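(* Let $\Gamma$ be a finitely generated, infinite group and let $\mathcal G=(V,E)$ be the Cayley graph of $\Gamma$ with respect to a finite symmetric generating set. Then $\Gamma$ has the Haagerup property if and only if for every $\alpha<1$ there exists a $\Gamma$-invariant bond percolation $\mathbb P$ on $\mathcal G$ such that $\mathbb E[\deg_\omega(o)]>\alpha\deg(o)$ and the two-point function $\tau(o,\cdot)$ vanishes at infinity.
   Context: Right Cayley graph: $V=\Gamma$ and $E=\{[g,gs]: g\in\Gamma, s\in S\}$, where $S$ is a finite symmetric generating set; $o\in\Gamma$ is the identity, $d$ the graph (word) metric, $\deg(o)$ the degree of $o$ in $\mathcal G$. $\Gamma$ acts on $\mathcal G$ by left multiplication. A bond percolation on $\mathcal G$ is a probability measure $\mathbb P$ on subsets $\omega$ of $E$ (product $\sigma$-algebra on $\{0,1\}^E$), with expectation $\mathbb E$; it is $\Gamma$-invariant if invariant under the induced action of $\Gamma$. The configuration $\omega$ is identified with the subgraph $(\Gamma,\omega)$; its connected components are called clusters; $\deg_\omega(o)$ is the degree of $o$ in $\omega$. The two-point function is $\tau(g,h)=\mathbb P[g\leftrightarrow h]$, the probability that $g$ and $h$ are in the same cluster. It vanishes at infinity (written $\tau(o,\cdot)\in C_0(\Gamma)$) if $\lim_{r\to\infty}\sup_{g,h\in\Gamma,\ d(g,h)>r}\tau(g,h)=0$. A finitely generated group $\Gamma$ has the Haagerup property if it admits an affine isometric action on a Hilbert space $H$ which is metrically proper, i.e. for every bounded $B\subset H$ the set $\{g\in\Gamma: gB\cap B\neq\emptyset\}$ is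 finite. *)

theory Defs
  imports "HOL-Probability.Probability" "HOL-Algebra.Module" "HOL-Algebra.Group_Action" "HOL-Algebra.Generated_Groups"
begin

section \<open>Hilbert spaces with an explicit carrier\<close>

text \<open>
  HOL does not allow quantification over types inside a formula, so ``there is a Hilbert space''
  is expressed by quantifying over Hilbert spaces whose underlying set is a subset of a
  type \<open>'h\<close>. The vector space structure is that of the HOL-Algebra locale \<open>module\<close> over the
  field of real numbers.
\<close>

definition real_field :: "real ring" where
  "real_field = \<lparr>carrier = UNIV, mult = (*), one = 1, zero = 0, add = (+)\<rparr>"

text \<open>
  The value outside the carrier only serves the locale \<open>Metric_space\<close>, which requires
  nonnegativity and symmetry of the distance for all arguments.
\<close>

definition ip_dist :: "(real, 'h) module \<Rightarrow> ('h \<Rightarrow> 'h \<Rightarrow> real) \<Rightarrow> 'h \<Rightarrow> 'h \<Rightarrow> real" where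
  "ip_dist H ip x y =
     (if x \<in> carrier H \<and> y \<in> carrier H then sqrt (ip (x \<ominus>\<^bsub>H\<^esub> y) (x \<ominus>\<^bsub>H\<^esub> y)) else 0)"

locale hilbert_space = Module.module real_field H
  for H :: "(real, 'h) module" (structure) +
  fixes ip :: "'h \<Rightarrow> 'h \<Rightarrow> real"
  assumes ip_commute: "\<lbrakk>x \<in> carrier H; y \<in> carrier H\<rbrakk> \<Longrightarrow> ip x y = ip y x"
    and ip_add_left: "\<lbrakk>x \<in> carrier H; y \<in> carrier H; z \<in> carrier H\<rbrakk>
          \<Longrightarrow> ip (x \<oplus> y) z = ip x z + ip y z"
    and ip_smult_left: "\<lbrakk>x \<in> carrier H; y \<in> carrier H\<rbrakk> \<Longrightarrow> ip (t \<odot> x) y = t * ip x y"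
    and ip_nonneg: "x \<in> carrier H \<Longrightarrow> 0 \<le> ip x x"
    and ip_eq_zero: "\<lbrakk>x \<in> carrier H; ip x x = 0\<rbrakk> \<Longrightarrow> x = \<zero>"
    and complete: "Metric_space.mcomplete (carrier H) (ip_dist H ip)"
begin

lemma ip_minus_left:
  assumes "x \<in> carrier H" "y \<in> carrier H" "z \<in> carrier H"
  shows "ip (x \<ominus> y) z = ip x z - ip y z"
proof -
  have "x \<ominus> y \<oplus> y = x"
    using assms by (simp add: M.minus_eq M.a_assoc M.l_neg)
  then show ?thesis
    using ip_add_left[of "x \<ominus> y" y z] assms by simp
qed

lemma ip_minus_right:
  assumes "x \<in> carrier H" "y \<in> carrier H" "z \<in> carrier H"
  shows "ip z (x \<ominus> y) = ip z x - ip z y"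
  using ip_minus_left[OF assms] assms by (simp add: ip_commute[of z])

lemma ip_Cauchy_Schwarz:
  assumes "x \<in> carrier H" "y \<in> carrier H"
  shows "\<bar>ip x y\<bar> \<le> sqrt (ip x x) * sqrt (ip y y)"
proof -
  have smc: "t \<odot> y \<in> carrier H" for t
    using assms by (simp add: smult_closed real_field_def)
  have pos: "0 \<le> ip x x - 2 * t * ip x y + t\<^sup>2 * ip y y" for t
  proof -
    have "0 \<le> ip (x \<ominus> t \<odot> y) (x \<ominus> t \<odot> y)"
      using assms smc by (intro ip_nonneg) simp
    also have "\<dots> = ip x x - 2 * t * ip x y + t\<^sup>2 * ip y y"
      using assms smc ip_commute[of x "t \<odot> y"] ip_commute[of y "t \<odot> y"] ip_commute[of y x]
      by (simp add: ip_minus_left ip_minus_right ip_smult_left power2_eq_square algebra_simps)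
    finally show ?thesis .
  qed
  have "(ip x y)\<^sup>2 \<le> ip x x * ip y y"
  proof (cases "ip y y = 0")
    case True
    have "ip x y = 0"
    proof (rule ccontr)
      assume "ip x y \<noteq> 0"
      then show False
        using pos[of "(ip x x + 1) / (2 * ip x y)"] True by simp
    qed
    then show ?thesis using True by simp
  next
    case False
    then have "0 < ip y y" using ip_nonneg[of y] assms by simp
    then show ?thesis
      using pos[of "ip x y / ip y y"] by (simp add: field_simps power2_eq_square)
  qed
  then show ?thesis
    by (metis real_sqrt_abs real_sqrt_le_mono real_sqrt_mult)
qed

lemma ip_triangle:
  assumes "x \<in> carrier H" "y \<in> carrier H"
  shows "sqrt (ip (x \<oplus> y) (x \<oplus> y)) \<le> sqrt (ip x x) + sqrt (ip y y)"
proof (rule real_le_lsqrt)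
  have "ip (x \<oplus> y) (x \<oplus> y) = ip x x + 2 * ip x y + ip y y"
    using assms ip_commute[of x "x \<oplus> y"] ip_commute[of y "x \<oplus> y"] ip_commute[of y x]
    by (simp add: ip_add_left)
  also have "\<dots> \<le> ip x x + 2 * (sqrt (ip x x) * sqrt (ip y y)) + ip y y"
    using ip_Cauchy_Schwarz[OF assms] by linarith
  also have "\<dots> = (sqrt (ip x x) + sqrt (ip y y))\<^sup>2"
    using assms by (simp add: power2_sum ip_nonneg)
  finally show "ip (x \<oplus> y) (x \<oplus> y) \<le> (sqrt (ip x x) + sqrt (ip y y))\<^sup>2" .
qed (use assms in \<open>auto simp: ip_nonneg\<close>)

sublocale Metric_space "carrier H" "ip_dist H ip"
proof
  show "0 \<le> ip_dist H ip x y" for x y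
    by (simp add: ip_dist_def ip_nonneg)
  show "ip_dist H ip x y = ip_dist H ip y x" for x y
    by (simp add: ip_dist_def ip_minus_left ip_minus_right)
  show "ip_dist H ip x y = 0 \<longleftrightarrow> x = y" if "x \<in> carrier H" "y \<in> carrier H" for x y
  proof
    assume "ip_dist H ip x y = 0"
    then have "x \<ominus> y = \<zero>"
      using that by (intro ip_eq_zero) (auto simp: ip_dist_def)
    moreover have "x \<ominus> y \<oplus> y = x"
      using that by (simp add: M.minus_eq M.a_assoc M.l_neg)
    ultimately show "x = y"
      using that by simp
  next
    assume "x = y"
    then show "ip_dist H ip x y = 0"
      using that by (simp add: ip_dist_def ip_minus_left)
  qed
  show "ip_dist H ip x z \<le> ip_dist H ip x y + ip_dist H ip y z"
    if "x \<in> carrier H" "y \<in> carrier H" "z \<in> carrier H" for x y z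
  proof -
    have "(x \<ominus> y) \<oplus> (y \<ominus> z) = x \<ominus> z"
      using that by (metis (no_types, lifting) M.a_assoc M.a_inv_closed M.l_neg M.l_zero
          M.minus_closed M.minus_eq)
    then show ?thesis
      using ip_triangle[of "x \<ominus> y" "y \<ominus> z"] that by (simp add: ip_dist_def)
  qed
qed

end

section \<open>The Haagerup property\<close>

text \<open>
  A \<open>group_action\<close> on a set is a homomorphism into the group of bijections of that set.
\<close>

definition affine_isometric_action ::
  "('a, 'b) monoid_scheme \<Rightarrow> (real, 'h) module \<Rightarrow> ('h \<Rightarrow> 'h \<Rightarrow> real) \<Rightarrow> ('a \<Rightarrow> 'h \<Rightarrow> 'h) \<Rightarrow> bool"
where
  "affine_isometric_action G H ip \<phi> \<longleftrightarrow>
     group_action G (carrier H) \<phi> \<and>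
     (\<forall>g\<in>carrier G. \<forall>x\<in>carrier H. \<forall>y\<in>carrier H. \<forall>t::real.
        \<phi> g ((1 - t) \<odot>\<^bsub>H\<^esub> x \<oplus>\<^bsub>H\<^esub> t \<odot>\<^bsub>H\<^esub> y) = (1 - t) \<odot>\<^bsub>H\<^esub> \<phi> g x \<oplus>\<^bsub>H\<^esub> t \<odot>\<^bsub>H\<^esub> \<phi> g y) \<and>
     (\<forall>g\<in>carrier G. \<forall>x\<in>carrier H. \<forall>y\<in>carrier H.
        ip_dist H ip (\<phi> g x) (\<phi> g y) = ip_dist H ip x y)"

definition metrically_proper ::
  "('a, 'b) monoid_scheme \<Rightarrow> (real, 'h) module \<Rightarrow> ('h \<Rightarrow> 'h \<Rightarrow> real) \<Rightarrow> ('a \<Rightarrow> 'h \<Rightarrow> 'h) \<Rightarrow> bool"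
where
  "metrically_proper G H ip \<phi> \<longleftrightarrow>
     (\<forall>B. Metric_space.mbounded (carrier H) (ip_dist H ip) B \<longrightarrow>
        finite {g \<in> carrier G. \<phi> g ` B \<inter> B \<noteq> {}})"

text \<open>
  The type \<open>'h\<close> is the universe from which the underlying set of the Hilbert space is taken. Any
  universe with at least continuum many elements contains a copy of every separable Hilbert space,
  and for such universes the property of a countable group does not depend on the choice of \<open>'h\<close>:
  an action on any Hilbert space restricts to the closed affine span of an orbit.
\<close>

definition haagerup :: "'h itself \<Rightarrow> ('a, 'b) monoid_scheme \<Rightarrow> bool" where
  "haagerup _ G \<longleftrightarrow>
     (\<exists>(H :: (real, 'h) module) ip \<phi>.
        hilbert_space H ip \<and> affine_isometric_action G H ip \<phi> \<and> metrically_proper G H ip \<phi>)"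

section \<open>Cayley graphs\<close>

text \<open>
  A graph on \<open>'a\<close> is given by its set of undirected edges, an edge being the set of its endpoints.
  The generating set may contain the identity, in which case the Cayley graph has a loop
  \<open>{g}\<close> at each vertex, which contributes one to the degree; thus \<open>deg(o) = |S|\<close> in all cases.
\<close>

definition cayley_edges :: "('a, 'b) monoid_scheme \<Rightarrow> 'a set \<Rightarrow> 'a set set" where
  "cayley_edges G S = {{g, g \<otimes>\<^bsub>G\<^esub> s} | g s. g \<in> carrier G \<and> s \<in> S}"

definition finite_symmetric_generating_set :: "('a, 'b) monoid_scheme \<Rightarrow> 'a set \<Rightarrow> bool" where
  "finite_symmetric_generating_set G S \<longleftrightarrow>
     finite S \<and> S \<subseteq> carrier G \<and> (\<forall>s\<in>S. inv\<^bsub>G\<^esub> s \<in> S) \<and> generate G S = carrier G"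

definition adjacency :: "'a set set \<Rightarrow> ('a \<times> 'a) set" where
  "adjacency \<omega> = {(x, y). {x, y} \<in> \<omega>}"

definition degree_in :: "'a set set \<Rightarrow> 'a \<Rightarrow> nat" where
  "degree_in \<omega> v = card {e \<in> \<omega>. v \<in> e}"

definition same_cluster :: "'a set set \<Rightarrow> 'a \<Rightarrow> 'a \<Rightarrow> bool" where
  "same_cluster \<omega> g h \<longleftrightarrow> (g, h) \<in> (adjacency \<omega>)\<^sup>*"

definition graph_dist :: "'a set set \<Rightarrow> 'a \<Rightarrow> 'a \<Rightarrow> nat" where
  "graph_dist E g h = (LEAST n. (g, h) \<in> adjacency E ^^ n)"

section \<open>Invariant bond percolation\<close>

text \<open>
  The measurable space of all subsets of \<open>E\<close>: the product sigma-algebra on the functions from \<open>E\<close>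
  to the booleans, transported along the identification of a subset with its indicator function.
\<close>

definition configuration_space :: "'e set \<Rightarrow> 'e set measure" where
  "configuration_space E =
     vimage_algebra (Pow E) (\<lambda>\<omega>. \<lambda>e\<in>E. e \<in> \<omega>) (\<Pi>\<^sub>M e\<in>E. count_space (UNIV :: bool set))"

definition bond_percolation :: "'e set \<Rightarrow> 'e set measure \<Rightarrow> bool" where
  "bond_percolation E P \<longleftrightarrow> prob_space P \<and> sets P = sets (configuration_space E)"

text \<open>
  The left translate of the edge \<open>e\<close> by \<open>\<gamma>\<close> is the left coset \<open>\<gamma> <# e\<close>.
\<close>

definition invariant_percolation :: "('a, 'b) monoid_scheme \<Rightarrow> 'a set set measure \<Rightarrow> bool" where
  "invariant_percolation G P \<longleftrightarrow>
     (\<forall>\<gamma>\<in>carrier G. distr P P (\<lambda>\<omega>. (\<lambda>e. \<gamma> <#\<^bsub>G\<^esub> e) ` \<omega>) = P)"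

definition two_point :: "'a set set measure \<Rightarrow> 'a \<Rightarrow> 'a \<Rightarrow> real" where
  "two_point P g h = measure P {\<omega> \<in> space P. same_cluster \<omega> g h}"

definition vanishes_at_infinity ::
  "('a, 'b) monoid_scheme \<Rightarrow> 'a set set \<Rightarrow> ('a \<Rightarrow> 'a \<Rightarrow> real) \<Rightarrow> bool"
where
  "vanishes_at_infinity G E \<tau> \<longleftrightarrow>
     ((\<lambda>r::real. SUP (g, h) \<in> {(g, h). g \<in> carrier G \<and> h \<in> carrier G \<and> real (graph_dist E g h) > r}.
          \<tau> g h) \<longlongrightarrow> 0) at_top"

end

(*
  If a group-invariant percolation has two-point function tau, then tau is an invariant positive
  definite kernel, being the expectation of the indicator of an equivalence relation. Summing
  1 - tau over a sequence of percolations whose edge densities tend to 1 fast enough gives a proper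
  conditionally negative definite function psi. The kernel -psi/2 has a reproducing kernel Hilbert
  space of functions on the group, on which the group acts properly by affine isometries.

  Conversely, let b(g) be the orbit of the origin under a proper affine isometric action, and let Y
  be the centered Gaussian field on the group with covariance <b(g), b(h)>, scaled by a small
  factor. The increments of Y form an invariant field. Keep an edge if and only if the integer parts
  of Y + u agree at its endpoints, where u is uniform in [0,1) and independent of Y. An edge is
  removed with probability at most the expected increment of Y along it, whereas g and h can only
  be connected if |Y(g) - Y(h)| < 1, whose probability decays like 1 / |b(g) - b(h)|.
*)
theory Submission
  imports Defs
begin

text \<open>The Hilbert space has to be a subset of \<open>'h\<close>. Realising it by functions on
  the countable group, of which there are only continuum many, achieves this and replaces the usual
  quotient and completion: the squared norm is a supremum over finite combinations, point
  evaluations are bounded by it, and completeness follows from pointwise limits. The price is that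
  no inner product is visible at first; it is recovered from the parallelogram law.

  In the converse direction the obstacle is that only the increments of \<open>Y\<close> are
  stationary: a translation by \<gamma> recentres \<open>Y\<close> by the random constant Y(inv
  \<gamma>). Modulo 1 this constant is a rotation, and the uniform law of \<open>u\<close> is
  invariant under rotations; this is the reason for \<open>u\<close>. The field is a triangular
  linear image of independent normals, so its value at each point is a finite sum, and equality in
  law of two fields is tested on characteristic functions of finite linear combinations.\<close>

section \<open>Hilbert spaces of real functions\<close>

text \<open>\<open>N\<close> is the squared norm. The axioms avoid an inner product because the
  \<open>N\<close> used later is a supremum, for which the parallelogram law has a direct proof.
  \<iota> only names the functions by elements of the universe.\<close>

locale quadratic_function_space =
  fixes V :: "('i \<Rightarrow> real) set" and N :: "('i \<Rightarrow> real) \<Rightarrow> real" and \<iota> :: "('i \<Rightarrow> real) \<Rightarrow> 'h"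
  assumes zero_mem: "(\<lambda>_. 0) \<in> V"
    and add_mem: "\<lbrakk>f \<in> V; g \<in> V\<rbrakk> \<Longrightarrow> (\<lambda>x. f x + g x) \<in> V"
    and scale_mem: "f \<in> V \<Longrightarrow> (\<lambda>x. t * f x) \<in> V"
    and N_nonneg: "f \<in> V \<Longrightarrow> 0 \<le> N f"
    and N_eq_0: "\<lbrakk>f \<in> V; N f = 0\<rbrakk> \<Longrightarrow> f = (\<lambda>_. 0)"
    and N_scale: "f \<in> V \<Longrightarrow> N (\<lambda>x. t * f x) = t\<^sup>2 * N f"
    and parallelogram: "\<lbrakk>f \<in> V; g \<in> V\<rbrakk> \<Longrightarrow>
          N (\<lambda>x. f x + g x) + N (\<lambda>x. f x - g x) = 2 * N f + 2 * N g"
    and N_complete: "\<And>f :: nat \<Rightarrow> 'i \<Rightarrow> real. (\<And>n. f n \<in> V) \<Longrightarrow>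
          (\<And>\<epsilon>. 0 < \<epsilon> \<Longrightarrow> \<exists>k. \<forall>m\<ge>k. \<forall>n\<ge>k. N (\<lambda>x. f m x - f n x) < \<epsilon>) \<Longrightarrow>
          \<exists>l\<in>V. (\<lambda>n. N (\<lambda>x. f n x - l x)) \<longlonglongrightarrow> 0"
    and inj_\<iota>: "inj_on \<iota> V"
begin

lemma diff_mem: "\<lbrakk>f \<in> V; g \<in> V\<rbrakk> \<Longrightarrow> (\<lambda>x. f x - g x) \<in> V"
  using add_mem[of f "\<lambda>x. (-1) * g x"] scale_mem[of g "-1"] by simp

lemma N_zero: "N (\<lambda>_. 0) = 0"
  using N_scale[OF zero_mem, of 0] by simp

lemma N_uminus: "f \<in> V \<Longrightarrow> N (\<lambda>x. - f x) = N f"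
  using N_scale[of f "-1"] by simp

definition inner_N :: "('i \<Rightarrow> real) \<Rightarrow> ('i \<Rightarrow> real) \<Rightarrow> real" where
  "inner_N f g = (N (\<lambda>x. f x + g x) - N (\<lambda>x. f x - g x)) / 4"

lemma inner_N_commute: "\<lbrakk>f \<in> V; g \<in> V\<rbrakk> \<Longrightarrow> inner_N f g = inner_N g f"
  using N_uminus[OF diff_mem[of f g]] by (simp add: inner_N_def add.commute)

lemma inner_N_self: "f \<in> V \<Longrightarrow> inner_N f f = N f"
  using N_scale[of f 2] by (simp add: inner_N_def N_zero)

text \<open>The parallelogram law alone makes the polarization additive (Jordan--von Neumann).\<close>

lemma inner_N_add:
  assumes "f \<in> V" "g \<in> V" "h \<in> V"
  shows "inner_N (\<lambda>x. f x + g x) h = inner_N f h + inner_N g h"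
proof -
  have p: "N (\<lambda>x. f x + g x + h x) + N (\<lambda>x. f x - g x - h x) = 2 * N f + 2 * N (\<lambda>x. g x + h x)"
    using parallelogram[of f "\<lambda>x. g x + h x"] assms add_mem by (simp add: algebra_simps)
  have q: "N (\<lambda>x. f x + g x - h x) + N (\<lambda>x. f x - g x + h x) = 2 * N f + 2 * N (\<lambda>x. g x - h x)"
    using parallelogram[of f "\<lambda>x. g x - h x"] assms diff_mem by (simp add: algebra_simps)
  have r: "N (\<lambda>x. f x - g x + h x) + N (\<lambda>x. f x - g x - h x) = 2 * N (\<lambda>x. f x - g x) + 2 * N h"
    using parallelogram[of "\<lambda>x. f x - g x" h] assms diff_mem by (simp add: algebra_simps)
  have p': "N (\<lambda>x. f x + g x + h x) + N (\<lambda>x. g x - f x - h x) = 2 * N g + 2 * N (\<lambda>x. f x + h x)"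
    using parallelogram[of g "\<lambda>x. f x + h x"] assms add_mem by (simp add: algebra_simps)
  have q': "N (\<lambda>x. f x + g x - h x) + N (\<lambda>x. g x - f x + h x) = 2 * N g + 2 * N (\<lambda>x. f x - h x)"
    using parallelogram[of g "\<lambda>x. f x - h x"] assms diff_mem by (simp add: algebra_simps)
  have s: "N (\<lambda>x. g x - f x - h x) = N (\<lambda>x. f x - g x + h x)"
    using N_uminus[OF add_mem[OF diff_mem[OF assms(1,2)] assms(3)]] by (simp add: algebra_simps)
  have s': "N (\<lambda>x. g x - f x + h x) = N (\<lambda>x. f x - g x - h x)"
    using N_uminus[OF diff_mem[OF diff_mem[OF assms(1,2)] assms(3)]] by (simp add: algebra_simps)
  \<comment> \<open>In \<open>p\<close> - \<open>q\<close> + \<open>p'\<close> - \<open>q'\<close>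
    the terms built from \<open>f - g\<close> cancel by \<open>s\<close> and \<open>s'\<close>,
    which leaves a multiple of the claim.\<close>
  show ?thesis
    using p q p' q' s s' unfolding inner_N_def by argo
qed

text \<open>Two nonnegative numbers differ by at most their sum. This gives the local boundedness in
  \<open>t\<close> that turns additivity into homogeneity.\<close>

lemma inner_N_bound:
  assumes "f \<in> V" "g \<in> V"
  shows "\<bar>inner_N (\<lambda>x. t * f x) g\<bar> \<le> (t\<^sup>2 * N f + N g) / 2"
proof -
  have "0 \<le> N (\<lambda>x. t * f x + g x)" "0 \<le> N (\<lambda>x. t * f x - g x)"
    using assms by (auto intro!: N_nonneg add_mem diff_mem scale_mem)
  moreover have "N (\<lambda>x. t * f x + g x) + N (\<lambda>x. t * f x - g x) = 2 * (t\<^sup>2 * N f) + 2 * N g"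
    using parallelogram[of "\<lambda>x. t * f x" g] assms by (simp add: N_scale scale_mem)
  ultimately show ?thesis
    unfolding inner_N_def by (simp add: abs_le_iff field_simps)
qed

end

text \<open>Subtracting the linear function with the same value at 1 leaves an additive function
  that vanishes on the integers. It has period 1, hence is bounded everywhere, and a bounded
  additive function is zero because it grows linearly along multiples.\<close>

lemma additive_bounded_imp_linear:
  fixes A :: "real \<Rightarrow> real"
  assumes add: "\<And>s t. A (s + t) = A s + A t" and bd: "\<And>t. \<lbrakk>0 \<le> t; t \<le> 1\<rbrakk> \<Longrightarrow> \<bar>A t\<bar> \<le> C"
  shows "A t = t * A 1"
proof -
  define B where "B s = A s - s * A 1" for s
  have Badd: "B (s + t) = B s + B t" for s t
    by (simp add: B_def add algebra_simps)
  have B0: "B 0 = 0" using Badd[of 0 0] by simp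
  have Bm: "B (- s) = - B s" for s using Badd[of s "- s"] B0 by simp
  have Bn: "B (of_nat n * s) = of_nat n * B s" for n s
    by (induction n) (simp_all add: B0 Badd algebra_simps)
  have B1: "B 1 = 0" by (simp add: B_def)
  have Bint: "B (of_int k) = 0" for k
    by (cases k rule: int_cases2) (use Bn[of _ 1] B1 Bm in auto)
  have Bbd: "\<bar>B s\<bar> \<le> C + \<bar>A 1\<bar>" for s
  proof -
    have "B s = B (frac s)" using Badd[of "frac s" "of_int \<lfloor>s\<rfloor>"] Bint by (simp add: frac_def)
    moreover have "\<bar>B (frac s)\<bar> \<le> \<bar>A (frac s)\<bar> + \<bar>frac s * A 1\<bar>" by (simp add: B_def)
    moreover have "\<bar>frac s * A 1\<bar> \<le> \<bar>A 1\<bar>"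
      by (simp add: abs_mult mult_left_le_one_le frac_lt_1 less_imp_le)
    moreover have "\<bar>A (frac s)\<bar> \<le> C" by (intro bd) (simp_all add: frac_lt_1 less_imp_le)
    ultimately show ?thesis by linarith
  qed
  have "B t = 0"
  proof (rule ccontr)
    assume "B t \<noteq> 0"
    then obtain n :: nat where "C + \<bar>A 1\<bar> < of_nat n * \<bar>B t\<bar>"
      using reals_Archimedean3[of "\<bar>B t\<bar>"] by auto
    then show False using Bbd[of "of_nat n * t"] by (simp add: Bn abs_mult)
  qed
  then show ?thesis by (simp add: B_def)
qed

context quadratic_function_space
begin

lemma inner_N_scale:
  assumes "f \<in> V" "g \<in> V"
  shows "inner_N (\<lambda>x. t * f x) g = t * inner_N f g"
proof -
  define A where "A t = inner_N (\<lambda>x. t * f x) g" for t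
  have "A (s + t) = A s + A t" for s t
    using inner_N_add[of "\<lambda>x. s * f x" "\<lambda>x. t * f x" g] assms
    by (simp add: A_def scale_mem distrib_right)
  moreover have "\<bar>A t\<bar> \<le> (N f + N g) / 2" if "0 \<le> t" "t \<le> 1" for t
  proof -
    have "t\<^sup>2 * N f \<le> N f"
      using that N_nonneg[OF assms(1)] by (simp add: mult_left_le_one_le power_le_one)
    then show ?thesis using inner_N_bound[OF assms, of t] unfolding A_def by argo
  qed
  ultimately have "A t = t * A 1" by (rule additive_bounded_imp_linear)
  then show ?thesis by (simp add: A_def)
qed

abbreviation fun_of :: "'h \<Rightarrow> 'i \<Rightarrow> real" where "fun_of \<equiv> inv_into V \<iota>"

definition hmod :: "(real, 'h) module" where
  "hmod = \<lparr>carrier = \<iota> ` V, mult = (\<lambda>_ _. \<iota> (\<lambda>_. 0)), one = \<iota> (\<lambda>_. 0), zero = \<iota> (\<lambda>_. 0),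
     add = (\<lambda>x y. \<iota> (\<lambda>i. fun_of x i + fun_of y i)),
     smult = (\<lambda>t x. \<iota> (\<lambda>i. t * fun_of x i))\<rparr>"

definition hip :: "'h \<Rightarrow> 'h \<Rightarrow> real" where
  "hip x y = inner_N (fun_of x) (fun_of y)"

lemma fun_of_\<iota> [simp]: "f \<in> V \<Longrightarrow> fun_of (\<iota> f) = f"
  by (simp add: inj_\<iota>)

lemma carrier_hmod: "carrier hmod = \<iota> ` V"
  by (simp add: hmod_def)

lemma fun_of_mem: "x \<in> carrier hmod \<Longrightarrow> fun_of x \<in> V"
  by (simp add: carrier_hmod inv_into_into)

lemma \<iota>_fun_of: "x \<in> carrier hmod \<Longrightarrow> \<iota> (fun_of x) = x"
  by (simp add: carrier_hmod f_inv_into_f)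

lemma add_hmod: "\<lbrakk>f \<in> V; g \<in> V\<rbrakk> \<Longrightarrow> \<iota> f \<oplus>\<^bsub>hmod\<^esub> \<iota> g = \<iota> (\<lambda>x. f x + g x)"
  by (simp add: hmod_def)

lemma smult_hmod: "f \<in> V \<Longrightarrow> t \<odot>\<^bsub>hmod\<^esub> \<iota> f = \<iota> (\<lambda>x. t * f x)"
  by (simp add: hmod_def)

lemma zero_hmod: "\<zero>\<^bsub>hmod\<^esub> = \<iota> (\<lambda>_. 0)"
  by (simp add: hmod_def)

lemma cring_real_field: "cring real_field"
proof (rule cringI)
  show "abelian_group real_field"
  proof (rule abelian_groupI)
    fix x :: real
    show "\<exists>y\<in>carrier real_field. y \<oplus>\<^bsub>real_field\<^esub> x = \<zero>\<^bsub>real_field\<^esub>"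
      by (rule bexI[of _ "- x"]) (simp_all add: real_field_def)
  qed (simp_all add: real_field_def)
  show "Group.comm_monoid real_field"
    by (rule comm_monoidI) (simp_all add: real_field_def)
qed (simp add: real_field_def distrib_right)

lemma abelian_group_hmod: "abelian_group hmod"
proof (rule abelian_groupI)
  fix x assume "x \<in> carrier hmod"
  then obtain f where f: "f \<in> V" "x = \<iota> f" by (auto simp: carrier_hmod)
  then show "\<exists>y\<in>carrier hmod. y \<oplus>\<^bsub>hmod\<^esub> x = \<zero>\<^bsub>hmod\<^esub>"
    using scale_mem[of f "-1"]
    by (intro bexI[of _ "\<iota> (\<lambda>x. - 1 * f x)"]) (auto simp: add_hmod zero_hmod carrier_hmod)
qed (auto simp: carrier_hmod add_hmod zero_hmod zero_mem add_mem add.commute add.left_commute)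

lemma module_hmod: "Module.module real_field hmod"
proof (rule moduleI)
  show "cring real_field" by (rule cring_real_field)
  show "abelian_group hmod" by (rule abelian_group_hmod)
qed (auto simp: carrier_hmod smult_hmod add_hmod scale_mem add_mem real_field_def algebra_simps)

lemma minus_hmod:
  assumes "f \<in> V" "g \<in> V"
  shows "\<iota> f \<ominus>\<^bsub>hmod\<^esub> \<iota> g = \<iota> (\<lambda>x. f x - g x)"
proof -
  interpret abelian_group hmod by (rule abelian_group_hmod)
  have "\<ominus>\<^bsub>hmod\<^esub> \<iota> g = \<iota> (\<lambda>x. - 1 * g x)"
    using assms scale_mem[of g "-1"]
    by (intro minus_equality) (auto simp: add_hmod zero_hmod carrier_hmod)
  then show ?thesis
    using assms scale_mem[of g "-1"] by (simp add: minus_eq add_hmod)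
qed

lemma ip_dist_hmod:
  "\<lbrakk>f \<in> V; g \<in> V\<rbrakk> \<Longrightarrow> ip_dist hmod hip (\<iota> f) (\<iota> g) = sqrt (N (\<lambda>x. f x - g x))"
  by (simp add: ip_dist_def carrier_hmod minus_hmod hip_def diff_mem inner_N_self)

text \<open>Cauchy-Schwarz by the minimum of the quadratic polynomial t -> N(t f + g). It is proved
  here because completeness, an axiom of \<open>hilbert_space\<close>, can only be discussed once
  the distance is known to be a metric.\<close>

lemma sqrt_N_triangle:
  assumes "f \<in> V" "g \<in> V"
  shows "sqrt (N (\<lambda>x. f x + g x)) \<le> sqrt (N f) + sqrt (N g)"
proof -
  have fg: "N (\<lambda>x. t * f x + g x) = t\<^sup>2 * N f + 2 * t * inner_N f g + N g" for t
    using parallelogram[of "\<lambda>x. t * f x" g] inner_N_scale[of f g t] assms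
    by (simp add: inner_N_def N_scale scale_mem algebra_simps) argo
  have pos: "0 \<le> t\<^sup>2 * N f + 2 * t * inner_N f g + N g" for t
    unfolding fg[symmetric] using assms by (auto intro!: N_nonneg add_mem scale_mem)
  have cs: "(inner_N f g)\<^sup>2 \<le> N f * N g"
  proof (cases "N f = 0")
    case True
    then have "f = (\<lambda>_. 0)" using assms N_eq_0 by blast
    then show ?thesis using assms True N_uminus[OF assms(2)] by (simp add: inner_N_def)
  next
    case False
    then have "0 < N f" using N_nonneg[OF assms(1)] by simp
    then show ?thesis
      using pos[of "- inner_N f g / N f"] by (simp add: field_simps power2_eq_square)
  qed
  have nn: "0 \<le> N f" "0 \<le> N g" using assms N_nonneg by auto
  have "\<bar>inner_N f g\<bar> \<le> sqrt (N f) * sqrt (N g)"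
    using real_sqrt_le_mono[OF cs] by (simp add: real_sqrt_mult)
  then have "N (\<lambda>x. f x + g x) \<le> (sqrt (N f) + sqrt (N g))\<^sup>2"
    using fg[of 1] nn by (simp add: power2_sum)
  then show ?thesis
    using nn by (intro real_le_lsqrt) auto
qed

lemma hilbert_space_hmod: "hilbert_space hmod hip"
proof -
  interpret Module.module real_field hmod by (rule module_hmod)
  have tri: "ip_dist hmod hip (\<iota> f) (\<iota> k) \<le> ip_dist hmod hip (\<iota> f) (\<iota> g) + ip_dist hmod hip (\<iota> g) (\<iota> k)"
    if "f \<in> V" "g \<in> V" "k \<in> V" for f g k
    using sqrt_N_triangle[of "\<lambda>x. f x - g x" "\<lambda>x. g x - k x"] that
    by (simp add: ip_dist_hmod diff_mem)
  interpret Metric_space "carrier hmod" "ip_dist hmod hip"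
  proof
    show "0 \<le> ip_dist hmod hip x y" for x y
      using N_nonneg[OF diff_mem[of "fun_of x" "fun_of y"]] ip_dist_hmod[of "fun_of x" "fun_of y"]
      by (cases "x \<in> carrier hmod \<and> y \<in> carrier hmod")
        (auto simp: fun_of_mem \<iota>_fun_of, auto simp: ip_dist_def)
    show "ip_dist hmod hip x y = ip_dist hmod hip y x" for x y
    proof (cases "x \<in> carrier hmod \<and> y \<in> carrier hmod")
      case True
      then obtain f g where "f \<in> V" "g \<in> V" "x = \<iota> f" "y = \<iota> g" by (auto simp: carrier_hmod)
      then show ?thesis
        using N_uminus[OF diff_mem[of f g]] by (simp add: ip_dist_hmod)
    qed (auto simp: ip_dist_def)
    show "ip_dist hmod hip x y = 0 \<longleftrightarrow> x = y" if xy: "x \<in> carrier hmod" "y \<in> carrier hmod" for x y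
    proof -
      obtain f g where fg: "f \<in> V" "g \<in> V" "x = \<iota> f" "y = \<iota> g" using xy unfolding carrier_hmod by blast
      have "N (\<lambda>x. f x - g x) = 0 \<longleftrightarrow> f = g"
        using N_eq_0[OF diff_mem[OF fg(1,2)]] N_zero by (auto simp: fun_eq_iff)
      then show ?thesis using fg inj_\<iota> by (auto simp: ip_dist_hmod inj_on_eq_iff)
    qed
    show "ip_dist hmod hip x z \<le> ip_dist hmod hip x y + ip_dist hmod hip y z"
      if "x \<in> carrier hmod" "y \<in> carrier hmod" "z \<in> carrier hmod" for x y z
      using that tri by (auto simp: carrier_hmod)
  qed
  show ?thesis
  proof
    show "hip x y = hip y x" if "x \<in> carrier hmod" "y \<in> carrier hmod" for x y
      using that by (simp add: hip_def inner_N_commute fun_of_mem)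
    show "hip (x \<oplus>\<^bsub>hmod\<^esub> y) z = hip x z + hip y z"
      if "x \<in> carrier hmod" "y \<in> carrier hmod" "z \<in> carrier hmod" for x y z
      using that by (auto simp: carrier_hmod add_hmod add_mem hip_def inner_N_add)
    show "hip (t \<odot>\<^bsub>hmod\<^esub> x) y = t * hip x y" if "x \<in> carrier hmod" "y \<in> carrier hmod" for t x y
      using that by (auto simp: carrier_hmod smult_hmod scale_mem hip_def inner_N_scale)
    show "0 \<le> hip x x" if "x \<in> carrier hmod" for x
      using that by (simp add: hip_def inner_N_self fun_of_mem N_nonneg)
    show "x = \<zero>\<^bsub>hmod\<^esub>" if "x \<in> carrier hmod" "hip x x = 0" for x
      using that N_eq_0 by (auto simp: hip_def inner_N_self zero_hmod carrier_hmod)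
    show "mcomplete"
      unfolding mcomplete_def
    proof (intro allI impI)
      fix \<sigma> assume \<sigma>: "MCauchy \<sigma>"
      define f where "f n = fun_of (\<sigma> n)" for n
      have \<sigma>c: "\<sigma> n \<in> carrier hmod" for n using \<sigma> by (auto simp: MCauchy_def)
      then have f: "f n \<in> V" and \<sigma>f: "\<sigma> n = \<iota> (f n)" for n
        by (simp_all add: f_def fun_of_mem \<iota>_fun_of)
      have "\<exists>k. \<forall>m\<ge>k. \<forall>n\<ge>k. N (\<lambda>x. f m x - f n x) < \<epsilon>" if "0 < \<epsilon>" for \<epsilon>
      proof -
        have "0 < sqrt \<epsilon>" using that by simp
        then obtain k where "\<forall>n n'. k \<le> n \<longrightarrow> k \<le> n' \<longrightarrow> ip_dist hmod hip (\<sigma> n) (\<sigma> n') < sqrt \<epsilon>"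
          using \<sigma> unfolding MCauchy_def by metis
        then show ?thesis by (auto simp: \<sigma>f ip_dist_hmod f)
      qed
      then obtain l where l: "l \<in> V" "(\<lambda>n. N (\<lambda>x. f n x - l x)) \<longlonglongrightarrow> 0"
        using N_complete[of f] f by blast
      have "(\<lambda>n. ip_dist hmod hip (\<sigma> n) (\<iota> l)) \<longlonglongrightarrow> 0"
        using tendsto_real_sqrt[OF l(2)] by (simp add: \<sigma>f ip_dist_hmod f l)
      then show "\<exists>x. limitin mtopology \<sigma> x sequentially"
        using l(1) \<sigma>c unfolding limitin_metric_dist_null
        by (intro exI[of _ "\<iota> l"]) (simp add: carrier_hmod)
    qed
  qed
qed

end

section \<open>Reproducing kernel spaces\<close>

text \<open>A list stands for a finitely supported signed measure and \<open>lin\<close> integrates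
  against it. Repeated points are allowed, so that the sum of two measures is plain concatenation
  and needs no normal form.\<close>

definition lin :: "(real \<times> 'i) list \<Rightarrow> ('i \<Rightarrow> real) \<Rightarrow> real" where
  "lin c f = (\<Sum>(t, x)\<leftarrow>c. t * f x)"

definition scale_comb :: "real \<Rightarrow> (real \<times> 'i) list \<Rightarrow> (real \<times> 'i) list" where
  "scale_comb r c = map (\<lambda>(t, x). (r * t, x)) c"

definition form :: "('i \<Rightarrow> 'i \<Rightarrow> real) \<Rightarrow> (real \<times> 'i) list \<Rightarrow> (real \<times> 'i) list \<Rightarrow> real" where
  "form L c d = lin c (\<lambda>x. lin d (L x))"

lemma lin_Nil [simp]: "lin [] f = 0"
  and lin_Cons [simp]: "lin ((t, x) # c) f = t * f x + lin c f"
  by (simp_all add: lin_def)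

lemma lin_append [simp]: "lin (c @ d) f = lin c f + lin d f"
  by (simp add: lin_def)

lemma lin_scale_comb [simp]: "lin (scale_comb r c) f = r * lin c f"
  by (induction c) (auto simp: scale_comb_def algebra_simps)

lemma lin_add: "lin c (\<lambda>x. f x + g x) = lin c f + lin c g"
  and lin_diff: "lin c (\<lambda>x. f x - g x) = lin c f - lin c g"
  and lin_scale: "lin c (\<lambda>x. r * f x) = r * lin c f"
  by (induction c) (auto simp: algebra_simps)

lemma lin_const: "lin c (\<lambda>_. r) = r * lin c (\<lambda>_. 1)"
  using lin_scale[of c r "\<lambda>_. 1"] by simp

lemma lin_0 [simp]: "lin c (\<lambda>_. 0) = 0"
  using lin_const[of c 0] by simp

lemma lin_sum: "lin c (\<lambda>x. \<Sum>v\<in>F. f v x) = (\<Sum>v\<in>F. lin c (f v))"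
  by (induction F rule: infinite_finite_induct) (simp_all add: lin_add)

lemma lin_uminus: "lin c (\<lambda>x. - f x) = - lin c f"
  using lin_scale[of c "-1" f] by simp

lemma lin_scale_right: "lin c (\<lambda>x. f x * r) = lin c f * r"
  using lin_scale[of c r f] by (simp add: mult.commute)

lemma lin_cong: "(\<And>x. x \<in> snd ` set c \<Longrightarrow> f x = g x) \<Longrightarrow> lin c f = lin c g"
  by (induction c) auto

lemma lin_swap: "lin c (\<lambda>x. lin d (F x)) = lin d (\<lambda>y. lin c (\<lambda>x. F x y))"
proof (induction c)
  case (Cons p c)
  then show ?case by (cases p) (simp add: lin_add lin_scale)
qed simp

lemma lin_map_snd: "lin (map (map_prod id p) c) f = lin c (\<lambda>x. f (p x))"
  by (induction c) auto

lemma tendsto_lin: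
  assumes "\<And>x. (\<lambda>n. F n x) \<longlonglongrightarrow> l x"
  shows "(\<lambda>n. lin c (F n)) \<longlonglongrightarrow> lin c l"
proof (induction c)
  case (Cons p c)
  then show ?case by (cases p) (auto intro!: tendsto_intros assms)
qed simp

lemma set_scale_comb [simp]: "snd ` set (scale_comb r c) = snd ` set c"
  by (force simp: scale_comb_def)

lemma form_append: "form L (c @ d) (c @ d) = form L c c + form L c d + form L d c + form L d d"
  by (simp add: form_def lin_add)

lemma form_scale: "form L (scale_comb r c) (scale_comb s d) = r * s * form L c d"
  by (simp add: form_def lin_scale)

text \<open>Cauchy-Schwarz for forms that may be degenerate: the left side is largest at t = x / b,
  and for b = 0 a linear function bounded above is constant.\<close>

lemma square_le_of_quadratic:
  fixes x b n :: real
  assumes "\<And>t. 2 * t * x - t\<^sup>2 * b \<le> n" "0 \<le> b" "0 \<le> n"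
  shows "x\<^sup>2 \<le> n * b"
proof (cases "b = 0")
  case True
  have "x = 0"
  proof (rule ccontr)
    assume "x \<noteq> 0"
    \<comment> \<open>With \<open>b = 0\<close> this \<open>t\<close> makes the left side equal to n
      + 1.\<close>
    then show False using assms(1)[of "(n + 1) / (2 * x)"] True by simp
  qed
  then show ?thesis using assms by simp
next
  case False
  then show ?thesis using assms(1)[of "x / b"] assms(2) by (simp add: field_simps power2_eq_square)
qed

text \<open>Combinations of total mass zero do not see constants, so functions are determined by
  them only up to a constant; \<open>e\<close> is the base point at which they are normalised to
  vanish.\<close>

locale conditionally_positive_kernel =
  fixes I :: "'i set" and e :: 'i and L :: "'i \<Rightarrow> 'i \<Rightarrow> real"
  assumes e_mem: "e \<in> I"
    and L_commute: "\<lbrakk>x \<in> I; y \<in> I\<rbrakk> \<Longrightarrow> L x y = L y x"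
    and L_positive: "\<lbrakk>snd ` set c \<subseteq> I; lin c (\<lambda>_. 1) = 0\<rbrakk> \<Longrightarrow> 0 \<le> form L c c"
begin

definition combs :: "(real \<times> 'i) list set" where
  "combs = {c. snd ` set c \<subseteq> I \<and> lin c (\<lambda>_. 1) = 0}"

text \<open>
  Half the squared norm of the functional \<open>f\<close> is the Legendre transform of half the form, whence
  the expression below.
\<close>

definition legendre :: "('i \<Rightarrow> real) \<Rightarrow> (real \<times> 'i) list \<Rightarrow> real" where
  "legendre f c = 2 * lin c f - form L c c"

text \<open>The functions that are bounded as functionals on \<open>combs\<close> with the seminorm
  given by \<open>form L c c\<close>. Vanishing at \<open>e\<close> and off \<open>I\<close> lets
  the functional determine the function.\<close>

definition V :: "('i \<Rightarrow> real) set" where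
  "V = {f. (\<forall>x. x \<notin> I \<longrightarrow> f x = 0) \<and> f e = 0 \<and> bdd_above (legendre f ` combs)}"

definition N :: "('i \<Rightarrow> real) \<Rightarrow> real" where
  "N f = (SUP c\<in>combs. legendre f c)"

lemma Nil_combs: "[] \<in> combs"
  and append_combs: "\<lbrakk>c \<in> combs; d \<in> combs\<rbrakk> \<Longrightarrow> c @ d \<in> combs"
  and scale_combs: "c \<in> combs \<Longrightarrow> scale_comb r c \<in> combs"
  by (auto simp: combs_def)

lemma form_commute: "\<lbrakk>c \<in> combs; d \<in> combs\<rbrakk> \<Longrightarrow> form L c d = form L d c"
  unfolding form_def by (subst lin_swap) (auto simp: combs_def intro!: lin_cong L_commute)

lemma form_nonneg: "c \<in> combs \<Longrightarrow> 0 \<le> form L c c"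
  by (simp add: combs_def L_positive)

lemma legendre_le_N: "\<lbrakk>f \<in> V; c \<in> combs\<rbrakk> \<Longrightarrow> legendre f c \<le> N f"
  unfolding N_def V_def by (intro cSUP_upper) auto

lemma N_le: "(\<And>c. c \<in> combs \<Longrightarrow> legendre f c \<le> b) \<Longrightarrow> N f \<le> b"
  unfolding N_def using Nil_combs by (intro cSUP_least) auto

lemma V_I:
  assumes "\<And>x. x \<notin> I \<Longrightarrow> f x = 0" "f e = 0" "\<And>c. c \<in> combs \<Longrightarrow> legendre f c \<le> b"
  shows "f \<in> V"
  using assms by (auto simp: V_def intro!: bdd_aboveI2)

lemma N_nonneg: "f \<in> V \<Longrightarrow> 0 \<le> N f"
  using legendre_le_N[OF _ Nil_combs] by (fastforce simp: legendre_def form_def)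

text \<open>For t nonzero, replacing c by c / t pulls out the factor t squared, since
  \<open>lin\<close> is of degree one and the form of degree two in c.\<close>

lemma scale_bound:
  assumes "f \<in> V" "c \<in> combs"
  shows "legendre (\<lambda>x. t * f x) c \<le> t\<^sup>2 * N f"
proof (cases "t = 0")
  case True
  then show ?thesis using form_nonneg[OF assms(2)] by (simp add: legendre_def)
next
  case False
  have "legendre (\<lambda>x. t * f x) c = t\<^sup>2 * legendre f (scale_comb (1 / t) c)"
    using False by (simp add: legendre_def form_scale lin_scale field_simps power2_eq_square)
  then show ?thesis
    using legendre_le_N[OF assms(1) scale_combs[OF assms(2)]] by (simp add: mult_left_mono)
qed

lemma scale_V: "f \<in> V \<Longrightarrow> (\<lambda>x. t * f x) \<in> V"
  using scale_bound by (intro V_I[of _ "t\<^sup>2 * N f"]) (auto simp: V_def)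

lemma N_scale_le: "f \<in> V \<Longrightarrow> N (\<lambda>x. t * f x) \<le> t\<^sup>2 * N f"
  by (intro N_le scale_bound)

lemma N_scale: "f \<in> V \<Longrightarrow> N (\<lambda>x. t * f x) = t\<^sup>2 * N f"
proof (cases "t = 0")
  case True
  assume f: "f \<in> V"
  show ?thesis using True N_scale_le[OF f, of t] N_nonneg[OF scale_V[OF f, of t]] by simp
next
  case False
  assume f: "f \<in> V"
  have "N (\<lambda>x. (1 / t) * (t * f x)) \<le> (1 / t)\<^sup>2 * N (\<lambda>x. t * f x)"
    by (intro N_scale_le scale_V f)
  moreover have "(\<lambda>x. (1 / t) * (t * f x)) = f" using False by simp
  ultimately have "t\<^sup>2 * N f \<le> N (\<lambda>x. t * f x)"
    using False by (simp add: power_one_over pos_le_divide_eq mult.commute)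
  then show ?thesis using N_scale_le[OF f, of t] by simp
qed

text \<open>\<open>legendre\<close> is affine in the function, so its value at f + g is the mean of
  its values at 2f and 2g.\<close>

lemma add_V:
  assumes "f \<in> V" "g \<in> V"
  shows "(\<lambda>x. f x + g x) \<in> V"
proof (rule V_I[of _ "N (\<lambda>x. 2 * f x) / 2 + N (\<lambda>x. 2 * g x) / 2"])
  fix c assume c: "c \<in> combs"
  have "legendre (\<lambda>x. f x + g x) c = legendre (\<lambda>x. 2 * f x) c / 2 + legendre (\<lambda>x. 2 * g x) c / 2"
    by (simp only: legendre_def lin_add lin_scale) (simp add: field_simps)
  then show "legendre (\<lambda>x. f x + g x) c \<le> N (\<lambda>x. 2 * f x) / 2 + N (\<lambda>x. 2 * g x) / 2"
    using legendre_le_N[OF scale_V[OF assms(1), of 2] c] legendre_le_N[OF scale_V[OF assms(2), of 2] c]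
    by simp
qed (use assms in \<open>auto simp: V_def\<close>)

lemma diff_V: "\<lbrakk>f \<in> V; g \<in> V\<rbrakk> \<Longrightarrow> (\<lambda>x. f x - g x) \<in> V"
  using add_V[of f "\<lambda>x. (-1) * g x"] scale_V[of g "-1"] by simp

lemma zero_V: "(\<lambda>_. 0) \<in> V"
  using form_nonneg by (intro V_I[of _ 0]) (auto simp: legendre_def)

text \<open>For fixed \<open>c\<close> and \<open>d\<close> the parallelogram identity of the form,
  applied to (c + d) / 2 and (c - d) / 2, trades the pair f + g, f - g for f, g. The two suprema are
  then taken one after the other.\<close>

lemma parallelogram_le:
  assumes "f \<in> V" "g \<in> V"
  shows "N (\<lambda>x. f x + g x) + N (\<lambda>x. f x - g x) \<le> 2 * N f + 2 * N g"
proof -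
  have *: "legendre (\<lambda>x. f x + g x) c + legendre (\<lambda>x. f x - g x) d \<le> 2 * N f + 2 * N g"
    if c: "c \<in> combs" and d: "d \<in> combs" for c d
  proof -
    let ?p = "scale_comb (1/2) (c @ d)" and ?m = "scale_comb (1/2) (c @ scale_comb (-1) d)"
    have "legendre (\<lambda>x. f x + g x) c + legendre (\<lambda>x. f x - g x) d
        = 2 * legendre f ?p + 2 * legendre g ?m"
    proof -
      have "form L c (scale_comb (-1) d) = - form L c d" "form L (scale_comb (-1) d) c = - form L d c"
        by (simp_all add: form_def lin_scale lin_uminus)
      then show ?thesis
        by (simp add: legendre_def form_scale form_append lin_add lin_diff field_simps)
    qed
    then show ?thesis
      using legendre_le_N[OF assms(1), of ?p] legendre_le_N[OF assms(2), of ?m] c d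
      by (simp add: scale_combs append_combs)
  qed
  have "N (\<lambda>x. f x + g x) \<le> 2 * N f + 2 * N g - N (\<lambda>x. f x - g x)"
  proof (rule N_le)
    fix c assume c: "c \<in> combs"
    have "N (\<lambda>x. f x - g x) \<le> 2 * N f + 2 * N g - legendre (\<lambda>x. f x + g x) c"
      using *[OF c] by (intro N_le) (simp add: algebra_simps)
    then show "legendre (\<lambda>x. f x + g x) c \<le> 2 * N f + 2 * N g - N (\<lambda>x. f x - g x)" by simp
  qed
  then show ?thesis by simp
qed

text \<open>The opposite inequality is \<open>parallelogram_le\<close> for f + g and f - g, whose
  sum and difference are 2f and 2g.\<close>

lemma parallelogram:
  assumes "f \<in> V" "g \<in> V"
  shows "N (\<lambda>x. f x + g x) + N (\<lambda>x. f x - g x) = 2 * N f + 2 * N g"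
proof -
  have "N (\<lambda>x. 2 * f x) + N (\<lambda>x. 2 * g x) \<le> 2 * N (\<lambda>x. f x + g x) + 2 * N (\<lambda>x. f x - g x)"
    using parallelogram_le[OF add_V[OF assms] diff_V[OF assms]] by simp
  then show ?thesis using parallelogram_le[OF assms] assms by (simp add: N_scale)
qed

lemma lin_square_le:
  assumes "f \<in> V" "c \<in> combs"
  shows "(lin c f)\<^sup>2 \<le> N f * form L c c"
proof (rule square_le_of_quadratic)
  show "2 * t * lin c f - t\<^sup>2 * form L c c \<le> N f" for t
    using legendre_le_N[OF assms(1) scale_combs[OF assms(2), of t]]
    by (simp add: legendre_def form_scale power2_eq_square)
qed (use assms form_nonneg N_nonneg in auto)

lemma point_combs: "x \<in> I \<Longrightarrow> [(1, x), (-1, e)] \<in> combs"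
  using e_mem by (simp add: combs_def)

text \<open>Continuity of point evaluations, the reproducing property: as f vanishes at
  \<open>e\<close>, the mass-zero combination of \<open>x\<close> and \<open>e\<close> already
  computes f x.\<close>

lemma square_le:
  assumes "f \<in> V" "x \<in> I"
  shows "(f x)\<^sup>2 \<le> N f * form L [(1, x), (-1, e)] [(1, x), (-1, e)]"
  using lin_square_le[OF assms(1) point_combs[OF assms(2)]] assms(1) by (simp add: V_def)

lemma N_eq_0:
  assumes "f \<in> V" "N f = 0"
  shows "f = (\<lambda>_. 0)"
proof
  fix x show "f x = 0"
    using square_le[OF assms(1), of x] assms by (cases "x \<in> I") (auto simp: V_def)
qed

text \<open>Evaluations are continuous, so a Cauchy sequence converges pointwise. \<open>N\<close>
  is a supremum of pointwise continuous functions, hence lower semicontinuous, and the Cauchy bounds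
  pass to the limit.\<close>

lemma N_complete:
  assumes f: "\<And>n :: nat. f n \<in> V"
    and cau: "\<And>\<epsilon>. 0 < \<epsilon> \<Longrightarrow> \<exists>k. \<forall>m\<ge>k. \<forall>n\<ge>k. N (\<lambda>x. f m x - f n x) < \<epsilon>"
  shows "\<exists>l\<in>V. (\<lambda>n. N (\<lambda>x. f n x - l x)) \<longlonglongrightarrow> 0"
proof -
  have "convergent (\<lambda>n. f n x)" for x
  proof (cases "x \<in> I")
    case True
    define D where "D = form L [(1, x), (-1, e)] [(1, x), (-1, e)]"
    have D: "0 \<le> D" unfolding D_def by (intro form_nonneg point_combs True)
    have "Cauchy (\<lambda>n. f n x)"
    proof (rule metric_CauchyI)
      fix \<epsilon> :: real assume e: "0 < \<epsilon>"
      \<comment> \<open>The summand 1 covers \<open>D = 0\<close>, as at the base point.\<close>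
      then obtain k where k: "\<forall>m\<ge>k. \<forall>n\<ge>k. N (\<lambda>x. f m x - f n x) < \<epsilon>\<^sup>2 / (D + 1)"
        using cau[of "\<epsilon>\<^sup>2 / (D + 1)"] D by auto
      have "dist (f m x) (f n x) < \<epsilon>" if "k \<le> m" "k \<le> n" for m n
      proof -
        have "(f m x - f n x)\<^sup>2 \<le> N (\<lambda>x. f m x - f n x) * D"
          using square_le[OF diff_V[OF f f] True] by (simp add: D_def)
        also have "\<dots> \<le> \<epsilon>\<^sup>2 / (D + 1) * D"
          using k that D by (intro mult_right_mono) (auto simp: less_imp_le)
        also have "\<dots> < \<epsilon>\<^sup>2" using e D by (simp add: field_simps)
        finally have "\<bar>f m x - f n x\<bar>\<^sup>2 < \<epsilon>\<^sup>2" by simp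
        then show ?thesis
          using e by (metis dist_real_def less_imp_le power2_less_imp_less)
      qed
      then show "\<exists>M. \<forall>m\<ge>M. \<forall>n\<ge>M. dist (f m x) (f n x) < \<epsilon>" by blast
    qed
    then show ?thesis by (rule Cauchy_convergent)
  next
    case False
    then have "f n x = 0" for n using f[of n] by (simp add: V_def)
    then show ?thesis by (simp add: convergent_const)
  qed
  then obtain l where l: "\<And>x. (\<lambda>n. f n x) \<longlonglongrightarrow> l x"
    unfolding convergent_def by metis
  have l0: "l x = 0" if "\<And>n. f n x = 0" for x
    using l[of x] that by (simp add: LIMSEQ_const_iff)
  have bound: "legendre (\<lambda>x. f n x - l x) c \<le> b"
    if b: "\<forall>m\<ge>k. N (\<lambda>x. f n x - f m x) \<le> b" and c: "c \<in> combs" for n c b k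
  proof (rule LIMSEQ_le_const2)
    show "(\<lambda>m. legendre (\<lambda>x. f n x - f m x) c) \<longlonglongrightarrow> legendre (\<lambda>x. f n x - l x) c"
      unfolding legendre_def by (intro tendsto_intros tendsto_lin l)
    show "\<exists>M. \<forall>m\<ge>M. legendre (\<lambda>x. f n x - f m x) c \<le> b"
      using b legendre_le_N[OF diff_V[OF f f] c] by (meson order_trans)
  qed
  have mem: "(\<lambda>x. f n x - l x) \<in> V"
    if b: "\<forall>m\<ge>k. N (\<lambda>x. f n x - f m x) \<le> b" for n b k
  proof (rule V_I[of _ b])
    show "f n x - l x = 0" if "x \<notin> I" for x
      using that f l0[of x] by (simp add: V_def)
    show "f n e - l e = 0"
      using f l0[of e] by (simp add: V_def)
  qed (rule bound[OF b])
  obtain k where "\<forall>m\<ge>k. \<forall>n\<ge>k. N (\<lambda>x. f m x - f n x) < 1" using cau[of 1] by auto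
  then have "\<forall>m\<ge>k. N (\<lambda>x. f k x - f m x) \<le> 1" by (simp add: less_imp_le)
  \<comment> \<open>Membership is known for the difference f k - l, and l = f k - (f k - l).\<close>
  from diff_V[OF f[of k] mem[OF this]] have lV: "l \<in> V" by simp
  have "(\<lambda>n. N (\<lambda>x. f n x - l x)) \<longlonglongrightarrow> 0"
  proof (rule LIMSEQ_I)
    fix \<epsilon> :: real assume "0 < \<epsilon>"
    then obtain k where k: "\<forall>m\<ge>k. \<forall>n\<ge>k. N (\<lambda>x. f m x - f n x) < \<epsilon> / 2"
      using cau[of "\<epsilon> / 2"] by auto
    have "norm (N (\<lambda>x. f n x - l x) - 0) < \<epsilon>" if "k \<le> n" for n
    proof -
      have "N (\<lambda>x. f n x - l x) \<le> \<epsilon> / 2"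
        using k that by (intro N_le bound[of k]) (auto simp: less_imp_le)
      then show ?thesis using N_nonneg[OF diff_V[OF f[of n] lV]] \<open>0 < \<epsilon>\<close> by simp
    qed
    then show "\<exists>no. \<forall>n\<ge>no. norm (N (\<lambda>x. f n x - l x) - 0) < \<epsilon>" by blast
  qed
  with lV show ?thesis by blast
qed

lemma quadratic_function_space: "inj_on \<iota> V \<Longrightarrow> quadratic_function_space V N \<iota>"
  by (intro quadratic_function_space.intro zero_V add_V scale_V N_nonneg N_eq_0 N_scale
      parallelogram N_complete)

text \<open>The embedding of combinations into the function space: by \<open>lin_feature\<close>,
  \<open>feature d\<close> is the functional that pairs with \<open>d\<close> under the form.
  Subtracting the value at \<open>e\<close> is the normalisation.\<close>

definition feature :: "(real \<times> 'i) list \<Rightarrow> 'i \<Rightarrow> real" where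
  "feature d x = (if x \<in> I then lin d (L x) - lin d (L e) else 0)"

lemma lin_feature:
  assumes "c \<in> combs"
  shows "lin c (feature d) = form L c d"
proof -
  have "lin c (feature d) = lin c (\<lambda>x. lin d (L x) - lin d (L e))"
    using assms by (intro lin_cong) (auto simp: feature_def combs_def)
  then show ?thesis
    using assms by (simp add: lin_diff lin_const[of _ "lin d (L e)"] combs_def form_def)
qed

text \<open>This is nonnegativity of the form at c - d. Equality at c = d then gives the exact norm
  in \<open>N_feature\<close>.\<close>

lemma legendre_feature:
  assumes "c \<in> combs" "d \<in> combs"
  shows "legendre (feature d) c \<le> form L d d"
proof -
  have m: "form L c (scale_comb (-1) d) = - form L c d" "form L (scale_comb (-1) d) c = - form L d c"
    by (simp_all add: form_def lin_scale lin_uminus)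
  have "0 \<le> form L (c @ scale_comb (-1) d) (c @ scale_comb (-1) d)"
    by (intro form_nonneg append_combs scale_combs assms)
  then show ?thesis
    using assms form_commute[of c d]
    by (simp add: legendre_def lin_feature form_append m form_scale)
qed

lemma feature_V: "d \<in> combs \<Longrightarrow> feature d \<in> V"
  using legendre_feature e_mem by (intro V_I[of _ "form L d d"]) (auto simp: feature_def)

lemma N_feature: "d \<in> combs \<Longrightarrow> N (feature d) = form L d d"
  using N_le[OF legendre_feature, of d] legendre_le_N[OF feature_V, of d d]
  by (simp add: legendre_def lin_feature)

end

section \<open>The Haagerup property from conditionally negative functions\<close>

text \<open>The action has the linear isometry \<open>T g\<close> as linear part and the cocycle
  \<open>b g\<close> as translation part; the squared norm of \<open>b g\<close> is \<psi> g, so the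
  displacement of the origin is proper.\<close>

lemma haagerup_of_conditionally_negative:
  fixes G :: "('a, 'b) monoid_scheme" and \<psi> :: "'a \<Rightarrow> real" and \<iota> :: "('a \<Rightarrow> real) \<Rightarrow> 'h"
  assumes "group G"
    and inj: "inj_on \<iota> {f. \<forall>x. x \<notin> carrier G \<longrightarrow> f x = 0}"
    and \<psi>_one: "\<psi> \<one>\<^bsub>G\<^esub> = 0"
    and \<psi>_inv: "\<And>g. g \<in> carrier G \<Longrightarrow> \<psi> (inv\<^bsub>G\<^esub> g) = \<psi> g"
    and \<psi>_negative: "\<And>c. \<lbrakk>snd ` set c \<subseteq> carrier G; lin c (\<lambda>_. 1) = 0\<rbrakk> \<Longrightarrow>
          lin c (\<lambda>x. lin c (\<lambda>y. \<psi> (inv\<^bsub>G\<^esub> x \<otimes>\<^bsub>G\<^esub> y))) \<le> 0"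
    and \<psi>_proper: "\<And>R. finite {g \<in> carrier G. \<psi> g \<le> R}"
  shows "haagerup TYPE('h) G"
proof -
  interpret G: group G by fact
  \<comment> \<open>The factor 1/2 makes the form at the point mass of g minus that of the identity
    equal to \<psi> g.\<close>
  define L where "L x y = - \<psi> (inv\<^bsub>G\<^esub> x \<otimes>\<^bsub>G\<^esub> y) / 2" for x y
  have L_inv: "L (g \<otimes>\<^bsub>G\<^esub> x) (g \<otimes>\<^bsub>G\<^esub> y) = L x y"
    if "g \<in> carrier G" "x \<in> carrier G" "y \<in> carrier G" for g x y
    using that by (simp add: L_def G.inv_mult_group G.m_assoc G.inv_solve_left')
      (metis G.inv_closed G.l_inv G.l_one G.m_assoc G.m_closed)
  interpret K: conditionally_positive_kernel "carrier G" "\<one>\<^bsub>G\<^esub>" L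
  proof
    show "L x y = L y x" if "x \<in> carrier G" "y \<in> carrier G" for x y
      using \<psi>_inv[of "inv\<^bsub>G\<^esub> x \<otimes>\<^bsub>G\<^esub> y"] that by (simp add: L_def G.inv_mult_group)
    show "0 \<le> form L c c" if "snd ` set c \<subseteq> carrier G" "lin c (\<lambda>_. 1) = 0" for c
    proof -
      have "form L c c = - 1 / 2 * lin c (\<lambda>x. lin c (\<lambda>y. \<psi> (inv\<^bsub>G\<^esub> x \<otimes>\<^bsub>G\<^esub> y)))"
        unfolding form_def L_def by (simp flip: lin_scale)
      then show ?thesis using \<psi>_negative[OF that] by simp
    qed
  qed simp
  have V0: "f \<one>\<^bsub>G\<^esub> = 0" "x \<notin> carrier G \<Longrightarrow> f x = 0" if "f \<in> K.V" for f x
    using that by (simp_all add: K.V_def)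
  interpret Q: quadratic_function_space K.V K.N \<iota>
    by (rule K.quadratic_function_space, rule inj_on_subset[OF inj]) (auto simp: K.V_def)
  interpret H: hilbert_space Q.hmod Q.hip by (rule Q.hilbert_space_hmod)

  \<comment> \<open>Left translation followed by renormalisation at the identity.\<close>
  define T where "T g f x = (if x \<in> carrier G then f (inv\<^bsub>G\<^esub> g \<otimes>\<^bsub>G\<^esub> x) - f (inv\<^bsub>G\<^esub> g) else 0)"
    for g and f :: "'a \<Rightarrow> real" and x
  define b where "b g = K.feature [(1, g), (-1, \<one>\<^bsub>G\<^esub>)]" for g
  \<comment> \<open>Up to additive constants, \<open>A g f - \<psi> / 2\<close> is the left translate of \<open>f - \<psi> / 2\<close>.\<close>
  define A where "A g f x = T g f x + b g x" for g f x

  \<comment> \<open>Translation of combinations. It preserves \<open>combs\<close> and the form, and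
    translation by inv g is dual to \<open>T g\<close>, so \<open>T g\<close> cannot increase the
    supremum \<open>N\<close>.\<close>
  define tr where "tr g = map (map_prod (id :: real \<Rightarrow> real) (\<lambda>x. g \<otimes>\<^bsub>G\<^esub> x))" for g
  have tr_combs: "tr g c \<in> K.combs" if "g \<in> carrier G" "c \<in> K.combs" for g c
    using that by (auto simp: tr_def K.combs_def lin_map_snd)
  have tr_form: "form L (tr g c) (tr g c) = form L c c" if "g \<in> carrier G" "c \<in> K.combs" for g c
  proof -
    have "x \<in> carrier G" if "x \<in> snd ` set c" for x
      using that \<open>c \<in> K.combs\<close> by (auto simp only: K.combs_def)
    then show ?thesis
      unfolding tr_def form_def lin_map_snd by (intro lin_cong L_inv that(1))
  qed
  have T_leg: "K.legendre (T g f) c = K.legendre f (tr (inv\<^bsub>G\<^esub> g) c)"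
    if "g \<in> carrier G" "c \<in> K.combs" for g f c
  proof -
    have "lin c (T g f) = lin c (\<lambda>x. f (inv\<^bsub>G\<^esub> g \<otimes>\<^bsub>G\<^esub> x) - f (inv\<^bsub>G\<^esub> g))"
      using that by (intro lin_cong) (auto simp: T_def K.combs_def)
    also have "\<dots> = lin (tr (inv\<^bsub>G\<^esub> g) c) f"
      using that(2) lin_const[of c "f (inv\<^bsub>G\<^esub> g)"]
      by (simp add: lin_diff tr_def lin_map_snd K.combs_def)
    finally show ?thesis using that by (simp add: K.legendre_def tr_form)
  qed
  have T_V: "T g f \<in> K.V" if "g \<in> carrier G" "f \<in> K.V" for g f
    using that by (intro K.V_I[of _ "K.N f"])
      (auto simp: T_leg intro!: K.legendre_le_N tr_combs, auto simp: T_def)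
  have T_N_le: "K.N (T g f) \<le> K.N f" if "g \<in> carrier G" "f \<in> K.V" for g f
    using that by (intro K.N_le) (auto simp: T_leg intro!: K.legendre_le_N tr_combs)
  have T_mult: "T g (T h f) = T (g \<otimes>\<^bsub>G\<^esub> h) f" if "g \<in> carrier G" "h \<in> carrier G" for g h f
    using that by (auto simp: T_def fun_eq_iff G.inv_mult_group G.m_assoc)
  have T_one: "T \<one>\<^bsub>G\<^esub> f = f" if "f \<in> K.V" for f
    using V0[OF that] by (auto simp: T_def fun_eq_iff)
  \<comment> \<open>A contraction whose inverse is a contraction is an isometry.\<close>
  have T_N: "K.N (T g f) = K.N f" if "g \<in> carrier G" "f \<in> K.V" for g f
  proof (rule antisym[OF T_N_le[OF that]])
    have "K.N (T (inv\<^bsub>G\<^esub> g) (T g f)) \<le> K.N (T g f)"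
      using that by (intro T_N_le T_V) auto
    then show "K.N f \<le> K.N (T g f)" using that by (simp add: T_mult T_one)
  qed
  have T_comb: "T g (\<lambda>x. s * f x + t * k x) = (\<lambda>x. s * T g f x + t * T g k x)" for g s f t k
    by (auto simp: T_def fun_eq_iff algebra_simps)
  have b_combs: "[(1, g), (-1, \<one>\<^bsub>G\<^esub>)] \<in> K.combs" if "g \<in> carrier G" for g
    using that by (rule K.point_combs)
  have b_V: "b g \<in> K.V" if "g \<in> carrier G" for g
    unfolding b_def by (intro K.feature_V b_combs that)
  have b_N: "K.N (b g) = \<psi> g" if "g \<in> carrier G" for g
    using that \<psi>_inv[OF that] unfolding b_def
    by (subst K.N_feature[OF b_combs]) (simp_all add: form_def L_def \<psi>_one)
  have b_eq: "b g x = (if x \<in> carrier G then (\<psi> x + \<psi> (inv\<^bsub>G\<^esub> g) - \<psi> (inv\<^bsub>G\<^esub> g \<otimes>\<^bsub>G\<^esub> x)) / 2 else 0)"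
    if "g \<in> carrier G" for g x
    using that K.L_commute[of x g] \<psi>_inv[of x] \<psi>_inv[of g] unfolding b_def
    by (simp add: K.feature_def L_def \<psi>_one field_simps)
  \<comment> \<open>The cocycle identity, which makes \<open>A\<close> an action.\<close>
  have b_mult: "b (g \<otimes>\<^bsub>G\<^esub> h) x = T g (b h) x + b g x" if "g \<in> carrier G" "h \<in> carrier G" for g h x
    using that by (simp add: b_eq T_def G.inv_mult_group G.m_assoc field_simps)
  have b_one: "b \<one>\<^bsub>G\<^esub> = (\<lambda>_. 0)"
    by (simp add: fun_eq_iff b_eq \<psi>_one)
  have A_V: "A g f \<in> K.V" if "g \<in> carrier G" "f \<in> K.V" for g f
    unfolding A_def using that by (intro K.add_V T_V b_V)
  have A_mult: "A (g \<otimes>\<^bsub>G\<^esub> h) f = A g (A h f)" if "g \<in> carrier G" "h \<in> carrier G" for g h f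
  proof -
    have "A h f = (\<lambda>x. 1 * T h f x + 1 * b h x)" by (simp add: A_def fun_eq_iff)
    then have "T g (A h f) = (\<lambda>x. 1 * T g (T h f) x + 1 * T g (b h) x)"
      by (simp only: T_comb)
    then show ?thesis using T_mult[OF that, of f] that by (simp add: fun_eq_iff A_def b_mult)
  qed
  have A_one: "A \<one>\<^bsub>G\<^esub> f = f" if "f \<in> K.V" for f
    using that by (simp add: fun_eq_iff A_def T_one b_one)

  define \<phi> where "\<phi> g = (\<lambda>x\<in>carrier Q.hmod. \<iota> (A g (Q.fun_of x)))" for g
  have \<phi>_\<iota>: "\<phi> g (\<iota> f) = \<iota> (A g f)" if "f \<in> K.V" for g f
    using that by (simp add: \<phi>_def Q.carrier_hmod)
  have \<phi>_bij: "\<phi> g \<in> Bij (carrier Q.hmod)" if g: "g \<in> carrier G" for g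
  proof -
    have "bij_betw (\<phi> g) (\<iota> ` K.V) (\<iota> ` K.V)"
      using g by (intro bij_betw_byWitness[where f' = "\<phi> (inv\<^bsub>G\<^esub> g)"])
        (auto simp: \<phi>_\<iota> A_V A_one simp flip: A_mult)
    then show ?thesis by (simp add: Bij_def \<phi>_def Q.carrier_hmod)
  qed
  have act: "group_action G (carrier Q.hmod) \<phi>"
  proof (intro group_action.intro group_hom.intro group_hom_axioms.intro G.is_group group_BijGroup)
    show "\<phi> \<in> hom G (BijGroup (carrier Q.hmod))"
    proof (rule homI)
      fix g h assume gh: "g \<in> carrier G" "h \<in> carrier G"
      have "\<phi> (g \<otimes>\<^bsub>G\<^esub> h) = compose (carrier Q.hmod) (\<phi> g) (\<phi> h)"
      proof
        fix x show "\<phi> (g \<otimes>\<^bsub>G\<^esub> h) x = compose (carrier Q.hmod) (\<phi> g) (\<phi> h) x"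
        proof (cases "x \<in> carrier Q.hmod")
          case True
          then obtain f where "f \<in> K.V" "x = \<iota> f" by (auto simp: Q.carrier_hmod)
          then show ?thesis using gh by (simp add: compose_def Q.carrier_hmod \<phi>_\<iota> A_V A_mult)
        qed (simp add: \<phi>_def compose_def)
      qed
      then show "\<phi> (g \<otimes>\<^bsub>G\<^esub> h) = \<phi> g \<otimes>\<^bsub>BijGroup (carrier Q.hmod)\<^esub> \<phi> h"
        using gh by (simp add: BijGroup_def \<phi>_bij)
    qed (simp add: BijGroup_def \<phi>_bij)
  qed
  have A_dist: "K.N (\<lambda>x. A g f x - A g k x) = K.N (\<lambda>x. f x - k x)"
    if "g \<in> carrier G" "f \<in> K.V" "k \<in> K.V" for g f k
    using T_N[OF that(1) K.diff_V[OF that(2,3)]] T_comb[of g 1 f "-1" k] by (simp add: A_def)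
  have aff: "affine_isometric_action G Q.hmod Q.hip \<phi>"
    unfolding affine_isometric_action_def
  proof (intro conjI ballI allI act)
    fix g x y and t :: real
    assume g: "g \<in> carrier G" and x: "x \<in> carrier Q.hmod" and y: "y \<in> carrier Q.hmod"
    obtain f k where f: "f \<in> K.V" "x = \<iota> f" and k: "k \<in> K.V" "y = \<iota> k"
      using x y unfolding Q.carrier_hmod by blast
    have "A g (\<lambda>x. (1 - t) * f x + t * k x) = (\<lambda>x. (1 - t) * A g f x + t * A g k x)"
      unfolding A_def T_comb by (simp add: fun_eq_iff algebra_simps)
    then show "\<phi> g ((1 - t) \<odot>\<^bsub>Q.hmod\<^esub> x \<oplus>\<^bsub>Q.hmod\<^esub> t \<odot>\<^bsub>Q.hmod\<^esub> y) =
        (1 - t) \<odot>\<^bsub>Q.hmod\<^esub> \<phi> g x \<oplus>\<^bsub>Q.hmod\<^esub> t \<odot>\<^bsub>Q.hmod\<^esub> \<phi> g y"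
      using f k g by (simp add: Q.smult_hmod Q.add_hmod \<phi>_\<iota> A_V K.scale_V K.add_V)
    show "ip_dist Q.hmod Q.hip (\<phi> g x) (\<phi> g y) = ip_dist Q.hmod Q.hip x y"
      using f k g by (simp add: \<phi>_\<iota> Q.ip_dist_hmod A_V A_dist)
  qed
  have "metrically_proper G Q.hmod Q.hip \<phi>"
    unfolding metrically_proper_def
  proof (intro allI impI)
    fix B assume "H.mbounded B"
    then obtain x0 r where B: "B \<subseteq> carrier Q.hmod" "\<And>x. x \<in> B \<Longrightarrow> ip_dist Q.hmod Q.hip x0 x \<le> r"
      and x0: "B = {} \<or> x0 \<in> carrier Q.hmod"
      by (auto simp: H.mbounded_def H.mcball_def)
    \<comment> \<open>Every point of \<open>B\<close> has distance at most \<open>R\<close> from the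
      origin. If g maps some point of \<open>B\<close> into \<open>B\<close>, then it moves the
      origin by at most 2R.\<close>
    define R where "R = ip_dist Q.hmod Q.hip x0 (\<iota> (\<lambda>_. 0)) + r"
    have "\<psi> g \<le> (2 * R)\<^sup>2" if g: "g \<in> carrier G" and ne: "\<phi> g ` B \<inter> B \<noteq> {}" for g
    proof -
      let ?d = "ip_dist Q.hmod Q.hip" and ?o = "\<iota> (\<lambda>_. 0)"
      obtain x where x: "x \<in> B" "\<phi> g x \<in> B" using ne by auto
      have c: "?o \<in> carrier Q.hmod" "x \<in> carrier Q.hmod" "x0 \<in> carrier Q.hmod" "\<phi> g x \<in> carrier Q.hmod"
        "\<phi> g ?o \<in> carrier Q.hmod"
        using x x0 B(1) g K.zero_V by (auto simp: Q.carrier_hmod \<phi>_\<iota> A_V)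
      have R: "?d y ?o \<le> R" if "y \<in> B" for y
        using H.triangle[of y x0 ?o] B(2)[OF that] H.commute[of x0 y] c that B(1)
        by (auto simp: R_def)
      have "?d (\<phi> g ?o) ?o \<le> ?d (\<phi> g ?o) (\<phi> g x) + ?d (\<phi> g x) ?o"
        by (intro H.triangle c)
      also have "?d (\<phi> g ?o) (\<phi> g x) = ?d x ?o"
        using aff g c H.commute unfolding affine_isometric_action_def by metis
      finally have "?d (\<phi> g ?o) ?o \<le> 2 * R" using R[OF x(1)] R[OF x(2)] by simp
      moreover have "?d (\<phi> g ?o) ?o = sqrt (\<psi> g)"
      proof -
        have "A g (\<lambda>_. 0) = b g" by (simp add: A_def T_def fun_eq_iff)
        then show ?thesis
          using g b_N[OF g] b_V[OF g] K.zero_V by (simp add: \<phi>_\<iota> Q.ip_dist_hmod A_V)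
      qed
      ultimately show ?thesis
        using K.N_nonneg[OF b_V[OF g]] b_N[OF g] real_le_rsqrt sqrt_le_D by fastforce
    qed
    then show "finite {g \<in> carrier G. \<phi> g ` B \<inter> B \<noteq> {}}"
      by (intro finite_subset[OF _ \<psi>_proper[of "(2 * R)\<^sup>2"]]) auto
  qed
  with aff show ?thesis
    unfolding haagerup_def using Q.hilbert_space_hmod by blast
qed

section \<open>Percolation on Cayley graphs\<close>

text \<open>A real number is coded by a set of naturals, a countable family of such sets by one set
  of pairs, hence again by one set of naturals.\<close>

lemma inj_real_functions_into:
  fixes I :: "'i set"
  assumes I: "countable I" and h: "(UNIV :: real set) \<lesssim> (UNIV :: 'h set)"
  shows "\<exists>\<iota> :: ('i \<Rightarrow> real) \<Rightarrow> 'h. inj_on \<iota> {f. \<forall>x. x \<notin> I \<longrightarrow> f x = 0}"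
proof -
  obtain b :: "nat set \<Rightarrow> real" where b: "bij b"
    using nat_sets_eqpoll_reals by (auto simp: eqpoll_def)
  obtain k :: "real \<Rightarrow> 'h" where k: "inj k"
    using h by (auto simp: lepoll_def)
  define code where "code f = {prod_encode (to_nat_on I x, m) |x m. x \<in> I \<and> m \<in> inv_into UNIV b (f x)}"
    for f :: "'i \<Rightarrow> real"
  have decode: "inv_into UNIV b (f x) = {m. prod_encode (to_nat_on I x, m) \<in> code f}" if "x \<in> I" for f x
    using that I by (auto simp: code_def)
  have "inj_on code {f. \<forall>x. x \<notin> I \<longrightarrow> f x = 0}"
  proof (intro inj_onI ext)
    fix f g x assume fg: "f \<in> {f. \<forall>x. x \<notin> I \<longrightarrow> f x = 0}" "g \<in> {f. \<forall>x. x \<notin> I \<longrightarrow> f x = 0}"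
      "code f = code g"
    show "f x = g x"
    proof (cases "x \<in> I")
      case True
      then have "inv_into UNIV b (f x) = inv_into UNIV b (g x)" using fg(3) by (simp add: decode)
      then show ?thesis using b by (metis bij_inv_eq_iff)
    qed (use fg in auto)
  qed
  then have "inj_on (k \<circ> b \<circ> code) {f. \<forall>x. x \<notin> I \<longrightarrow> f x = 0}"
    using k b by (intro comp_inj_on) (auto intro: inj_on_subset simp: bij_def)
  then show ?thesis by blast
qed

section \<open>Walks, balls and translations in the Cayley graph\<close>

locale cayley_graph = group G for G :: "('a, 'b) monoid_scheme" (structure) +
  fixes S :: "'a set"
  assumes gens: "finite_symmetric_generating_set G S"
begin

abbreviation E :: "'a set set" where "E \<equiv> cayley_edges G S"

lemma finite_S: "finite S" and S_carrier: "S \<subseteq> carrier G"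
  and S_inv: "s \<in> S \<Longrightarrow> inv s \<in> S" and generate_S: "generate G S = carrier G"
  using gens by (auto simp: finite_symmetric_generating_set_def)

lemma S_mem [simp]: "s \<in> S \<Longrightarrow> s \<in> carrier G"
  using S_carrier by blast

text \<open>An undirected edge can be traversed against its generator; symmetry of \<open>S\<close>
  turns this into a step by the inverse generator.\<close>

lemma adjacency_E: "(g, h) \<in> adjacency E \<longleftrightarrow> g \<in> carrier G \<and> (\<exists>s\<in>S. h = g \<otimes> s)"
proof
  assume "(g, h) \<in> adjacency E"
  then obtain a s where a: "a \<in> carrier G" "s \<in> S" "{g, h} = {a, a \<otimes> s}"
    by (auto simp: adjacency_def cayley_edges_def)
  then consider "g = a" "h = a \<otimes> s" | "g = a \<otimes> s" "h = a" by (auto simp: doubleton_eq_iff)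
  then show "g \<in> carrier G \<and> (\<exists>s\<in>S. h = g \<otimes> s)"
  proof cases
    case 1
    then show ?thesis using a(1,2) by blast
  next
    case 2
    then have "h = g \<otimes> inv s" "g \<in> carrier G" using a(1,2) by (simp_all add: m_assoc)
    then show ?thesis using S_inv[OF a(2)] by blast
  qed
qed (auto simp: adjacency_def cayley_edges_def)

lemma adjacency_carrier: "(g, h) \<in> adjacency E \<Longrightarrow> g \<in> carrier G \<and> h \<in> carrier G"
  using S_carrier by (auto simp: adjacency_E)

lemma adjacency_translate:
  "\<lbrakk>\<gamma> \<in> carrier G; (g, h) \<in> adjacency E\<rbrakk> \<Longrightarrow> (\<gamma> \<otimes> g, \<gamma> \<otimes> h) \<in> adjacency E"
  by (metis S_mem adjacency_E m_assoc m_closed)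

lemma walk_translate:
  "\<lbrakk>\<gamma> \<in> carrier G; (g, h) \<in> adjacency E ^^ n\<rbrakk> \<Longrightarrow> (\<gamma> \<otimes> g, \<gamma> \<otimes> h) \<in> adjacency E ^^ n"
  by (induction n arbitrary: h) (auto intro: adjacency_translate)

lemma finite_walk: "finite {h. (g, h) \<in> adjacency E ^^ n}"
proof (induction n)
  case (Suc n)
  have "{h. (g, h) \<in> adjacency E ^^ Suc n} \<subseteq> (\<lambda>(k, s). k \<otimes> s) ` ({h. (g, h) \<in> adjacency E ^^ n} \<times> S)"
    by (auto simp: adjacency_E)
  then show ?case using Suc finite_S by (meson finite_SigmaI finite_imageI finite_subset)
qed simp

lemma walk_from_one: "g \<in> carrier G \<Longrightarrow> \<exists>n. (\<one>, g) \<in> adjacency E ^^ n"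
  unfolding generate_S[symmetric]
proof (induction rule: generate.induct)
  case one
  then show ?case by (intro exI[of _ 0]) simp
next
  case (incl h)
  then have "(\<one>, h) \<in> adjacency E" unfolding adjacency_E by force
  then show ?case by (intro exI[of _ 1]) simp
next
  case (inv h)
  then have "(\<one>, inv h) \<in> adjacency E" using S_inv unfolding adjacency_E by force
  then show ?case by (intro exI[of _ 1]) simp
next
  case (eng h1 h2)
  then obtain m n where mn: "(\<one>, h1) \<in> adjacency E ^^ m" "(\<one>, h2) \<in> adjacency E ^^ n" by blast
  have "h1 \<in> carrier G" using eng generate_S by simp
  from walk_translate[OF this mn(2)] this have "(h1, h1 \<otimes> h2) \<in> adjacency E ^^ n" by simp
  with mn(1) have "(\<one>, h1 \<otimes> h2) \<in> adjacency E ^^ (m + n)" by (auto simp: relpow_add)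
  then show ?case by blast
qed

lemma walk_exists:
  assumes "g \<in> carrier G" "h \<in> carrier G"
  shows "\<exists>n. (g, h) \<in> adjacency E ^^ n"
proof -
  obtain n where "(\<one>, inv g \<otimes> h) \<in> adjacency E ^^ n" using walk_from_one assms by blast
  from walk_translate[OF assms(1) this] show ?thesis using assms by (auto simp: m_assoc[symmetric])
qed

lemma graph_dist_walk: "\<lbrakk>g \<in> carrier G; h \<in> carrier G\<rbrakk> \<Longrightarrow> (g, h) \<in> adjacency E ^^ graph_dist E g h"
  unfolding graph_dist_def using walk_exists by (rule LeastI_ex)

lemma graph_dist_le: "(g, h) \<in> adjacency E ^^ n \<Longrightarrow> graph_dist E g h \<le> n"
  unfolding graph_dist_def by (rule Least_le)

lemma finite_ball: "finite {h \<in> carrier G. real (graph_dist E \<one> h) \<le> r}"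
proof (rule finite_subset)
  show "{h \<in> carrier G. real (graph_dist E \<one> h) \<le> r} \<subseteq> (\<Union>n\<in>{..nat \<lfloor>r\<rfloor>}. {h. (\<one>, h) \<in> adjacency E ^^ n})"
  proof
    fix h assume "h \<in> {h \<in> carrier G. real (graph_dist E \<one> h) \<le> r}"
    then have "(\<one>, h) \<in> adjacency E ^^ graph_dist E \<one> h" "graph_dist E \<one> h \<le> nat \<lfloor>r\<rfloor>"
      by (auto intro!: graph_dist_walk simp: le_nat_floor)
    then show "h \<in> (\<Union>n\<in>{..nat \<lfloor>r\<rfloor>}. {h. (\<one>, h) \<in> adjacency E ^^ n})" by blast
  qed
qed (simp add: finite_walk)

lemma countable_carrier: "countable (carrier G)"
proof (rule countable_subset)
  show "carrier G \<subseteq> (\<Union>n. {h. (\<one>, h) \<in> adjacency E ^^ n})" using walk_from_one by blast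
  show "countable (\<Union>n. {h. (\<one>, h) \<in> adjacency E ^^ n})"
    by (intro countable_UN countable_finite finite_walk countableI_type)
qed

text \<open>Ensures that the supremum defining vanishing at infinity runs over a nonempty set for
  every radius.\<close>

lemma far_point_exists:
  assumes "infinite (carrier G)"
  shows "\<exists>h\<in>carrier G. r < real (graph_dist E \<one> h)"
proof (rule ccontr)
  assume "\<not> ?thesis"
  then have "carrier G \<subseteq> {h \<in> carrier G. real (graph_dist E \<one> h) \<le> r}" by force
  then show False using assms finite_ball finite_subset by blast
qed

lemma edge_carrier: "e \<in> E \<Longrightarrow> e \<subseteq> carrier G"
  using S_carrier by (auto simp: cayley_edges_def)

lemma edge_one: "s \<in> S \<Longrightarrow> {\<one>, s} \<in> E"
  using S_carrier by (force simp: cayley_edges_def)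

lemma translate_pair: "\<gamma> <# {g, h} = {\<gamma> \<otimes> g, \<gamma> \<otimes> h}"
  by (auto simp: l_coset_def)

lemma translate_E: "\<lbrakk>\<gamma> \<in> carrier G; e \<in> E\<rbrakk> \<Longrightarrow> \<gamma> <# e \<in> E"
proof -
  assume "\<gamma> \<in> carrier G" "e \<in> E"
  then obtain g s where "g \<in> carrier G" "s \<in> S" "e = {g, g \<otimes> s}"
    by (auto simp: cayley_edges_def)
  moreover from this have "\<gamma> <# e = {\<gamma> \<otimes> g, (\<gamma> \<otimes> g) \<otimes> s}"
    using \<open>\<gamma> \<in> carrier G\<close> by (simp add: translate_pair m_assoc)
  ultimately show "\<gamma> <# e \<in> E"
    using \<open>\<gamma> \<in> carrier G\<close> unfolding cayley_edges_def by blast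
qed

lemma translate_inv:
  "\<lbrakk>\<gamma> \<in> carrier G; e \<in> E\<rbrakk> \<Longrightarrow> inv \<gamma> <# (\<gamma> <# e) = e"
  "\<lbrakk>\<gamma> \<in> carrier G; e \<in> E\<rbrakk> \<Longrightarrow> \<gamma> <# (inv \<gamma> <# e) = e"
  using edge_carrier by (simp_all add: lcos_m_assoc lcos_mult_one)

abbreviation translate :: "'a \<Rightarrow> 'a set set \<Rightarrow> 'a set set" where
  "translate \<gamma> \<omega> \<equiv> (\<lambda>e. \<gamma> <# e) ` \<omega>"

lemma mem_translate:
  assumes "\<gamma> \<in> carrier G" "\<omega> \<subseteq> E" "e \<in> E"
  shows "e \<in> translate \<gamma> \<omega> \<longleftrightarrow> inv \<gamma> <# e \<in> \<omega>"
proof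
  assume "e \<in> translate \<gamma> \<omega>"
  then show "inv \<gamma> <# e \<in> \<omega>" using assms translate_inv(1) by auto
next
  assume "inv \<gamma> <# e \<in> \<omega>"
  then show "e \<in> translate \<gamma> \<omega>" using translate_inv(2)[OF assms(1,3)] by (metis image_eqI)
qed

lemma translate_subset: "\<lbrakk>\<gamma> \<in> carrier G; \<omega> \<subseteq> E\<rbrakk> \<Longrightarrow> translate \<gamma> \<omega> \<subseteq> E"
  using translate_E by blast

lemma same_cluster_translate_imp:
  "same_cluster \<omega> g h \<Longrightarrow> same_cluster (translate \<gamma> \<omega>) (\<gamma> \<otimes> g) (\<gamma> \<otimes> h)"
  unfolding same_cluster_def
proof (induction rule: rtrancl_induct)
  case (step y z)
  then have "(\<gamma> \<otimes> y, \<gamma> \<otimes> z) \<in> adjacency (translate \<gamma> \<omega>)"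
    unfolding adjacency_def by (auto simp flip: translate_pair)
  with step.IH show ?case by simp
qed simp

lemma same_cluster_translate:
  assumes "\<gamma> \<in> carrier G" "g \<in> carrier G" "h \<in> carrier G" "\<omega> \<subseteq> E"
  shows "same_cluster (translate \<gamma> \<omega>) (\<gamma> \<otimes> g) (\<gamma> \<otimes> h) \<longleftrightarrow> same_cluster \<omega> g h"
proof
  assume "same_cluster (translate \<gamma> \<omega>) (\<gamma> \<otimes> g) (\<gamma> \<otimes> h)"
  from same_cluster_translate_imp[OF this, of "inv \<gamma>"]
  have "same_cluster (translate (inv \<gamma>) (translate \<gamma> \<omega>)) g h"
    using assms by (simp add: m_assoc[symmetric])
  moreover have "translate (inv \<gamma>) (translate \<gamma> \<omega>) = (\<lambda>e. e) ` \<omega>"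
    unfolding image_image using assms by (intro image_cong refl translate_inv(1)) auto
  ultimately show "same_cluster \<omega> g h" by simp
qed (rule same_cluster_translate_imp)

text \<open>The generators parametrise the edges at the identity injectively, loops included. The
  degree thus becomes a sum of edge indicators, whose expectation is a sum of probabilities.\<close>

lemma degree_one:
  assumes "\<omega> \<subseteq> E"
  shows "real (degree_in \<omega> \<one>) = (\<Sum>s\<in>S. of_bool ({\<one>, s} \<in> \<omega>))"
proof -
  have "{e \<in> \<omega>. \<one> \<in> e} = (\<lambda>s. {\<one>, s}) ` {s \<in> S. {\<one>, s} \<in> \<omega>}"
  proof (intro equalityI subsetI)
    fix e assume e: "e \<in> {e \<in> \<omega>. \<one> \<in> e}"
    then have "e \<in> E" using assms by blast
    then obtain g s where gs: "g \<in> carrier G" "s \<in> S" "e = {g, g \<otimes> s}"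
      unfolding cayley_edges_def by blast
    have "\<one> \<in> {g, g \<otimes> s}" using e gs(3) by blast
    then consider "\<one> = g" | "\<one> = g \<otimes> s" by blast
    then show "e \<in> (\<lambda>s. {\<one>, s}) ` {s \<in> S. {\<one>, s} \<in> \<omega>}"
    proof cases
      case 1
      then have "e = {\<one>, s}" using gs(2) unfolding gs(3) by (simp flip: 1)
      then show ?thesis using e gs(2) by blast
    next
      case 2
      then have "g = inv s" using gs(1,2) by (metis S_mem inv_equality 2)
      moreover have "e = {\<one>, g}" unfolding gs(3) by (simp flip: 2 add: insert_commute)
      ultimately show ?thesis using e S_inv[OF gs(2)] by blast
    qed
  qed auto
  moreover have "inj_on (\<lambda>s. {\<one>, s}) {s \<in> S. {\<one>, s} \<in> \<omega>}"
    by (auto simp: inj_on_def doubleton_eq_iff)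
  ultimately show ?thesis
    by (simp add: degree_in_def card_image finite_S Int_def sum.If_cases of_bool_def)
qed

lemma degree_E: "degree_in E \<one> = card S"
proof -
  have "real (degree_in E \<one>) = (\<Sum>s\<in>S. 1)"
    unfolding degree_one[OF order_refl] by (intro sum.cong) (simp_all add: edge_one)
  then show ?thesis by simp
qed

end

section \<open>Measurability, invariance and the two-point function\<close>

lemma space_configuration_space [simp]: "space (configuration_space E) = Pow E"
  by (simp add: configuration_space_def)

lemma measurable_mem_configuration:
  assumes "e \<in> E"
  shows "Measurable.pred (configuration_space E) (\<lambda>\<omega>. e \<in> \<omega>)"
proof -
  let ?f = "\<lambda>\<omega>. \<lambda>e\<in>E. e \<in> \<omega>"
  have f: "?f \<in> configuration_space E \<rightarrow>\<^sub>M (\<Pi>\<^sub>M e\<in>E. count_space UNIV)"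
    unfolding configuration_space_def by (rule measurable_vimage_algebra1) (auto simp: space_PiM)
  from measurable_compose[OF f measurable_component_singleton[OF assms]]
  show ?thesis using assms by simp
qed

lemma measurable_into_configuration:
  assumes "\<And>x. x \<in> space M \<Longrightarrow> f x \<subseteq> E" "\<And>e. e \<in> E \<Longrightarrow> Measurable.pred M (\<lambda>x. e \<in> f x)"
  shows "f \<in> M \<rightarrow>\<^sub>M configuration_space E"
  unfolding configuration_space_def
proof (rule measurable_vimage_algebra2)
  show "(\<lambda>x. \<lambda>e\<in>E. e \<in> f x) \<in> M \<rightarrow>\<^sub>M (\<Pi>\<^sub>M e\<in>E. count_space UNIV)"
    using assms(2) by (intro measurable_restrict) simp
qed (use assms(1) in auto)

locale cayley_percolation = cayley_graph G S for G :: "('a, 'b) monoid_scheme" (structure) and S +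
  fixes P :: "'a set set measure"
  assumes P: "bond_percolation (cayley_edges G S) P"
begin

sublocale prob_space P
  using P by (simp add: bond_percolation_def)

lemma sets_P [measurable_cong]: "sets P = sets (configuration_space E)"
  using P by (simp add: bond_percolation_def)

lemma space_P: "space P = Pow E"
  using sets_eq_imp_space_eq[OF sets_P] by simp

lemma measurable_mem: "Measurable.pred P (\<lambda>\<omega>. e \<in> \<omega>)"
proof (cases "e \<in> E")
  case True
  then show ?thesis
    unfolding measurable_cong_sets[OF sets_P refl] by (rule measurable_mem_configuration)
next
  case False
  then have "Measurable.pred P (\<lambda>\<omega>. e \<in> \<omega>) \<longleftrightarrow> Measurable.pred P (\<lambda>\<omega>. False)"
    by (intro measurable_cong) (auto simp: space_P)
  then show ?thesis by simp
qed

lemma adjacency_carrier': "\<lbrakk>\<omega> \<in> space P; (g, h) \<in> adjacency \<omega>\<rbrakk> \<Longrightarrow> g \<in> carrier G \<and> h \<in> carrier G"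
  using adjacency_carrier by (auto simp: space_P adjacency_def)

text \<open>Connection is a countable union over the length and the vertices of a walk; countability
  of the group enters here.\<close>

lemma measurable_same_cluster: "Measurable.pred P (\<lambda>\<omega>. same_cluster \<omega> g h)"
proof -
  have *: "Measurable.pred P (\<lambda>\<omega>. (g, h) \<in> adjacency \<omega> ^^ n)" for n h
  proof (induction n arbitrary: h)
    case (Suc n)
    have "Measurable.pred P (\<lambda>\<omega>. (g, h) \<in> adjacency \<omega> ^^ Suc n) \<longleftrightarrow>
      Measurable.pred P (\<lambda>\<omega>. \<exists>k\<in>carrier G. (g, k) \<in> adjacency \<omega> ^^ n \<and> (k, h) \<in> adjacency \<omega>)"
      by (intro measurable_cong) (auto dest: adjacency_carrier' simp: relcomp_unfold)
    moreover have "Measurable.pred P (\<lambda>\<omega>. (k, h) \<in> adjacency \<omega>)" for k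
      using measurable_mem by (simp add: adjacency_def)
    ultimately show ?case
      using countable_carrier Suc by (auto intro!: pred_intros_countable_bounded pred_intros_logic)
  qed simp
  have "same_cluster \<omega> g h \<longleftrightarrow> (\<exists>n. (g, h) \<in> adjacency \<omega> ^^ n)" for \<omega>
    by (simp add: same_cluster_def rtrancl_is_UN_relpow)
  then show ?thesis using * by (simp add: pred_intros_countable)
qed

lemma cluster_event [measurable]: "{\<omega> \<in> space P. same_cluster \<omega> g h} \<in> sets P"
  using measurable_same_cluster by (simp add: pred_def)

lemma measurable_translate:
  assumes "\<gamma> \<in> carrier G"
  shows "translate \<gamma> \<in> P \<rightarrow>\<^sub>M P"
proof -
  have "translate \<gamma> \<in> P \<rightarrow>\<^sub>M configuration_space E"
  proof (rule measurable_into_configuration)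
    fix e assume "e \<in> E"
    then have "Measurable.pred P (\<lambda>\<omega>. e \<in> translate \<gamma> \<omega>) \<longleftrightarrow> Measurable.pred P (\<lambda>\<omega>. inv \<gamma> <# e \<in> \<omega>)"
      using assms by (intro measurable_cong mem_translate) (auto simp: space_P)
    then show "Measurable.pred P (\<lambda>\<omega>. e \<in> translate \<gamma> \<omega>)" using measurable_mem by simp
  qed (use assms translate_subset space_P in auto)
  then show ?thesis unfolding measurable_cong_sets[OF refl sets_P] .
qed

lemma two_point_translate:
  assumes "invariant_percolation G P" "\<gamma> \<in> carrier G" "g \<in> carrier G" "h \<in> carrier G"
  shows "two_point P (\<gamma> \<otimes> g) (\<gamma> \<otimes> h) = two_point P g h"
proof -
  have "two_point P (\<gamma> \<otimes> g) (\<gamma> \<otimes> h)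
      = measure (distr P P (translate \<gamma>)) {\<omega> \<in> space P. same_cluster \<omega> (\<gamma> \<otimes> g) (\<gamma> \<otimes> h)}"
    using assms(1,2) by (simp add: two_point_def invariant_percolation_def)
  also have "\<dots> = prob (translate \<gamma> -` {\<omega> \<in> space P. same_cluster \<omega> (\<gamma> \<otimes> g) (\<gamma> \<otimes> h)} \<inter> space P)"
    by (intro measure_distr measurable_translate assms cluster_event)
  also have "translate \<gamma> -` {\<omega> \<in> space P. same_cluster \<omega> (\<gamma> \<otimes> g) (\<gamma> \<otimes> h)} \<inter> space P
      = {\<omega> \<in> space P. same_cluster \<omega> g h}"
    using assms translate_subset[OF assms(2)] by (auto simp: space_P same_cluster_translate)
  finally show ?thesis by (simp add: two_point_def)
qed

lemma same_cluster_refl: "same_cluster \<omega> g g"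
  by (simp add: same_cluster_def)

lemma same_cluster_trans: "\<lbrakk>same_cluster \<omega> g h; same_cluster \<omega> h k\<rbrakk> \<Longrightarrow> same_cluster \<omega> g k"
  by (auto simp: same_cluster_def)

lemma same_cluster_sym: "same_cluster \<omega> g h \<Longrightarrow> same_cluster \<omega> h g"
  unfolding same_cluster_def
  by (rule symD[OF sym_rtrancl]) (auto simp: sym_def adjacency_def insert_commute)

lemma two_point_commute: "two_point P g h = two_point P h g"
  unfolding two_point_def by (rule arg_cong[of _ _ prob]) (auto intro: same_cluster_sym)

lemma two_point_self: "two_point P g g = 1"
  by (simp add: two_point_def same_cluster_refl prob_space)

text \<open>If g and k are separated, then h is separated from one of them. This carries bounds from
  the generators to the whole group.\<close>

lemma two_point_triangle: "1 - two_point P g k \<le> (1 - two_point P g h) + (1 - two_point P h k)"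
proof -
  let ?A = "\<lambda>g h. {\<omega> \<in> space P. same_cluster \<omega> g h}"
  have "prob (space P - ?A g k) \<le> prob ((space P - ?A g h) \<union> (space P - ?A h k))"
    by (intro finite_measure_mono) (auto intro: same_cluster_trans)
  also have "\<dots> \<le> prob (space P - ?A g h) + prob (space P - ?A h k)"
    by (intro measure_Un_le) auto
  finally show ?thesis by (simp add: prob_compl two_point_def)
qed

lemma expected_degree: "(\<integral>\<omega>. real (degree_in \<omega> \<one>) \<partial>P) = (\<Sum>s\<in>S. prob {\<omega> \<in> space P. {\<one>, s} \<in> \<omega>})"
proof -
  have "(\<integral>\<omega>. real (degree_in \<omega> \<one>) \<partial>P) = (\<integral>\<omega>. (\<Sum>s\<in>S. indicator {\<omega> \<in> space P. {\<one>, s} \<in> \<omega>} \<omega>) \<partial>P)"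
    by (intro Bochner_Integration.integral_cong refl) (auto simp: space_P degree_one indicator_def intro!: sum.cong)
  also have "\<dots> = (\<Sum>s\<in>S. prob {\<omega> \<in> space P. {\<one>, s} \<in> \<omega>})"
    using measurable_mem
    by (subst Bochner_Integration.integral_sum)
      (auto simp: pred_def less_top[symmetric] intro!: integrable_real_indicator)
  finally show ?thesis .
qed

text \<open>The missing expected degree, less than \<epsilon> times \<open>card S\<close>, is a sum
  of nonnegative closing probabilities and so bounds each of them.\<close>

lemma two_point_generator:
  assumes s: "s \<in> S"
    and deg: "(1 - \<epsilon>) * real (degree_in E \<one>) < (\<integral>\<omega>. real (degree_in \<omega> \<one>) \<partial>P)"
  shows "1 - two_point P \<one> s \<le> \<epsilon> * card S"
proof -
  let ?p = "\<lambda>s. prob {\<omega> \<in> space P. {\<one>, s} \<in> \<omega>}"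
  have "?p s \<le> two_point P \<one> s"
    unfolding two_point_def
    by (intro finite_measure_mono cluster_event) (auto simp: same_cluster_def adjacency_def)
  moreover have "(\<Sum>s\<in>S. ?p s) = ?p s + (\<Sum>s\<in>S - {s}. ?p s)"
    using s finite_S by (intro sum.remove) auto
  moreover have "(\<Sum>s\<in>S - {s}. ?p s) \<le> (\<Sum>s\<in>S - {s}. 1)"
    by (intro sum_mono) simp
  moreover have "real (card (S - {s})) = real (card S) - 1"
    using card.remove[OF finite_S s] by simp
  ultimately show ?thesis
    using deg unfolding expected_degree degree_E by (simp add: algebra_simps)
qed

end

section \<open>Positive definiteness of the two-point function\<close>

text \<open>Grouping the points of \<open>c\<close> by their label \<kappa> writes the form as a sum
  over labels of squared total weights.\<close>

lemma lin_equivalence_nonneg: "0 \<le> lin c (\<lambda>x. lin c (\<lambda>y. of_bool (\<kappa> x = \<kappa> y)))"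
proof -
  let ?F = "\<kappa> ` snd ` set c"
  have "lin c (\<lambda>x. lin c (\<lambda>y. of_bool (\<kappa> x = \<kappa> y)))
      = lin c (\<lambda>x. lin c (\<lambda>y. \<Sum>v\<in>?F. of_bool (\<kappa> x = v) * of_bool (\<kappa> y = v)))"
  proof (intro lin_cong)
    fix x y assume x: "x \<in> snd ` set c"
    have "(\<Sum>v\<in>?F. of_bool (\<kappa> x = v) * of_bool (\<kappa> y = v)) = (\<Sum>v\<in>?F. if \<kappa> x = v then of_bool (\<kappa> x = \<kappa> y) else (0 :: real))"
      by (intro sum.cong) auto
    then show "of_bool (\<kappa> x = \<kappa> y) = (\<Sum>v\<in>?F. of_bool (\<kappa> x = v) * of_bool (\<kappa> y = v) :: real)"
      using x by (simp add: sum.delta)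
  qed
  also have "\<dots> = (\<Sum>v\<in>?F. (lin c (\<lambda>x. of_bool (\<kappa> x = v)))\<^sup>2)"
    by (simp only: lin_sum lin_scale lin_scale_right power2_eq_square)
  also have "\<dots> \<ge> 0" by (intro sum_nonneg) simp
  finally show ?thesis .
qed

lemma sums_lin:
  assumes "\<And>x. x \<in> snd ` set c \<Longrightarrow> (\<lambda>n. F n x) sums l x"
  shows "(\<lambda>n. lin c (F n)) sums lin c l"
  using assms
proof (induction c)
  case (Cons p c)
  then show ?case by (cases p) (auto intro!: sums_add sums_mult)
qed simp

lemma
  assumes "\<And>x. integrable M (f x)"
  shows integrable_lin: "integrable M (\<lambda>\<omega>. lin c (\<lambda>x. f x \<omega>))"
    and integral_lin: "(\<integral>\<omega>. lin c (\<lambda>x. f x \<omega>) \<partial>M) = lin c (\<lambda>x. integral\<^sup>L M (f x))"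
proof -
  have "integrable M (\<lambda>\<omega>. lin c (\<lambda>x. f x \<omega>)) \<and>
    (\<integral>\<omega>. lin c (\<lambda>x. f x \<omega>) \<partial>M) = lin c (\<lambda>x. integral\<^sup>L M (f x))"
  proof (induction c)
    case (Cons p c)
    then show ?case using assms by (cases p) simp
  qed simp
  then show "integrable M (\<lambda>\<omega>. lin c (\<lambda>x. f x \<omega>))"
    "(\<integral>\<omega>. lin c (\<lambda>x. f x \<omega>) \<partial>M) = lin c (\<lambda>x. integral\<^sup>L M (f x))" by blast+
qed

context cayley_percolation
begin

lemma two_point_positive: "0 \<le> lin c (\<lambda>g. lin c (two_point P g))"
proof -
  \<comment> \<open>The label of a vertex is its cluster as a set.\<close>
  have same: "of_bool (same_cluster \<omega> g h) = (of_bool (Collect (same_cluster \<omega> g) = Collect (same_cluster \<omega> h)) :: real)"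
    for \<omega> :: "'a set set" and g h
  proof -
    have "same_cluster \<omega> g h \<longleftrightarrow> (\<forall>k. same_cluster \<omega> g k \<longleftrightarrow> same_cluster \<omega> h k)"
      by (meson same_cluster_refl same_cluster_sym same_cluster_trans)
    then show ?thesis by (simp add: set_eq_iff)
  qed
  have int: "integrable P (\<lambda>\<omega>. of_bool (same_cluster \<omega> g h) :: real)" for g h :: 'a
    using measurable_same_cluster by (intro integrable_const_bound[of _ 1]) auto
  have "two_point P g h = (\<integral>\<omega>. of_bool (same_cluster \<omega> g h) \<partial>P)" for g h
  proof -
    have "(\<integral>\<omega>. of_bool (same_cluster \<omega> g h) \<partial>P) = (\<integral>\<omega>. indicat_real {\<omega> \<in> space P. same_cluster \<omega> g h} \<omega> \<partial>P)"
      by (intro Bochner_Integration.integral_cong) (auto simp: indicator_def)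
    then show ?thesis using cluster_event by (simp add: two_point_def Int_absorb2)
  qed
  then have "two_point P g = (\<lambda>h. \<integral>\<omega>. of_bool (same_cluster \<omega> g h) \<partial>P)" for g
    by blast
  then have "lin c (\<lambda>g. lin c (two_point P g))
      = (\<integral>\<omega>. lin c (\<lambda>g. lin c (\<lambda>h. of_bool (same_cluster \<omega> g h))) \<partial>P)"
    by (simp only: integral_lin[OF integrable_lin[OF int]] integral_lin[OF int])
  also have "\<dots> \<ge> 0"
    unfolding same by (intro integral_nonneg_AE AE_I2 lin_equivalence_nonneg)
  finally show ?thesis .
qed

lemma two_point_bounded_far:
  assumes "vanishes_at_infinity G E (two_point P)" "0 < \<epsilon>"
  shows "\<exists>r. \<forall>g\<in>carrier G. r < real (graph_dist E \<one> g) \<longrightarrow> two_point P \<one> g \<le> \<epsilon>"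
proof -
  define D where "D r = {(g, h). g \<in> carrier G \<and> h \<in> carrier G \<and> r < real (graph_dist E g h)}" for r
  have "((\<lambda>r. SUP (g, h)\<in>D r. two_point P g h) \<longlongrightarrow> 0) at_top"
    using assms(1) by (simp add: vanishes_at_infinity_def D_def)
  then have "\<forall>\<^sub>F r in at_top. (SUP (g, h)\<in>D r. two_point P g h) < \<epsilon>"
    using assms(2) by (rule order_tendstoD)
  then obtain r where r: "(SUP (g, h)\<in>D r. two_point P g h) < \<epsilon>"
    using eventually_happens'[OF trivial_limit_at_top_linorder] by blast
  have "two_point P \<one> g \<le> \<epsilon>" if "g \<in> carrier G" "r < real (graph_dist E \<one> g)" for g
  proof -
    have "bdd_above ((\<lambda>(g, h). two_point P g h) ` D r)"
      by (intro bdd_aboveI2[of _ _ 1]) (auto simp: two_point_def)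
    then have "(case (\<one>, g) of (g, h) \<Rightarrow> two_point P g h) \<le> (SUP (g, h)\<in>D r. two_point P g h)"
      using that by (intro cSUP_upper) (auto simp: D_def)
    then show ?thesis using r by simp
  qed
  then show ?thesis by blast
qed

end

section \<open>From percolations to a proper conditionally negative function\<close>

context cayley_graph
begin

lemma card_S_pos: "infinite (carrier G) \<Longrightarrow> 0 < card S"
  using finite_S generate_S generate_empty by (metis card_gt_0_iff finite.emptyI finite.insertI)

lemma haagerup_of_percolations:
  assumes inf: "infinite (carrier G)" and h: "(UNIV :: real set) \<lesssim> (UNIV :: 'h set)"
    and perc: "\<And>\<alpha>::real. \<alpha> < 1 \<Longrightarrow>
      \<exists>P. bond_percolation E P \<and> invariant_percolation G P \<and>
         (\<integral>\<omega>. real (degree_in \<omega> \<one>) \<partial>P) > \<alpha> * real (degree_in E \<one>) \<and>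
         vanishes_at_infinity G E (two_point P)"
  shows "haagerup TYPE('h) G"
proof -
  \<comment> \<open>The division by \<open>card S\<close> compensates the factor in
    \<open>two_point_generator\<close>, so each generator has \<open>q n s\<close> at most 2 to the
    power -n.\<close>
  have "\<exists>P. bond_percolation E P \<and> invariant_percolation G P \<and>
     (\<integral>\<omega>. real (degree_in \<omega> \<one>) \<partial>P) > (1 - (1/2)^n / card S) * real (degree_in E \<one>) \<and>
     vanishes_at_infinity G E (two_point P)" for n :: nat
    using card_S_pos[OF inf] by (intro perc) simp
  then obtain P :: "nat \<Rightarrow> 'a set set measure" where
    bond: "\<And>n. bond_percolation E (P n)" and inv: "\<And>n. invariant_percolation G (P n)" and
    deg: "\<And>n. (1 - (1/2)^n / card S) * real (degree_in E \<one>) < (\<integral>\<omega>. real (degree_in \<omega> \<one>) \<partial>P n)" and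
    van: "\<And>n. vanishes_at_infinity G E (two_point (P n))"
    by metis
  interpret P: cayley_percolation G S "P n" for n
    by unfold_locales (rule bond)
  define q where "q n g = 1 - two_point (P n) \<one> g" for n g
  have q_nonneg: "0 \<le> q n g" for n g by (simp add: q_def two_point_def)
  have q_diff: "q n (inv g \<otimes> h) = 1 - two_point (P n) g h" if "g \<in> carrier G" "h \<in> carrier G" for n g h
    using P.two_point_translate[OF inv[of n], of g \<one> "inv g \<otimes> h"] that
    by (simp add: q_def m_assoc[symmetric])
  have q_gen: "q n s \<le> (1/2)^n" if "s \<in> S" for n s
    using P.two_point_generator[OF that deg] card_S_pos[OF inf] by (simp add: q_def)
  \<comment> \<open>By the triangle inequality the length of a walk serves as \<open>k\<close>. Its
    independence of \<open>n\<close> is what makes the series converge.\<close>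
  have "\<exists>k. \<forall>n. q n g \<le> k * (1/2)^n" if "(\<one>, g) \<in> adjacency E ^^ m" for m g
    using that
  proof (induction m arbitrary: g)
    case 0
    then show ?case by (intro exI[of _ 0]) (simp add: q_def P.two_point_self)
  next
    case (Suc m)
    then obtain h where h: "(\<one>, h) \<in> adjacency E ^^ m" "(h, g) \<in> adjacency E" by auto
    from Suc.IH[OF h(1)] obtain k where k: "\<And>n. q n h \<le> k * (1/2)^n" by blast
    from h(2) obtain s where s: "s \<in> S" "g = h \<otimes> s" "h \<in> carrier G"
      unfolding adjacency_E by blast
    have "q n g \<le> (k + 1) * (1/2)^n" for n
    proof -
      have "q n g \<le> q n h + q n s"
        using P.two_point_triangle[where n = n and g = \<one> and k = g and h = h] q_diff[of h g n] s
        by (simp add: q_def m_assoc[symmetric])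
      then show ?thesis using k[of n] q_gen[OF s(1), of n] by (simp add: algebra_simps)
    qed
    then show ?case by blast
  qed
  then have q_bound: "\<exists>k. \<forall>n. q n g \<le> k * (1/2)^n" if "g \<in> carrier G" for g
    using walk_from_one[OF that] by blast
  have q_summable: "summable (\<lambda>n. q n g)" if g: "g \<in> carrier G" for g
  proof -
    obtain k where k: "\<And>n. q n g \<le> k * (1/2)^n" using q_bound[OF g] by blast
    show ?thesis
    proof (rule summable_comparison_test'[of "\<lambda>n. k * (1/2)^n" 0])
      show "summable (\<lambda>n. k * (1 / 2 :: real) ^ n)" by (intro summable_mult summable_geometric) simp
      show "norm (q n g) \<le> k * (1/2)^n" for n using k[of n] q_nonneg[of n g] by simp
    qed
  qed
  define \<psi> where "\<psi> g = (\<Sum>n. q n g)" for g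
  obtain \<iota> :: "('a \<Rightarrow> real) \<Rightarrow> 'h" where "inj_on \<iota> {f. \<forall>x. x \<notin> carrier G \<longrightarrow> f x = 0}"
    using inj_real_functions_into[OF countable_carrier h] by blast
  with is_group show ?thesis
  proof (rule haagerup_of_conditionally_negative)
    show "\<psi> \<one> = 0" by (simp add: \<psi>_def q_def P.two_point_self)
    show "\<psi> (inv g) = \<psi> g" if "g \<in> carrier G" for g
      using q_diff[of g \<one>] that by (simp add: \<psi>_def q_def P.two_point_commute[of _ g])
    show "lin c (\<lambda>x. lin c (\<lambda>y. \<psi> (inv x \<otimes> y))) \<le> 0"
      if c: "snd ` set c \<subseteq> carrier G" "lin c (\<lambda>_. 1) = 0" for c
    proof -
      have sums: "(\<lambda>n. lin c (\<lambda>x. lin c (\<lambda>y. q n (inv x \<otimes> y)))) sums lin c (\<lambda>x. lin c (\<lambda>y. \<psi> (inv x \<otimes> y)))"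
        unfolding \<psi>_def using c(1) by (intro sums_lin summable_sums q_summable) auto
      have "lin c (\<lambda>x. lin c (\<lambda>y. q n (inv x \<otimes> y))) \<le> 0" for n
      proof -
        have "lin c (\<lambda>x. lin c (\<lambda>y. q n (inv x \<otimes> y))) = lin c (\<lambda>x. lin c (\<lambda>y. 1 - two_point (P n) x y))"
          using c(1) by (intro lin_cong q_diff) auto
        \<comment> \<open>On mass zero the constant 1 drops out, leaving minus the positive form of
          the two-point function.\<close>
        then show ?thesis
          using P.two_point_positive[where n = n and c = c] c(2) by (simp add: lin_diff lin_uminus)
      qed
      from sums_le[OF this sums sums_zero] show ?thesis .
    qed
    show "finite {g \<in> carrier G. \<psi> g \<le> R}" for R
    proof -
      \<comment> \<open>Far out, each of the first \<open>M\<close> terms of the series is at least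
        1/2, and M / 2 exceeds \<open>R\<close>.\<close>
      obtain M :: nat where M: "2 * R < real M" using reals_Archimedean2 by blast
      have "\<exists>r. \<forall>g\<in>carrier G. r < real (graph_dist E \<one> g) \<longrightarrow> two_point (P n) \<one> g \<le> 1/2" for n
        by (intro P.two_point_bounded_far van) simp
      then obtain r where r: "\<And>n g. g \<in> carrier G \<Longrightarrow> r n < real (graph_dist E \<one> g) \<Longrightarrow> two_point (P n) \<one> g \<le> 1/2"
        by metis
      have "real (graph_dist E \<one> g) \<le> Max (insert 0 (r ` {..<M}))" if g: "g \<in> carrier G" "\<psi> g \<le> R" for g
      proof (rule ccontr)
        assume far: "\<not> ?thesis"
        have "1/2 \<le> q n g" if "n < M" for n
        proof -
          have "r n \<le> Max (insert 0 (r ` {..<M}))" using that by (intro Max_ge) auto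
          then show ?thesis using r[OF g(1), of n] far by (simp add: q_def)
        qed
        then have "(\<Sum>n<M. 1/2) \<le> (\<Sum>n<M. q n g)" by (intro sum_mono) simp
        also have "\<dots> \<le> \<psi> g" unfolding \<psi>_def
          using q_nonneg by (intro sum_le_suminf q_summable g) auto
        finally show False using M g(2) by simp
      qed
      then show ?thesis by (intro finite_subset[OF _ finite_ball]) auto
    qed
  qed
qed

end

section \<open>Uniqueness of laws by characteristic functions\<close>

text \<open>The value at t = 0 shows that the total masses agree. If positive, they are normalised
  away to reach Levy's theorem for distributions.\<close>

lemma finite_measure_eq_by_char:
  fixes \<mu> \<nu> :: "real measure"
  assumes fin: "finite_measure \<mu>" "finite_measure \<nu>"
    and sets [simp, measurable_cong]: "sets \<mu> = sets borel" "sets \<nu> = sets borel"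
    and char: "\<And>t. (CLINT x|\<mu>. iexp (t * x)) = (CLINT x|\<nu>. iexp (t * x))"
  shows "\<mu> = \<nu>"
proof -
  interpret \<mu>: finite_measure \<mu> by fact
  interpret \<nu>: finite_measure \<nu> by fact
  have sp [simp]: "space \<mu> = UNIV" "space \<nu> = UNIV"
    using sets_eq_imp_space_eq[OF sets(1)] sets_eq_imp_space_eq[OF sets(2)] by simp_all
  define m where "m = measure \<mu> UNIV"
  have m': "m = measure \<nu> UNIV"
    using char[of 0] by (simp add: m_def)
  have em: "emeasure \<mu> UNIV = ennreal m" "emeasure \<nu> UNIV = ennreal m"
    by (simp_all add: \<mu>.emeasure_eq_measure \<nu>.emeasure_eq_measure m_def[symmetric] m'[symmetric])
  show ?thesis
  proof (cases "m = 0")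
    case True
    have "emeasure \<mu> A = 0" "emeasure \<nu> A = 0" if "A \<in> sets borel" for A
      using emeasure_mono[of A UNIV \<mu>] emeasure_mono[of A UNIV \<nu>] em True by simp_all
    then show ?thesis by (intro measure_eqI) simp_all
  next
    case False
    then have m: "0 < m" by (simp add: m_def zero_less_measure_iff)
    have rd: "real_distribution (density M (\<lambda>_. ennreal (1 / m)))"
      if "sets M = sets borel" "emeasure M UNIV = ennreal m" for M :: "real measure"
    proof (intro real_distribution.intro prob_spaceI real_distribution_axioms.intro)
      have [simp]: "space M = UNIV" using sets_eq_imp_space_eq[OF that(1)] by simp
      show "emeasure (density M (\<lambda>_. ennreal (1 / m))) (space (density M (\<lambda>_. ennreal (1 / m)))) = 1"
        using m that by (simp add: emeasure_density_const flip: ennreal_mult)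
    qed (simp_all add: that)
    have ch: "char (density M (\<lambda>_. ennreal (1 / m))) t = (1 / m) * (CLINT x|M. iexp (t * x))"
      if [measurable_cong]: "sets M = sets borel" for M t
      using m unfolding char_def by (subst integral_density) (simp_all add: scaleR_conv_of_real)
    have eq: "density \<mu> (\<lambda>_. ennreal (1 / m)) = density \<nu> (\<lambda>_. ennreal (1 / m))"
    proof (rule Levy_uniqueness)
      show "char (density \<mu> (\<lambda>_. ennreal (1 / m))) = char (density \<nu> (\<lambda>_. ennreal (1 / m)))"
        by (rule ext) (simp only: ch[OF sets(1)] ch[OF sets(2)] char)
    qed (intro rd sets em)+
    show ?thesis
    proof (rule measure_eqI)
      fix A assume A: "A \<in> sets \<mu>"
      then have "ennreal (1 / m) * emeasure \<mu> A = ennreal (1 / m) * emeasure \<nu> A"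
        using arg_cong[OF eq, of "\<lambda>M. emeasure M A"] by (simp add: emeasure_density_const)
      then show "emeasure \<mu> A = emeasure \<nu> A"
        using m by (simp add: ennreal_mult_cancel_left)
    qed simp
  qed
qed

text \<open>Uniqueness applied to the image under \<open>X\<close> of the finite measure with
  density \<open>W\<close>.\<close>

lemma weighted_law_eq:
  fixes W X :: "'a \<Rightarrow> real"
  assumes "prob_space M1" "prob_space M2"
    and meas [measurable]: "W \<in> borel_measurable M1" "X \<in> borel_measurable M1"
      "W \<in> borel_measurable M2" "X \<in> borel_measurable M2"
    and W: "\<And>x. 0 \<le> W x" "\<And>x. W x \<le> C"
    and char: "\<And>t. (CLINT x|M1. W x * iexp (t * X x)) = (CLINT x|M2. W x * iexp (t * X x))"
    and A [measurable]: "A \<in> sets borel"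
  shows "(LINT x|M1. W x * indicator A (X x)) = (LINT x|M2. W x * indicator A (X x))"
proof -
  define \<mu> where "\<mu> M = distr (density M (\<lambda>x. ennreal (W x))) borel X" for M
  have fin: "finite_measure (\<mu> M)"
    and ch: "(CLINT x|\<mu> M. iexp (t * x)) = (CLINT x|M. W x * iexp (t * X x))"
    and ev: "measure (\<mu> M) A = (LINT x|M. W x * indicator A (X x))"
    if "prob_space M" and [measurable]: "W \<in> borel_measurable M" "X \<in> borel_measurable M" for M t
  proof -
    interpret prob_space M by fact
    have int: "integrable M W"
      using W by (intro integrable_const_bound[of _ C]) auto
    have "(\<integral>\<^sup>+ x. ennreal (W x) \<partial>M) < \<infinity>"
      using int W by (simp add: integrable_iff_bounded)
    then have "finite_measure (density M (\<lambda>x. ennreal (W x)))"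
      by (intro finite_measureI) (simp add: emeasure_density)
    then show "finite_measure (\<mu> M)"
      unfolding \<mu>_def by (rule finite_measure.finite_measure_distr) simp
    show "(CLINT x|\<mu> M. iexp (t * x)) = (CLINT x|M. W x * iexp (t * X x))"
      using W unfolding \<mu>_def by (simp add: integral_distr integral_density scaleR_conv_of_real)
    have "(LINT x|\<mu> M. indicat_real A x) = (LINT x|M. W x * indicator A (X x))"
      using W unfolding \<mu>_def by (subst integral_distr; simp) (simp add: integral_density)
    then show "measure (\<mu> M) A = (LINT x|M. W x * indicator A (X x))"
      by (simp add: \<mu>_def)
  qed
  have "\<mu> M1 = \<mu> M2"
  proof (rule finite_measure_eq_by_char)
    show "(CLINT x|\<mu> M1. iexp (t * x)) = (CLINT x|\<mu> M2. iexp (t * x))" for t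
      by (simp only: ch[OF assms(1) meas(1,2)] ch[OF assms(2) meas(3,4)] char)
    show "finite_measure (\<mu> M1)" "finite_measure (\<mu> M2)"
      by (intro fin assms)+
  qed (simp_all add: \<mu>_def)
  then show ?thesis
    using ev[OF assms(1)] ev[OF assms(2)] by simp
qed

lemma measurable_lin:
  assumes "snd ` set c \<subseteq> I"
  shows "lin c \<in> borel_measurable (PiM I (\<lambda>_. borel))"
proof -
  have "(\<lambda>Y. lin c Y) \<in> borel_measurable (PiM I (\<lambda>_. borel))"
    using assms
  proof (induction c)
    case (Cons p c)
    then show ?case
      by (cases p) (auto intro!: borel_measurable_add borel_measurable_times measurable_component_singleton)
  next
    case Nil
    have "lin [] = (\<lambda>Y :: 'i \<Rightarrow> real. 0)" by (simp add: fun_eq_iff)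
    then show ?case by simp
  qed
  then show ?thesis by simp
qed

text \<open>
  The coordinates are passed one after the other from the characters to indicator functions; the
  remaining character is traded for the nonnegative weights \<open>1 + cos\<close> and \<open>1 + sin\<close>, which makes
  the one-dimensional uniqueness theorem applicable.
\<close>

lemma PiM_eq_by_char:
  fixes M1 M2 :: "('i \<Rightarrow> real) measure"
  assumes prob: "prob_space M1" "prob_space M2"
    and sets [measurable_cong]: "sets M1 = sets (PiM I (\<lambda>_. borel))" "sets M2 = sets (PiM I (\<lambda>_. borel))"
    and char: "\<And>c. snd ` set c \<subseteq> I \<Longrightarrow> (CLINT Y|M1. iexp (lin c Y)) = (CLINT Y|M2. iexp (lin c Y))"
  shows "M1 = M2"
proof (rule measure_eqI_PiM_infinite[OF sets])
  interpret M1: prob_space M1 by fact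
  interpret M2: prob_space M2 by fact
  show "finite_measure M1" by unfold_locales
  fix A :: "'i \<Rightarrow> real set" and J assume J: "finite J" "J \<subseteq> I" and A: "\<And>i. i \<in> J \<Longrightarrow> A i \<in> sets borel"
  define w where "w J Y = (\<Prod>j\<in>J. indicat_real (A j) (Y j))" for J Y
  have w01: "0 \<le> w J Y" "w J Y \<le> 1" for J Y
    by (auto simp: w_def intro!: prod_nonneg prod_le_1)
  have w_meas: "w J \<in> borel_measurable (PiM I (\<lambda>_. borel))" if "J \<subseteq> I" "\<And>i. i \<in> J \<Longrightarrow> A i \<in> sets borel" for J
    unfolding w_def using that
    by (intro borel_measurable_prod borel_measurable_indicator' measurable_compose[OF measurable_component_singleton]) auto
  \<comment> \<open>The claim must hold for all \<open>c\<close> at once: moving \<open>j\<close> to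
    the indicators uses it for combinations enlarged by a term at \<open>j\<close>.\<close>
  have "\<forall>c. snd ` set c \<subseteq> I \<longrightarrow>
      (CLINT Y|M1. w J Y * iexp (lin c Y)) = (CLINT Y|M2. w J Y * iexp (lin c Y))"
    using J A
  proof (induction J rule: finite_induct)
    case empty
    then show ?case using char by (simp add: w_def)
  next
    case (insert j J)
    have j: "j \<in> I" and JI: "J \<subseteq> I" and Aj [measurable]: "A j \<in> sets borel" and AJ: "\<And>i. i \<in> J \<Longrightarrow> A i \<in> sets borel"
      using insert.prems by auto
    have IH: "(CLINT Y|M1. w J Y * iexp (lin c Y)) = (CLINT Y|M2. w J Y * iexp (lin c Y))"
      if "snd ` set c \<subseteq> I" for c
      using insert.IH JI AJ that by blast
    have wJ [measurable]: "w J \<in> borel_measurable (PiM I (\<lambda>_. borel))"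
      by (rule w_meas[OF JI AJ])
    have Yj [measurable]: "(\<lambda>Y. Y j) \<in> borel_measurable (PiM I (\<lambda>_. borel))"
      using j by simp
    show ?case
    proof (intro allI impI)
      fix c :: "(real \<times> 'i) list" assume c: "snd ` set c \<subseteq> I"
      note [measurable] = measurable_lin[OF c]
      define L where "L Y = lin c Y" for Y
      have L [measurable]: "L \<in> borel_measurable (PiM I (\<lambda>_. borel))"
        unfolding L_def by (rule measurable_lin[OF c])
      \<comment> \<open>The combinations \<open>c\<close> and -c give the two exponentials in cos
        and sin, so the weighted integrals in \<open>Wc\<close> and \<open>Ws\<close> expand into
        characters covered by \<open>IH\<close>.\<close>
      let ?s = "scale_comb (-1) c"
      have int: "complex_integrable M (\<lambda>Y. w J Y * iexp (lin d Y))"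
        if "prob_space M" "snd ` set d \<subseteq> I" and [measurable_cong]: "sets M = sets (PiM I (\<lambda>_. borel))" for M d
      proof -
        interpret prob_space M by fact
        note [measurable] = measurable_lin[OF that(2)]
        show ?thesis
          using w01 by (intro integrable_const_bound[of _ 1]) (auto simp: norm_mult)
      qed
      have ints: "complex_integrable M1 (\<lambda>Y. w J Y * iexp (lin d Y))" "complex_integrable M2 (\<lambda>Y. w J Y * iexp (lin d Y))"
        if "snd ` set d \<subseteq> I" for d
        using int that prob sets by blast+
      have combs: "snd ` set [(t, j)] \<subseteq> I" "snd ` set ((t, j) # c) \<subseteq> I" "snd ` set ((t, j) # ?s) \<subseteq> I" for t
        using c j by auto
      have e0: "w J Y * iexp (t * Y j) = w J Y * iexp (lin [(t, j)] Y)" for Y t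
        by simp
      have ec: "complex_of_real (w J Y * (1 + cos (L Y))) * iexp (t * Y j) =
          w J Y * iexp (lin [(t, j)] Y) + (w J Y * iexp (lin ((t, j) # c) Y)) / 2
            + (w J Y * iexp (lin ((t, j) # ?s) Y)) / 2" for Y t
        by (simp add: L_def cos_exp_eq exp_add exp_diff exp_minus field_simps flip: cos_of_real)
      have es: "complex_of_real (w J Y * (1 + sin (L Y))) * iexp (t * Y j) =
          w J Y * iexp (lin [(t, j)] Y) + (w J Y * iexp (lin ((t, j) # c) Y)) / (2 * \<i>)
            - (w J Y * iexp (lin ((t, j) # ?s) Y)) / (2 * \<i>)" for Y t
        by (simp add: L_def sin_exp_eq exp_add exp_diff exp_minus field_simps flip: sin_of_real)
      have W0: "(LINT Y|M1. w J Y * indicator (A j) (Y j)) = (LINT Y|M2. w J Y * indicator (A j) (Y j))"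
        by (rule weighted_law_eq[OF prob, where C = 1]) (use w01 IH[OF combs(1)] in \<open>auto simp: e0\<close>)
      have Wc: "(LINT Y|M1. w J Y * (1 + cos (L Y)) * indicator (A j) (Y j)) =
          (LINT Y|M2. w J Y * (1 + cos (L Y)) * indicator (A j) (Y j))"
      proof (rule weighted_law_eq[OF prob, where C = 2])
        show "0 \<le> w J Y * (1 + cos (L Y))" for Y
          by (intro mult_nonneg_nonneg w01) (use cos_ge_minus_one[of "L Y"] in linarith)
        show "w J Y * (1 + cos (L Y)) \<le> 2" for Y
          using mult_mono[of "w J Y" 1 "1 + cos (L Y)" 2] w01 cos_ge_minus_one[of "L Y"] by simp
        show "(CLINT Y|M1. complex_of_real (w J Y * (1 + cos (L Y))) * iexp (t * Y j)) =
            (CLINT Y|M2. complex_of_real (w J Y * (1 + cos (L Y))) * iexp (t * Y j))" for t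
          unfolding ec by (simp only: Bochner_Integration.integral_add Bochner_Integration.integrable_add
              integral_divide_zero integrable_divide_zero ints combs IH simp_thms)
      qed measurable
      have Ws: "(LINT Y|M1. w J Y * (1 + sin (L Y)) * indicator (A j) (Y j)) =
          (LINT Y|M2. w J Y * (1 + sin (L Y)) * indicator (A j) (Y j))"
      proof (rule weighted_law_eq[OF prob, where C = 2])
        show "0 \<le> w J Y * (1 + sin (L Y))" for Y
          by (intro mult_nonneg_nonneg w01) (use sin_ge_minus_one[of "L Y"] in linarith)
        show "w J Y * (1 + sin (L Y)) \<le> 2" for Y
          using mult_mono[of "w J Y" 1 "1 + sin (L Y)" 2] w01 sin_ge_minus_one[of "L Y"] by simp
        show "(CLINT Y|M1. complex_of_real (w J Y * (1 + sin (L Y))) * iexp (t * Y j)) =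
            (CLINT Y|M2. complex_of_real (w J Y * (1 + sin (L Y))) * iexp (t * Y j))" for t
          unfolding es by (simp only: Bochner_Integration.integral_add Bochner_Integration.integrable_add
              Bochner_Integration.integral_diff Bochner_Integration.integrable_diff
              integral_divide_zero integrable_divide_zero ints combs IH simp_thms)
      qed measurable
      \<comment> \<open>The 1 added to make the weights nonnegative is subtracted again, and Euler's
        formula restores the character.\<close>
      have split: "(CLINT Y|M. w (insert j J) Y * iexp (lin c Y)) =
          complex_of_real ((LINT Y|M. w J Y * (1 + cos (L Y)) * indicator (A j) (Y j))
            - (LINT Y|M. w J Y * indicator (A j) (Y j)))
          + \<i> * complex_of_real ((LINT Y|M. w J Y * (1 + sin (L Y)) * indicator (A j) (Y j))
            - (LINT Y|M. w J Y * indicator (A j) (Y j)))"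
        if "prob_space M" and [measurable_cong]: "sets M = sets (PiM I (\<lambda>_. borel))" for M
      proof -
        interpret prob_space M by fact
        have bd: "integrable M (\<lambda>Y. w J Y * f Y * indicator (A j) (Y j))"
          if [measurable]: "f \<in> borel_measurable (PiM I (\<lambda>_. borel))" and "\<And>Y. \<bar>f Y\<bar> \<le> 2" for f
        proof (intro integrable_const_bound[of _ 2] AE_I2)
          fix Y
          have "w J Y * \<bar>f Y\<bar> \<le> 1 * 2" using w01 that(2) by (intro mult_mono) auto
          then show "norm (w J Y * f Y * indicator (A j) (Y j)) \<le> 2"
            using w01 by (auto simp: abs_mult split: split_indicator)
        qed simp
        have i0: "integrable M (\<lambda>Y. w J Y * indicator (A j) (Y j))"
          using bd[of "\<lambda>_. 1"] by simp
        have ic: "integrable M (\<lambda>Y. w J Y * cos (L Y) * indicator (A j) (Y j))"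
          by (intro bd) (auto intro: order_trans[OF abs_cos_le_one])
        have isin: "integrable M (\<lambda>Y. w J Y * sin (L Y) * indicator (A j) (Y j))"
          by (intro bd) (auto intro: order_trans[OF abs_sin_le_one])
        have c: "(LINT Y|M. w J Y * (1 + cos (L Y)) * indicator (A j) (Y j)) =
          (LINT Y|M. w J Y * indicator (A j) (Y j)) + (LINT Y|M. w J Y * cos (L Y) * indicator (A j) (Y j))"
          using i0 ic by (simp add: distrib_left distrib_right)
        have s: "(LINT Y|M. w J Y * (1 + sin (L Y)) * indicator (A j) (Y j)) =
          (LINT Y|M. w J Y * indicator (A j) (Y j)) + (LINT Y|M. w J Y * sin (L Y) * indicator (A j) (Y j))"
          using i0 isin by (simp add: distrib_left distrib_right)
        have "complex_of_real (w (insert j J) Y) * iexp (lin c Y) =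
            complex_of_real (w J Y * cos (L Y) * indicator (A j) (Y j))
            + \<i> * complex_of_real (w J Y * sin (L Y) * indicator (A j) (Y j))" for Y
          using insert.hyps by (simp add: w_def L_def exp_Euler algebra_simps flip: cos_of_real sin_of_real)
        then show ?thesis
          unfolding c s using ic isin by (simp del: of_real_mult)
      qed
      show "(CLINT Y|M1. w (insert j J) Y * iexp (lin c Y)) = (CLINT Y|M2. w (insert j J) Y * iexp (lin c Y))"
        by (simp only: split[OF prob(1) sets(1)] split[OF prob(2) sets(2)] W0 Wc Ws)
    qed
  qed
  \<comment> \<open>The empty combination leaves the probability of a cylinder set.\<close>
  from this[rule_format, of "[]"] have eq: "(LINT Y|M1. w J Y) = (LINT Y|M2. w J Y)"
    by simp
  have ind: "w J Y = indicator (prod_emb I (\<lambda>_. borel) J (Pi\<^sub>E J A)) Y" if "Y \<in> extensional I" for Y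
  proof -
    have "restrict Y J \<in> Pi\<^sub>E J A \<longleftrightarrow> (\<forall>j\<in>J. Y j \<in> A j)" by auto
    moreover have "w J Y = (if \<forall>j\<in>J. Y j \<in> A j then 1 else 0)"
      using J(1) by (auto simp: w_def indicator_def intro!: prod.neutral)
    ultimately show ?thesis
      using that by (simp add: prod_emb_def indicator_def space_PiM PiE_def)
  qed
  have em: "emeasure M (prod_emb I (\<lambda>_. borel) J (Pi\<^sub>E J A)) = ennreal (LINT Y|M. w J Y)"
    if "prob_space M" "sets M = sets (PiM I (\<lambda>_. borel))" for M
  proof -
    interpret prob_space M by fact
    have sp: "space M = space (PiM I (\<lambda>_. borel))" using sets_eq_imp_space_eq[OF that(2)] .
    have mem: "prod_emb I (\<lambda>_. borel) J (Pi\<^sub>E J A) \<in> sets M"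
      unfolding that(2) using J A by (intro sets_PiM_I) auto
    have "(LINT Y|M. w J Y) = (LINT Y|M. indicat_real (prod_emb I (\<lambda>_. borel) J (Pi\<^sub>E J A)) Y)"
      by (intro Bochner_Integration.integral_cong refl ind) (simp add: sp space_PiM PiE_def)
    also have "\<dots> = measure M (prod_emb I (\<lambda>_. borel) J (Pi\<^sub>E J A))"
      using mem sets.sets_into_space[OF mem] by (simp add: Int_absorb2)
    finally show ?thesis by (simp add: emeasure_eq_measure)
  qed
  show "emeasure M1 (prod_emb I (\<lambda>_. borel) J (Pi\<^sub>E J A)) = emeasure M2 (prod_emb I (\<lambda>_. borel) J (Pi\<^sub>E J A))"
    by (simp only: em[OF prob(1) sets(1)] em[OF prob(2) sets(2)] eq)
qed

section \<open>Gaussian fields\<close>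

text \<open>Iterated Gaussian elimination: the conditional covariance given the field at the first n
  points of the enumeration.\<close>

primrec schur :: "('i \<Rightarrow> 'i \<Rightarrow> real) \<Rightarrow> (nat \<Rightarrow> 'i) \<Rightarrow> nat \<Rightarrow> 'i \<Rightarrow> 'i \<Rightarrow> real" where
  "schur K e 0 = K"
| "schur K e (Suc n) = (\<lambda>x y. schur K e n x y
      - schur K e n x (e n) * schur K e n (e n) y / schur K e n (e n) (e n))"

text \<open>
  Division by zero yields zero, so that a Schur complement with respect to a null vector of the
  form leaves the form unchanged.
\<close>

definition cholesky :: "('i \<Rightarrow> 'i \<Rightarrow> real) \<Rightarrow> (nat \<Rightarrow> 'i) \<Rightarrow> nat \<Rightarrow> 'i \<Rightarrow> real" where
  "cholesky K e n x = schur K e n x (e n) / sqrt (schur K e n (e n) (e n))"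

locale positive_kernel =
  fixes I :: "'i set" and K :: "'i \<Rightarrow> 'i \<Rightarrow> real"
  assumes K_commute: "\<lbrakk>x \<in> I; y \<in> I\<rbrakk> \<Longrightarrow> K x y = K y x"
    and K_positive: "snd ` set c \<subseteq> I \<Longrightarrow> 0 \<le> form K c c"
begin

lemma diag_nonneg: "x \<in> I \<Longrightarrow> 0 \<le> K x x"
  using K_positive[of "[(1, x)]"] by (simp add: form_def)

text \<open>Cauchy-Schwarz: a direction of zero variance is uncorrelated with everything. This keeps
  the elimination correct at a zero pivot.\<close>

lemma null_vector:
  assumes "x \<in> I" "y \<in> I" "K y y = 0"
  shows "K x y = 0"
proof -
  have "(- K x y)\<^sup>2 \<le> K x x * 0"
  proof (rule square_le_of_quadratic)
    show "2 * t * (- K x y) - t\<^sup>2 * 0 \<le> K x x" for t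
      using K_positive[of "[(1, x), (t, y)]"] K_commute[of y x] assms by (simp add: form_def)
  qed (simp_all add: diag_nonneg assms)
  then show ?thesis by simp
qed

text \<open>Completing the square: the new form at c is the old form at c with the multiple -k / K e
  e of the point mass at \<open>e\<close> added.\<close>

lemma schur_step:
  assumes "e \<in> I"
  shows "positive_kernel I (\<lambda>x y. K x y - K x e * K e y / K e e)"
proof
  show "K x y - K x e * K e y / K e e = K y x - K y e * K e x / K e e" if "x \<in> I" "y \<in> I" for x y
    using K_commute that assms by (simp add: mult.commute)
  show "0 \<le> form (\<lambda>x y. K x y - K x e * K e y / K e e) c c" if c: "snd ` set c \<subseteq> I" for c
  proof -
    define k where "k = lin c (K e)"
    have k': "lin c (\<lambda>x. K x e) = k"
      unfolding k_def using c assms by (intro lin_cong K_commute) auto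
    have "form (\<lambda>x y. K x y - K x e * K e y / K e e) c c
        = form K c c - lin c (\<lambda>x. lin c (\<lambda>y. K x e / K e e * K e y))"
      by (simp add: form_def lin_diff)
    also have "lin c (\<lambda>x. lin c (\<lambda>y. K x e / K e e * K e y)) = lin c (\<lambda>x. K x e / K e e * k)"
      by (simp only: lin_scale k_def)
    also have "\<dots> = k / K e e * k"
      by (simp only: divide_inverse lin_scale_right k')
    finally have eq: "form (\<lambda>x y. K x y - K x e * K e y / K e e) c c = form K c c - k / K e e * k" .
    show ?thesis
    proof (cases "K e e = 0")
      case True
      then show ?thesis using eq K_positive[OF c] by simp
    next
      case False
      have "form K ((t, e) # c) ((t, e) # c) = t * t * K e e + 2 * t * k + form K c c" for t
        by (simp add: form_def lin_add lin_scale k' k_def[symmetric]) (simp add: algebra_simps)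
      from this[of "- k / K e e"] False
      have "form K ((- k / K e e, e) # c) ((- k / K e e, e) # c) = form K c c - k / K e e * k"
        by simp
      then show ?thesis
        using eq K_positive[of "(- k / K e e, e) # c"] c assms by simp
    qed
  qed
qed

lemma schur_positive:
  assumes e: "range e \<subseteq> I"
  shows "positive_kernel I (schur K e n)"
proof (induction n)
  case 0
  show ?case by (simp add: positive_kernel_axioms)
next
  case (Suc n)
  then interpret Kn: positive_kernel I "schur K e n" .
  show ?case using Kn.schur_step[OF range_subsetD[OF e]] by simp
qed

text \<open>Eliminating a point kills its row, by cancellation for a nonzero pivot and by
  \<open>null_vector\<close> otherwise; later steps keep it zero.\<close>

lemma schur_null:
  assumes e: "range e \<subseteq> I" and "m < n" "x \<in> I"
  shows "schur K e n x (e m) = 0"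
  using assms(2,3)
proof (induction n arbitrary: x)
  case (Suc n)
  interpret Kn: positive_kernel I "schur K e n" by (rule schur_positive[OF e])
  show ?case
  proof (cases "m = n")
    case True
    then show ?thesis using Kn.null_vector[OF Suc.prems(2) range_subsetD[OF e, of n]] by auto
  next
    case False
    then show ?thesis using Suc.IH[OF _ Suc.prems(2)] Suc.IH[OF _ range_subsetD[OF e, of n]] Suc.prems by simp
  qed
qed simp

text \<open>Triangularity of the factor, the reason why each value of the field involves finitely
  many normals.\<close>

lemma cholesky_null:
  assumes e: "range e \<subseteq> I" and "m < n"
  shows "cholesky K e n (e m) = 0"
proof -
  interpret Kn: positive_kernel I "schur K e n" by (rule schur_positive[OF e])
  show ?thesis
    using schur_null[OF e assms(2) range_subsetD[OF e, of n]] Kn.K_commute[OF range_subsetD[OF e, of m] range_subsetD[OF e, of n]] by (simp add: cholesky_def)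
qed

lemma schur_eq:
  assumes e: "range e \<subseteq> I" and xy: "x \<in> I" "y \<in> I"
  shows "K x y = (\<Sum>j<n. cholesky K e j x * cholesky K e j y) + schur K e n x y"
proof (induction n)
  case (Suc n)
  interpret Kn: positive_kernel I "schur K e n" by (rule schur_positive[OF e])
  have "schur K e n x (e n) * schur K e n (e n) y / schur K e n (e n) (e n)
      = cholesky K e n x * cholesky K e n y"
    using Kn.diag_nonneg[OF range_subsetD[OF e, of n]] Kn.K_commute[OF xy(2) range_subsetD[OF e, of n]] by (simp add: cholesky_def)
  then show ?case using Suc.IH by simp
qed simp

text \<open>The remainder of the telescoping sum in \<open>schur_eq\<close> vanishes on the points
  already eliminated.\<close>

lemma form_cholesky:
  assumes e: "range e \<subseteq> I" and c: "snd ` set c \<subseteq> e ` {..<n}"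
  shows "form K c c = (\<Sum>j<n. (lin c (cholesky K e j))\<^sup>2)"
proof -
  have "form K c c = lin c (\<lambda>x. lin c (\<lambda>y. \<Sum>j<n. cholesky K e j x * cholesky K e j y))"
    unfolding form_def
  proof (intro lin_cong)
    fix x y assume "x \<in> snd ` set c" "y \<in> snd ` set c"
    then obtain m k where "m < n" "k < n" "x = e m" "y = e k" using c by blast
    then show "K x y = (\<Sum>j<n. cholesky K e j x * cholesky K e j y)"
      using schur_eq[OF e range_subsetD[OF e, of m] range_subsetD[OF e, of k], of n] schur_null[OF e \<open>k < n\<close> range_subsetD[OF e, of m]] by simp
  qed
  also have "\<dots> = (\<Sum>j<n. (lin c (cholesky K e j))\<^sup>2)"
    by (simp only: lin_sum lin_scale lin_scale_right power2_eq_square)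
  finally show ?thesis .
qed

end

section \<open>Independent normals and the field they generate\<close>

definition normal_sequence :: "(nat \<Rightarrow> real) measure" where
  "normal_sequence = PiM UNIV (\<lambda>_. std_normal_distribution)"

lemma prob_space_std_normal: "prob_space std_normal_distribution"
  using real_dist_normal_dist by (rule real_distribution.axioms(1))

lemma prob_space_normal_sequence: "prob_space normal_sequence"
  unfolding normal_sequence_def by (intro prob_space_PiM prob_space_std_normal)

lemma char_normal_sequence:
  "(CLINT \<xi>|normal_sequence. iexp (\<Sum>j<n. a j * \<xi> j)) = complex_of_real (exp (- (\<Sum>j<n. (a j)\<^sup>2) / 2))"
proof -
  interpret prob_space normal_sequence by (rule prob_space_normal_sequence)
  have coord [measurable]: "(\<lambda>\<xi>. \<xi> j) \<in> normal_sequence \<rightarrow>\<^sub>M std_normal_distribution" for j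
    unfolding normal_sequence_def by (rule measurable_component_singleton) simp
  then have [measurable]: "(\<lambda>\<xi>. \<xi> j) \<in> borel_measurable normal_sequence" for j
    by simp
  have law: "distr normal_sequence std_normal_distribution (\<lambda>\<xi>. \<xi> j) = std_normal_distribution" for j
    unfolding normal_sequence_def by (rule distr_PiM_component) (simp_all add: prob_space_std_normal)
  have "indep_vars (\<lambda>_. std_normal_distribution) (\<lambda>j \<xi>. \<xi> j) UNIV"
  proof (subst indep_vars_iff_distr_eq_PiM)
    have "(\<lambda>x. \<lambda>i\<in>UNIV. x i) = (\<lambda>x :: nat \<Rightarrow> real. x)" by (simp add: fun_eq_iff)
    then show "distr normal_sequence (PiM UNIV (\<lambda>_. std_normal_distribution)) (\<lambda>x. \<lambda>i\<in>UNIV. x i)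
        = (\<Pi>\<^sub>M i\<in>UNIV. distr normal_sequence std_normal_distribution (\<lambda>\<xi>. \<xi> i))"
      unfolding law by (simp only: normal_sequence_def distr_id)
  qed (use coord in simp_all)
  then have "indep_vars (\<lambda>_. borel) (\<lambda>j \<xi>. a j * \<xi> j) UNIV"
    by (rule indep_vars_compose2) simp
  then have "indep_vars (\<lambda>_. borel) (\<lambda>j \<xi>. a j * \<xi> j) {..<n}"
    by (rule indep_vars_subset) simp
  from char_distr_sum[OF this, of 1]
  have sum: "char (distr normal_sequence borel (\<lambda>\<xi>. \<Sum>j<n. a j * \<xi> j)) 1
      = (\<Prod>j<n. char (distr normal_sequence borel (\<lambda>\<xi>. a j * \<xi> j)) 1)" .
  have factor: "char (distr normal_sequence borel (\<lambda>\<xi>. a j * \<xi> j)) 1 = complex_of_real (exp (- ((a j)\<^sup>2 / 2)))" for j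
  proof -
    have "char (distr normal_sequence borel (\<lambda>\<xi>. a j * \<xi> j)) 1 = (CLINT \<xi>|normal_sequence. iexp (a j * \<xi> j))"
      unfolding char_def by (subst integral_distr) simp_all
    also have "\<dots> = (CLINT x|distr normal_sequence std_normal_distribution (\<lambda>\<xi>. \<xi> j). iexp (a j * x))"
      by (subst integral_distr) simp_all
    also have "\<dots> = char std_normal_distribution (a j)"
      by (simp add: law char_def)
    finally show ?thesis by (simp add: char_std_normal_distribution)
  qed
  have "(CLINT \<xi>|normal_sequence. iexp (\<Sum>j<n. a j * \<xi> j))
      = char (distr normal_sequence borel (\<lambda>\<xi>. \<Sum>j<n. a j * \<xi> j)) 1"
    unfolding char_def by (subst integral_distr) simp_all
  also have "\<dots> = complex_of_real (exp (- (\<Sum>j<n. (a j)\<^sup>2) / 2))"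
    unfolding sum factor by (simp add: sum_negf sum_divide_distrib flip: of_real_prod exp_sum)
  finally show ?thesis .
qed

lemma (in positive_kernel) gaussian_field:
  assumes I: "countable I" "infinite I"
  shows "\<exists>M. prob_space M \<and> sets M = sets (PiM I (\<lambda>_. borel)) \<and>
    (\<forall>c. snd ` set c \<subseteq> I \<longrightarrow> (CLINT Y|M. iexp (lin c Y)) = complex_of_real (exp (- form K c c / 2)))"
proof -
  define e where "e = from_nat_into I"
  define ix where "ix = to_nat_on I"
  have "I \<noteq> {}" using I by auto
  then have e: "range e \<subseteq> I" by (simp add: e_def image_subset_iff from_nat_into)
  have e_ix: "e (ix x) = x" if "x \<in> I" for x
    using I that by (simp add: e_def ix_def)
  \<comment> \<open>The sum includes the point's own index \<open>ix x\<close>; all later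
    coefficients vanish by \<open>cholesky_null\<close>.\<close>
  define Y where "Y \<xi> = (\<lambda>x\<in>I. \<Sum>j<Suc (ix x). cholesky K e j x * \<xi> j)" for \<xi> :: "nat \<Rightarrow> real"
  have coord [measurable]: "(\<lambda>\<xi>. \<xi> j) \<in> borel_measurable normal_sequence" for j
    using measurable_component_singleton[of j UNIV "\<lambda>_. std_normal_distribution"]
    by (simp add: normal_sequence_def)
  have Y [measurable]: "Y \<in> normal_sequence \<rightarrow>\<^sub>M PiM I (\<lambda>_. borel)"
    unfolding Y_def by (intro measurable_restrict) simp
  define M where "M = distr normal_sequence (PiM I (\<lambda>_. borel)) Y"
  have "(CLINT Y|M. iexp (lin c Y)) = complex_of_real (exp (- form K c c / 2))"
    if c: "snd ` set c \<subseteq> I" for c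
  proof -
    \<comment> \<open>A common length for the sums at all points of \<open>c\<close>; the inserted 0
      covers the empty combination.\<close>
    define n where "n = Suc (Max (insert 0 (ix ` snd ` set c)))"
    have n: "ix x < n" if "x \<in> snd ` set c" for x
      using that by (simp add: n_def less_Suc_eq_le)
    have sub: "snd ` set c \<subseteq> e ` {..<n}"
    proof
      fix x assume "x \<in> snd ` set c"
      then show "x \<in> e ` {..<n}" using n[of x] e_ix[of x] c by (intro image_eqI[of _ _ "ix x"]) auto
    qed
    have Yx: "Y \<xi> x = (\<Sum>j<n. \<xi> j * cholesky K e j x)" if x: "x \<in> snd ` set c" for \<xi> x
    proof -
      have xI: "x \<in> I" using c x by blast
      have "(\<Sum>j<Suc (ix x). cholesky K e j x * \<xi> j) = (\<Sum>j<n. cholesky K e j x * \<xi> j)"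
      proof (intro sum.mono_neutral_left ballI)
        fix j assume "j \<in> {..<n} - {..<Suc (ix x)}"
        then show "cholesky K e j x * \<xi> j = 0"
          using cholesky_null[OF e, of "ix x" j] e_ix[OF xI] by simp
      qed (use n[OF x] in auto)
      then show ?thesis using xI by (simp add: Y_def mult.commute)
    qed
    have lin: "lin c (Y \<xi>) = (\<Sum>j<n. lin c (cholesky K e j) * \<xi> j)" for \<xi>
    proof -
      have "lin c (Y \<xi>) = lin c (\<lambda>x. \<Sum>j<n. \<xi> j * cholesky K e j x)"
        by (intro lin_cong Yx)
      then show ?thesis by (simp only: lin_sum lin_scale mult.commute)
    qed
    note [measurable] = measurable_lin[OF c]
    have "(CLINT Y|M. iexp (lin c Y)) = (CLINT \<xi>|normal_sequence. iexp (lin c (Y \<xi>)))"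
      unfolding M_def by (subst integral_distr) simp_all
    then show ?thesis
      by (simp only: lin char_normal_sequence form_cholesky[OF e sub])
  qed
  moreover have "prob_space M"
    unfolding M_def by (intro prob_space.prob_space_distr prob_space_normal_sequence Y)
  moreover have "sets M = sets (PiM I (\<lambda>_. borel))" by (simp add: M_def)
  ultimately show ?thesis by blast
qed

text \<open>The law is given as a scaled standard normal rather than by a density, so that variance
  0 is included.\<close>

lemma law_of_char_normal:
  assumes "prob_space M" and X [measurable]: "X \<in> borel_measurable M"
    and char: "\<And>t. (CLINT x|M. iexp (t * X x)) = complex_of_real (exp (- (t\<^sup>2 * q) / 2))" and q: "0 \<le> q"
  shows "distr M borel X = distr std_normal_distribution borel (\<lambda>x. sqrt q * x)"
proof (rule Levy_uniqueness)
  interpret prob_space M by fact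
  interpret n: real_distribution std_normal_distribution by (rule real_dist_normal_dist)
  show "real_distribution (distr M borel X)" by simp
  show "real_distribution (distr std_normal_distribution borel (\<lambda>x. sqrt q * x))"
    by (intro n.real_distribution_distr) simp
  show "char (distr M borel X) = char (distr std_normal_distribution borel (\<lambda>x. sqrt q * x))"
  proof
    fix t
    have "char (distr M borel X) t = complex_of_real (exp (- (t\<^sup>2 * q) / 2))"
      unfolding char_def char[symmetric] by (subst integral_distr) simp_all
    also have "\<dots> = char std_normal_distribution (t * sqrt q)"
      using q by (simp add: char_std_normal_distribution power_mult_distrib)
    also have "\<dots> = char (distr std_normal_distribution borel (\<lambda>x. sqrt q * x)) t"
      unfolding char_def by (subst integral_distr) (simp_all add: mult.assoc)
    finally show "char (distr M borel X) t = char (distr std_normal_distribution borel (\<lambda>x. sqrt q * x)) t" .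
  qed
qed

text \<open>The density is at most 1 and the event lies in an interval of length 2 / sqrt q.\<close>

lemma normal_small_ball:
  assumes "0 < q"
  shows "measure std_normal_distribution {x. \<bar>sqrt q * x\<bar> < 1} \<le> 2 / sqrt q"
proof -
  have "emeasure std_normal_distribution {x. \<bar>sqrt q * x\<bar> < 1}
      = (\<integral>\<^sup>+ x. ennreal (std_normal_density x) * indicator {x. \<bar>sqrt q * x\<bar> < 1} x \<partial>lborel)"
    by (subst emeasure_density) simp_all
  also have "\<dots> \<le> (\<integral>\<^sup>+ x. indicator {- 1 / sqrt q..1 / sqrt q} x \<partial>lborel)"
  proof (intro nn_integral_mono)
    fix x :: real
    have "std_normal_density x \<le> 1"
    proof -
      have "1 \<le> sqrt (2 * pi)" using pi_ge_two by simp
      then show ?thesis unfolding std_normal_density_def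
        by (intro mult_le_one) (simp_all add: divide_le_eq)
    qed
    moreover have "x \<in> {- 1 / sqrt q..1 / sqrt q}" if "- 1 < sqrt q * x \<and> sqrt q * x < 1"
      using assms that by (auto simp: field_simps abs_less_iff)
    ultimately show "ennreal (std_normal_density x) * indicator {x. \<bar>sqrt q * x\<bar> < 1} x
        \<le> indicator {- 1 / sqrt q..1 / sqrt q} x"
      by (auto simp: abs_less_iff split: split_indicator)
  qed
  also have "\<dots> = ennreal (2 / sqrt q)"
    using assms by simp
  finally show ?thesis
    using assms real_dist_normal_dist
    by (subst (asm) finite_measure.emeasure_eq_measure)
      (auto dest: real_distribution.axioms(1) simp: prob_space_def)
qed

section \<open>The partition into cells of a field with invariant increments\<close>

lemma periodic_int_shift:
  assumes "\<And>x. x + 1 \<in> B \<longleftrightarrow> (x :: real) \<in> B"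
  shows "x + of_int n \<in> B \<longleftrightarrow> x \<in> B"
proof -
  have nat: "x + of_nat m \<in> B \<longleftrightarrow> x \<in> B" for x m
  proof (induction m)
    case (Suc m)
    then show ?case using assms[of "x + of_nat m"] by (simp add: add.assoc add.commute[of 1])
  qed simp
  show ?thesis
  proof (cases n rule: int_cases2)
    case (nonneg m)
    then show ?thesis using nat[of x m] by simp
  next
    case (nonpos m)
    then show ?thesis using nat[of "x + of_int n" m] by simp
  qed
qed

lemma emeasure_lborel_shift:
  assumes [measurable]: "B \<in> sets borel"
  shows "emeasure lborel {u :: real. u + a \<in> B} = emeasure lborel B"
proof -
  have "emeasure lborel B = emeasure (distr lborel borel ((+) a)) B"
    by (simp only: lborel_distr_plus)
  also have "\<dots> = emeasure lborel {u. u + a \<in> B}"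
    by (subst emeasure_distr) (auto simp: add.commute intro!: arg_cong[of _ _ "emeasure lborel"])
  finally show ?thesis by simp
qed

text \<open>Rotation invariance of the circle: periodicity reduces the shift to its fractional part
  f, and the piece of the window [f, 1 + f) beyond 1 is moved back by 1.\<close>

lemma emeasure_periodic_shift:
  fixes B :: "real set"
  assumes B [measurable]: "B \<in> sets borel" and per: "\<And>x. x + 1 \<in> B \<longleftrightarrow> x \<in> B"
  shows "emeasure lborel {u \<in> {0..<1}. u + a \<in> B} = emeasure lborel (B \<inter> {0..<1})"
proof -
  define f where "f = frac a"
  have f: "0 \<le> f" "f < 1" by (simp_all add: f_def frac_lt_1)
  have "u + a \<in> B \<longleftrightarrow> u + f \<in> B" for u
    using periodic_int_shift[OF per, of "u + f" "\<lfloor>a\<rfloor>"] by (simp add: f_def frac_def)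
  then have "{u \<in> {0..<1}. u + a \<in> B} = {u. u + f \<in> B \<inter> {f..<1 + f}}" by auto
  then have "emeasure lborel {u \<in> {0..<1}. u + a \<in> B} = emeasure lborel (B \<inter> {f..<1 + f})"
    using emeasure_lborel_shift[of "B \<inter> {f..<1 + f}" f] by simp
  also have "B \<inter> {f..<1 + f} = (B \<inter> {f..<1}) \<union> (B \<inter> {1..<1 + f})" using f by auto
  also have "emeasure lborel \<dots> = emeasure lborel (B \<inter> {f..<1}) + emeasure lborel (B \<inter> {1..<1 + f})"
    by (intro plus_emeasure[symmetric]) auto
  also have "emeasure lborel (B \<inter> {1..<1 + f}) = emeasure lborel {u. u + 1 \<in> B \<inter> {1..<1 + f}}"
    by (rule emeasure_lborel_shift[symmetric]) simp
  also have "{u. u + 1 \<in> B \<inter> {1..<1 + f}} = B \<inter> {0..<f}" using per by auto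
  also have "emeasure lborel (B \<inter> {f..<1}) + emeasure lborel (B \<inter> {0..<f})
      = emeasure lborel ((B \<inter> {f..<1}) \<union> (B \<inter> {0..<f}))"
    by (intro plus_emeasure) auto
  also have "(B \<inter> {f..<1}) \<union> (B \<inter> {0..<f}) = B \<inter> {0..<1}" using f by auto
  finally show ?thesis .
qed

definition unit_uniform :: "real measure" where
  "unit_uniform = uniform_measure lborel {0..<1}"

lemma sets_unit_uniform [simp, measurable_cong]: "sets unit_uniform = sets borel"
  and space_unit_uniform [simp]: "space unit_uniform = UNIV"
  by (simp_all add: unit_uniform_def)

lemma prob_space_unit_uniform: "prob_space unit_uniform"
  unfolding unit_uniform_def by (rule prob_space_uniform_measure) simp_all

lemma emeasure_unit_uniform: "B \<in> sets borel \<Longrightarrow> emeasure unit_uniform B = emeasure lborel (B \<inter> {0..<1})"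
  by (simp add: unit_uniform_def Int_commute divide_ennreal_def)

lemma unit_uniform_shift:
  assumes "B \<in> sets borel" "\<And>x. x + 1 \<in> B \<longleftrightarrow> x \<in> B"
  shows "emeasure unit_uniform {u. u + a \<in> B} = emeasure unit_uniform B"
proof -
  have "{u. u + a \<in> B} \<in> sets borel" using assms(1) by measurable
  then show ?thesis
    using emeasure_periodic_shift[OF assms, of a]
    by (simp add: emeasure_unit_uniform assms(1) Int_def conj_commute)
qed

text \<open>A rotation moves \<open>a\<close> to 0. For a gap d < 1 the integer parts then differ
  only if the uniform point lies within d of 1; for larger gaps the bound exceeds 1.\<close>

lemma floor_differ_aux:
  assumes "a \<le> b"
  shows "emeasure unit_uniform {u. \<lfloor>a + u\<rfloor> \<noteq> \<lfloor>b + u\<rfloor>} \<le> ennreal (b - a)"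
proof (cases "b - a < 1")
  case True
  define d where "d = b - a"
  define B where "B = {x. \<lfloor>x\<rfloor> \<noteq> \<lfloor>x + d\<rfloor>}"
  have B: "B \<in> sets borel" unfolding B_def by measurable
  have per: "x + 1 \<in> B \<longleftrightarrow> x \<in> B" for x
  proof -
    have "\<lfloor>x + 1 + d\<rfloor> = \<lfloor>x + d\<rfloor> + 1" by linarith
    then show ?thesis by (simp add: B_def)
  qed
  have "{u. \<lfloor>a + u\<rfloor> \<noteq> \<lfloor>b + u\<rfloor>} = {u. u + a \<in> B}"
    by (auto simp: B_def d_def add.commute)
  then have "emeasure unit_uniform {u. \<lfloor>a + u\<rfloor> \<noteq> \<lfloor>b + u\<rfloor>} = emeasure lborel (B \<inter> {0..<1})"
    using unit_uniform_shift[OF B per] emeasure_unit_uniform[OF B] by simp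
  also have "\<dots> \<le> emeasure lborel {1 - d..1}"
  proof (intro emeasure_mono subsetI)
    fix x assume x: "x \<in> B \<inter> {0..<1}"
    then have "\<lfloor>x\<rfloor> = 0" by (simp add: floor_eq_iff)
    with x have "\<lfloor>x + d\<rfloor> \<noteq> 0" by (simp add: B_def)
    moreover have "0 \<le> x + d" using x assms by (simp add: d_def)
    ultimately have "1 \<le> x + d" by linarith
    then show "x \<in> {1 - d..1}" using x by simp
  qed simp
  also have "\<dots> = ennreal (b - a)" using assms by (simp add: d_def)
  finally show ?thesis .
next
  case False
  have "emeasure unit_uniform {u. \<lfloor>a + u\<rfloor> \<noteq> \<lfloor>b + u\<rfloor>} \<le> 1"
    by (rule prob_space.measure_le_1[OF prob_space_unit_uniform])
  also have "\<dots> \<le> ennreal (b - a)" using False by (simp add: ennreal_leI flip: ennreal_1)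
  finally show ?thesis .
qed

lemma floor_differ: "emeasure unit_uniform {u. \<lfloor>a + u\<rfloor> \<noteq> \<lfloor>b + u\<rfloor>} \<le> ennreal \<bar>a - b\<bar>"
proof (cases "a \<le> b")
  case True
  then show ?thesis using floor_differ_aux[OF True] by simp
next
  case False
  moreover have "{u. \<lfloor>a + u\<rfloor> \<noteq> \<lfloor>b + u\<rfloor>} = {u. \<lfloor>b + u\<rfloor> \<noteq> \<lfloor>a + u\<rfloor>}" by auto
  ultimately show ?thesis using floor_differ_aux[of b a] by simp
qed

section \<open>The percolation of a field with stationary increments\<close>

text \<open>Comparing all pairs in \<open>e\<close> avoids ordering the endpoints and keeps every
  loop open.\<close>

definition cell_config :: "'a set set \<Rightarrow> ('a \<Rightarrow> real) \<times> real \<Rightarrow> 'a set set" where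
  "cell_config E = (\<lambda>(Y, u). {e \<in> E. \<forall>g\<in>e. \<forall>h\<in>e. \<lfloor>Y g + u\<rfloor> = \<lfloor>Y h + u\<rfloor>})"

lemma pair_mem_cell_config:
  "{g, h} \<in> E \<Longrightarrow> {g, h} \<in> cell_config E (Y, u) \<longleftrightarrow> \<lfloor>Y g + u\<rfloor> = \<lfloor>Y h + u\<rfloor>"
  by (auto simp: cell_config_def)

text \<open>Only this direction holds in general: a cell may break into several clusters.\<close>

lemma same_cluster_cell_config:
  assumes "same_cluster (cell_config E (Y, u)) g h"
  shows "\<lfloor>Y g + u\<rfloor> = \<lfloor>Y h + u\<rfloor>"
  using assms unfolding same_cluster_def
proof (induction rule: rtrancl_induct)
  case (step y z)
  have "\<lfloor>Y y + u\<rfloor> = \<lfloor>Y z + u\<rfloor>"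
    using step.hyps(2) unfolding adjacency_def cell_config_def by blast
  with step.IH show ?case by (rule trans)
qed (rule refl)

text \<open>The field seen from \<gamma> has the law of the field seen from the identity. Taking
  \<gamma> and g to be the identity shows that \<open>Y\<close> vanishes there almost surely, so
  \<open>Y\<close> itself is in general not stationary.\<close>

locale cayley_field = cayley_graph G S for G :: "('a, 'b) monoid_scheme" (structure) and S +
  fixes M :: "('a \<Rightarrow> real) measure"
  assumes prob_M: "prob_space M"
    and sets_M [measurable_cong]: "sets M = sets (PiM (carrier G) (\<lambda>_. borel))"
    and increments: "\<gamma> \<in> carrier G \<Longrightarrow>
      distr M (PiM (carrier G) (\<lambda>_. borel)) (\<lambda>Y. \<lambda>g\<in>carrier G. Y (\<gamma> \<otimes> g) - Y \<gamma>) = M"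
begin

sublocale U: prob_space unit_uniform by (rule prob_space_unit_uniform)
sublocale M: prob_space M by (rule prob_M)
sublocale MU: pair_prob_space M unit_uniform ..

definition P :: "'a set set measure" where
  "P = distr (M \<Otimes>\<^sub>M unit_uniform) (configuration_space E) (cell_config E)"

lemma measurable_coord [measurable]: "g \<in> carrier G \<Longrightarrow> (\<lambda>Y. Y g) \<in> borel_measurable M"
  by measurable

lemma measurable_cell_config [measurable]:
  "cell_config E \<in> M \<Otimes>\<^sub>M unit_uniform \<rightarrow>\<^sub>M configuration_space E"
proof (rule measurable_into_configuration)
  fix e assume e: "e \<in> E"
  then obtain g s where gs: "g \<in> carrier G" "s \<in> S" "e = {g, g \<otimes> s}"
    unfolding cayley_edges_def by blast
  then have [measurable]: "(\<lambda>Y. Y g) \<in> borel_measurable M" "(\<lambda>Y. Y (g \<otimes> s)) \<in> borel_measurable M"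
    by (auto intro!: measurable_coord)
  have "e \<in> cell_config E x \<longleftrightarrow> \<lfloor>fst x g + snd x\<rfloor> = \<lfloor>fst x (g \<otimes> s) + snd x\<rfloor>" for x
    using pair_mem_cell_config[of g "g \<otimes> s" E "fst x" "snd x"] e gs by simp
  then show "Measurable.pred (M \<Otimes>\<^sub>M unit_uniform) (\<lambda>x. e \<in> cell_config E x)"
    by simp
qed (auto simp: cell_config_def)

lemma bond_percolation_P: "bond_percolation E P"
  unfolding bond_percolation_def P_def
  by (simp add: MU.prob_space_distr)

sublocale cayley_percolation G S P
  by unfold_locales (rule bond_percolation_P)

text \<open>Fubini with \<open>u\<close> innermost, so that rotation invariance can be used for each
  fixed \<open>Y\<close>.\<close>

lemma emeasure_P:
  assumes "A \<in> sets (configuration_space E)"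
  shows "emeasure P A = (\<integral>\<^sup>+Y. emeasure unit_uniform {u. cell_config E (Y, u) \<in> A} \<partial>M)"
proof -
  have "emeasure P A = emeasure (M \<Otimes>\<^sub>M unit_uniform) (cell_config E -` A \<inter> space (M \<Otimes>\<^sub>M unit_uniform))"
    unfolding P_def using assms by (intro emeasure_distr) simp_all
  also have "\<dots> = (\<integral>\<^sup>+Y. emeasure unit_uniform (Pair Y -` (cell_config E -` A \<inter> space (M \<Otimes>\<^sub>M unit_uniform))) \<partial>M)"
    using assms by (intro U.emeasure_pair_measure_alt measurable_sets[OF measurable_cell_config])
  also have "\<dots> = (\<integral>\<^sup>+Y. emeasure unit_uniform {u. cell_config E (Y, u) \<in> A} \<partial>M)"
    by (intro nn_integral_cong arg_cong[of _ _ "emeasure unit_uniform"]) (auto simp: space_pair_measure)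
  finally show ?thesis .
qed

lemma sets_section:
  assumes "A \<in> sets (configuration_space E)" "Y \<in> space M"
  shows "{u. cell_config E (Y, u) \<in> A} \<in> sets borel"
proof -
  have "(\<lambda>u. cell_config E (Y, u)) \<in> unit_uniform \<rightarrow>\<^sub>M configuration_space E"
    using assms(2) by (intro measurable_compose[OF _ measurable_cell_config]) simp
  from measurable_sets[OF this assms(1)] show ?thesis by (simp add: vimage_def)
qed

lemma measurable_section:
  assumes "A \<in> sets (configuration_space E)"
  shows "(\<lambda>Y. emeasure unit_uniform {u. cell_config E (Y, u) \<in> A}) \<in> borel_measurable M"
proof -
  have "(\<lambda>Y. emeasure unit_uniform (Pair Y -` (cell_config E -` A \<inter> space (M \<Otimes>\<^sub>M unit_uniform)))) \<in> borel_measurable M"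
    using assms by (intro U.measurable_emeasure_Pair measurable_sets[OF measurable_cell_config])
  moreover have "(\<lambda>Y. emeasure unit_uniform (Pair Y -` (cell_config E -` A \<inter> space (M \<Otimes>\<^sub>M unit_uniform)))) Y
      = emeasure unit_uniform {u. cell_config E (Y, u) \<in> A}" if "Y \<in> space M" for Y
    using that by (intro arg_cong[of _ _ "emeasure unit_uniform"]) (auto simp: space_pair_measure)
  ultimately show ?thesis by (subst measurable_cong[symmetric])
qed

text \<open>The constant subtracted in recentring the field is added to the offset, so the sum of
  field and offset is merely translated.\<close>

lemma translate_cell_config:
  assumes "\<gamma> \<in> carrier G"
  shows "translate \<gamma> (cell_config E (Y, u))
    = cell_config E (\<lambda>g\<in>carrier G. Y (inv \<gamma> \<otimes> g) - Y (inv \<gamma>), u + Y (inv \<gamma>))" (is "?l = ?r")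
proof -
  have "e \<in> ?l \<longleftrightarrow> e \<in> ?r" if e: "e \<in> E" for e
  proof -
    obtain g s where gs: "g \<in> carrier G" "s \<in> S" "e = {g, g \<otimes> s}"
      using e unfolding cayley_edges_def by blast
    have "e \<in> ?l \<longleftrightarrow> inv \<gamma> <# e \<in> cell_config E (Y, u)"
      by (intro mem_translate assms e) (auto simp: cell_config_def)
    also have "\<dots> \<longleftrightarrow> \<lfloor>Y (inv \<gamma> \<otimes> g) + u\<rfloor> = \<lfloor>Y (inv \<gamma> \<otimes> (g \<otimes> s)) + u\<rfloor>"
      using translate_E[of "inv \<gamma>" e] assms e gs by (simp add: translate_pair pair_mem_cell_config)
    also have "\<dots> \<longleftrightarrow> e \<in> ?r"
      using e gs assms by (simp add: pair_mem_cell_config algebra_simps)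
    finally show ?thesis .
  qed
  moreover have "?l \<subseteq> E" by (intro translate_subset assms) (auto simp: cell_config_def)
  moreover have "?r \<subseteq> E" by (auto simp: cell_config_def)
  ultimately show ?thesis by blast
qed

text \<open>For fixed \<open>Y\<close> the new offset is a rotation of \<open>u\<close> and is
  absorbed; what remains is the recentred field, whose law is unchanged by \<open>increments\<close>
  at inv \<gamma>.\<close>

lemma invariant_P: "invariant_percolation G P"
  unfolding invariant_percolation_def
proof (intro ballI measure_eqI)
  fix \<gamma> A assume \<gamma>: "\<gamma> \<in> carrier G" and "A \<in> sets (distr P P (translate \<gamma>))"
  then have A: "A \<in> sets (configuration_space E)" by (simp add: sets_P)
  define shift where "shift Y = (\<lambda>g\<in>carrier G. Y (inv \<gamma> \<otimes> g) - Y (inv \<gamma>))" for Y :: "'a \<Rightarrow> real"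
  define F where "F Y = emeasure unit_uniform {u. cell_config E (Y, u) \<in> A}" for Y
  have shift [measurable]: "shift \<in> M \<rightarrow>\<^sub>M PiM (carrier G) (\<lambda>_. borel)"
    unfolding shift_def using \<gamma>
    by (intro measurable_restrict borel_measurable_diff measurable_coord) auto
  have shift': "shift \<in> M \<rightarrow>\<^sub>M M" using shift by (simp add: measurable_cong_sets[OF refl sets_M])
  have F [measurable]: "F \<in> borel_measurable M" unfolding F_def by (rule measurable_section[OF A])
  let ?A' = "translate \<gamma> -` A \<inter> space P"
  have A': "?A' \<in> sets (configuration_space E)"
    using measurable_sets[OF measurable_translate[OF \<gamma>], of A] A by (simp add: sets_P)
  have "emeasure (distr P P (translate \<gamma>)) A = emeasure P ?A'"
    using A by (intro emeasure_distr measurable_translate \<gamma>) (simp add: sets_P)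
  also have "\<dots> = (\<integral>\<^sup>+Y. emeasure unit_uniform {u. cell_config E (Y, u) \<in> ?A'} \<partial>M)"
    by (rule emeasure_P[OF A'])
  also have "\<dots> = (\<integral>\<^sup>+Y. F (shift Y) \<partial>M)"
  proof (intro nn_integral_cong)
    fix Y assume Y: "Y \<in> space M"
    define B where "B = {u. cell_config E (shift Y, u) \<in> A}"
    have "{u. cell_config E (Y, u) \<in> ?A'} = {u. u + Y (inv \<gamma>) \<in> B}"
      using translate_cell_config[OF \<gamma>, of Y]
      by (auto simp: B_def shift_def space_P cell_config_def)
    moreover have "emeasure unit_uniform {u. u + Y (inv \<gamma>) \<in> B} = emeasure unit_uniform B"
    proof (rule unit_uniform_shift)
      show "B \<in> sets borel"
        unfolding B_def by (intro sets_section A measurable_space[OF shift' Y])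
      \<comment> \<open>Raising \<open>u\<close> by 1 relabels the cells but leaves the partition
        unchanged.\<close>
      have "cell_config E (Z, u + 1) = cell_config E (Z, u)" for Z u
        by (simp add: cell_config_def add.assoc[symmetric])
      then show "x + 1 \<in> B \<longleftrightarrow> x \<in> B" for x by (simp add: B_def)
    qed
    ultimately show "emeasure unit_uniform {u. cell_config E (Y, u) \<in> ?A'} = F (shift Y)"
      by (simp add: B_def F_def)
  qed
  also have "\<dots> = (\<integral>\<^sup>+Y. F Y \<partial>distr M (PiM (carrier G) (\<lambda>_. borel)) shift)"
    using F by (subst nn_integral_distr) (simp_all add: shift measurable_cong_sets[OF sets_M refl])
  also have "distr M (PiM (carrier G) (\<lambda>_. borel)) shift = M"
    unfolding shift_def using \<gamma> by (intro increments) simp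
  also have "(\<integral>\<^sup>+Y. F Y \<partial>M) = emeasure P A"
    unfolding F_def by (rule emeasure_P[OF A, symmetric])
  finally show "emeasure (distr P P (translate \<gamma>)) A = emeasure P A" .
qed simp

lemma two_point_le:
  assumes "g \<in> carrier G" "h \<in> carrier G"
  shows "two_point P g h \<le> M.prob {Y \<in> space M. \<bar>Y g - Y h\<bar> < 1}"
proof -
  have A: "{\<omega> \<in> space P. same_cluster \<omega> g h} \<in> sets (configuration_space E)"
    using cluster_event by (simp add: sets_P)
  note [measurable] = assms[THEN measurable_coord]
  have "emeasure P {\<omega> \<in> space P. same_cluster \<omega> g h}
      \<le> (\<integral>\<^sup>+Y. indicator {Y \<in> space M. \<bar>Y g - Y h\<bar> < 1} Y \<partial>M)"
    unfolding emeasure_P[OF A]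
  proof (intro nn_integral_mono)
    fix Y assume Y: "Y \<in> space M"
    show "emeasure unit_uniform {u. cell_config E (Y, u) \<in> {\<omega> \<in> space P. same_cluster \<omega> g h}}
        \<le> indicator {Y \<in> space M. \<bar>Y g - Y h\<bar> < 1} Y"
    proof (cases "\<bar>Y g - Y h\<bar> < 1")
      case True
      then show ?thesis using Y U.measure_le_1 by simp
    next
      case False
      have "\<not> same_cluster (cell_config E (Y, u)) g h" for u
      proof
        assume "same_cluster (cell_config E (Y, u)) g h"
        from same_cluster_cell_config[OF this] show False using False by linarith
      qed
      then show ?thesis by simp
    qed
  qed
  also have "\<dots> = emeasure M {Y \<in> space M. \<bar>Y g - Y h\<bar> < 1}"
    by (intro nn_integral_indicator) measurable
  finally show ?thesis
    by (simp add: two_point_def emeasure_eq_measure M.emeasure_eq_measure)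
qed

lemma edge_closed_le:
  assumes "{g, h} \<in> E"
  shows "ennreal (1 - prob {\<omega> \<in> space P. {g, h} \<in> \<omega>}) \<le> (\<integral>\<^sup>+Y. ennreal \<bar>Y g - Y h\<bar> \<partial>M)"
proof -
  have A: "{\<omega> \<in> space P. {g, h} \<in> \<omega>} \<in> sets P" using measurable_mem by (simp add: pred_def)
  then have A': "space P - {\<omega> \<in> space P. {g, h} \<in> \<omega>} \<in> sets (configuration_space E)"
    using sets.compl_sets[OF A] by (simp add: sets_P)
  have "ennreal (1 - prob {\<omega> \<in> space P. {g, h} \<in> \<omega>}) = emeasure P (space P - {\<omega> \<in> space P. {g, h} \<in> \<omega>})"
    using A by (simp add: emeasure_eq_measure prob_compl)
  also have "\<dots> \<le> (\<integral>\<^sup>+Y. ennreal \<bar>Y g - Y h\<bar> \<partial>M)"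
    unfolding emeasure_P[OF A']
  proof (intro nn_integral_mono)
    fix Y
    have "{u. cell_config E (Y, u) \<in> space P - {\<omega> \<in> space P. {g, h} \<in> \<omega>}} = {u. \<lfloor>Y g + u\<rfloor> \<noteq> \<lfloor>Y h + u\<rfloor>}"
      using assms by (auto simp: pair_mem_cell_config) (auto simp: cell_config_def space_P)
    then show "emeasure unit_uniform {u. cell_config E (Y, u) \<in> space P - {\<omega> \<in> space P. {g, h} \<in> \<omega>}}
        \<le> ennreal \<bar>Y g - Y h\<bar>"
      using floor_differ by simp
  qed
  finally show ?thesis .
qed

end

section \<open>Percolations from the Haagerup property\<close>

context cayley_graph
begin

text \<open>A finite exceptional set of quotients lies in a ball, whose radius is bounded by the
  longest of finitely many chosen walks.\<close>

lemma vanishes_at_infinityI: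
  assumes inf: "infinite (carrier G)"
    and nonneg: "\<And>g h. 0 \<le> \<tau> g h" and le1: "\<And>g h. \<tau> g h \<le> 1"
    and small: "\<And>\<epsilon>. 0 < \<epsilon> \<Longrightarrow> \<exists>F. finite F \<and> F \<subseteq> carrier G \<and>
      (\<forall>g\<in>carrier G. \<forall>h\<in>carrier G. inv g \<otimes> h \<notin> F \<longrightarrow> \<tau> g h \<le> \<epsilon>)"
  shows "vanishes_at_infinity G E \<tau>"
  unfolding vanishes_at_infinity_def
proof (rule tendstoI)
  fix \<epsilon> :: real assume \<epsilon>: "0 < \<epsilon>"
  define D where "D r = {(g, h). g \<in> carrier G \<and> h \<in> carrier G \<and> r < real (graph_dist E g h)}" for r
  obtain F where F: "finite F" "F \<subseteq> carrier G"
    "\<And>g h. \<lbrakk>g \<in> carrier G; h \<in> carrier G; inv g \<otimes> h \<notin> F\<rbrakk> \<Longrightarrow> \<tau> g h \<le> \<epsilon> / 2"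
    using small[of "\<epsilon> / 2"] \<epsilon> by auto
  have "\<forall>k\<in>F. \<exists>n. (\<one>, k) \<in> adjacency E ^^ n" using walk_from_one F(2) by blast
  then obtain n where n: "\<And>k. k \<in> F \<Longrightarrow> (\<one>, k) \<in> adjacency E ^^ n k" by metis
  define R where "R = real (Max (insert 0 (n ` F)))"
  have "dist (SUP (g, h)\<in>D r. \<tau> g h) 0 < \<epsilon>" if r: "R < r" for r
  proof -
    \<comment> \<open>A far pair makes the supremum meaningful and, through its nonnegative value,
      bounds it below by 0.\<close>
    obtain k where k: "k \<in> carrier G" "r < real (graph_dist E \<one> k)"
      using far_point_exists[OF inf] by blast
    then have mem: "(\<one>, k) \<in> D r" by (simp add: D_def)
    have "(SUP (g, h)\<in>D r. \<tau> g h) \<le> \<epsilon> / 2"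
    proof (rule cSUP_least)
      show "D r \<noteq> {}" using mem by blast
      fix p assume "p \<in> D r"
      then obtain g h where gh: "p = (g, h)" "g \<in> carrier G" "h \<in> carrier G" "r < real (graph_dist E g h)"
        by (auto simp: D_def)
      have "inv g \<otimes> h \<notin> F"
      proof
        assume kF: "inv g \<otimes> h \<in> F"
        from walk_translate[OF gh(2) n[OF kF]] have "(g, h) \<in> adjacency E ^^ n (inv g \<otimes> h)"
          using gh by (simp add: m_assoc[symmetric])
        then have "graph_dist E g h \<le> n (inv g \<otimes> h)" by (rule graph_dist_le)
        also have "\<dots> \<le> Max (insert 0 (n ` F))" using kF F(1) by (intro Max_ge) auto
        finally show False using gh(4) r by (simp add: R_def)
      qed
      then show "(case p of (g, h) \<Rightarrow> \<tau> g h) \<le> \<epsilon> / 2" using F(3) gh by simp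
    qed
    moreover have "(case (\<one>, k) of (g, h) \<Rightarrow> \<tau> g h) \<le> (SUP (g, h)\<in>D r. \<tau> g h)"
      using mem le1 by (intro cSUP_upper) (auto intro!: bdd_aboveI2[of _ _ 1])
    ultimately show ?thesis using nonneg[of \<one> k] \<epsilon> by simp
  qed
  then show "\<forall>\<^sub>F r in at_top. dist (SUP (g, h)\<in>{(g, h). g \<in> carrier G \<and> h \<in> carrier G \<and> r < real (graph_dist E g h)}. \<tau> g h) 0 < \<epsilon>"
    unfolding D_def by (rule eventually_mono[OF eventually_gt_at_top])
qed

text \<open>The variance of Y g - Y h when K is the covariance of Y, and the squared distance of the
  vectors when K is their Gram kernel.\<close>

definition squared_dist :: "('a \<Rightarrow> 'a \<Rightarrow> real) \<Rightarrow> 'a \<Rightarrow> 'a \<Rightarrow> real" where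
  "squared_dist K g h = K g g - 2 * K g h + K h h"

text \<open>With \<open>K\<close> normalised at the identity, polarisation recovers \<open>K\<close>
  from \<open>squared_dist\<close>, so invariance of the distances gives equal covariances, hence
  equal characteristic functions, after recentring.\<close>

lemma cayley_field_of_kernel:
  assumes inf: "infinite (carrier G)"
    and K: "positive_kernel (carrier G) K"
    and K_one: "\<And>g. g \<in> carrier G \<Longrightarrow> K \<one> g = 0"
    and inv: "\<And>\<gamma> g h. \<lbrakk>\<gamma> \<in> carrier G; g \<in> carrier G; h \<in> carrier G\<rbrakk> \<Longrightarrow>
      squared_dist K (\<gamma> \<otimes> g) (\<gamma> \<otimes> h) = squared_dist K g h"
  shows "\<exists>M. cayley_field G S M \<and> (\<forall>g\<in>carrier G. \<forall>h\<in>carrier G.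
    distr M borel (\<lambda>Y. Y g - Y h) = distr std_normal_distribution borel (\<lambda>x. sqrt (squared_dist K g h) * x))"
proof -
  interpret K: positive_kernel "carrier G" K by fact
  obtain M where M: "prob_space M" and sets_M [measurable_cong]: "sets M = sets (PiM (carrier G) (\<lambda>_. borel))"
    and char: "\<And>c. snd ` set c \<subseteq> carrier G \<Longrightarrow>
      (CLINT Y|M. iexp (lin c Y)) = complex_of_real (exp (- form K c c / 2))"
    using K.gaussian_field[OF countable_carrier inf] by blast
  interpret M: prob_space M by fact
  have coord [measurable]: "(\<lambda>Y. Y g) \<in> borel_measurable M" if "g \<in> carrier G" for g
    using that by measurable
  have field: "cayley_field G S M"
  proof
    fix \<gamma> assume \<gamma>: "\<gamma> \<in> carrier G"
    define T where "T Y = (\<lambda>g\<in>carrier G. Y (\<gamma> \<otimes> g) - Y \<gamma>)" for Y :: "'a \<Rightarrow> real"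
    have T [measurable]: "T \<in> M \<rightarrow>\<^sub>M PiM (carrier G) (\<lambda>_. borel)"
      unfolding T_def using \<gamma> by (intro measurable_restrict borel_measurable_diff coord) auto
    have "distr M (PiM (carrier G) (\<lambda>_. borel)) T = M"
    proof (rule PiM_eq_by_char)
      fix c :: "(real \<times> 'a) list" assume c: "snd ` set c \<subseteq> carrier G"
      note [measurable] = measurable_lin[OF c]
      \<comment> \<open>The dual of recentring: each point mass at g becomes the mass at \<gamma> g
        minus the mass at \<gamma>.\<close>
      define d where "d = map (map_prod id (\<lambda>g. \<gamma> \<otimes> g)) c @ [(- lin c (\<lambda>_. 1), \<gamma>)]"
      have d: "snd ` set d \<subseteq> carrier G" using c \<gamma> by (force simp: d_def)
      have lin_d: "lin d f = lin c (\<lambda>g. f (\<gamma> \<otimes> g) - f \<gamma>)" for f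
        by (simp add: d_def lin_map_snd lin_diff lin_const[of c "f \<gamma>"])
      have lin_T: "lin c (T Y) = lin d Y" for Y
        unfolding lin_d using c by (intro lin_cong) (auto simp: T_def)
      have "form K d d = form K c c"
        unfolding form_def lin_d lin_diff[symmetric]
      proof (intro lin_cong)
        fix g h assume "g \<in> snd ` set c" "h \<in> snd ` set c"
        then have gh: "g \<in> carrier G" "h \<in> carrier G" using c by auto
        show "K (\<gamma> \<otimes> g) (\<gamma> \<otimes> h) - K (\<gamma> \<otimes> g) \<gamma> - (K \<gamma> (\<gamma> \<otimes> h) - K \<gamma> \<gamma>) = K g h"
          using inv[OF \<gamma> gh] inv[OF \<gamma> gh(1) one_closed] inv[OF \<gamma> gh(2) one_closed] \<gamma> gh
            K_one[OF gh(1)] K_one[OF gh(2)] K_one[OF one_closed]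
            K.K_commute[OF gh(1) one_closed] K.K_commute[OF gh(2) one_closed]
            K.K_commute[of \<gamma> "\<gamma> \<otimes> h"]
          by (simp add: squared_dist_def)
      qed
      then show "(CLINT Y|distr M (PiM (carrier G) (\<lambda>_. borel)) T. iexp (lin c Y)) = (CLINT Y|M. iexp (lin c Y))"
        using char[OF c] char[OF d] by (subst integral_distr) (simp_all add: lin_T)
    qed (simp_all add: M sets_M M.prob_space_distr)
    then show "distr M (PiM (carrier G) (\<lambda>_. borel)) (\<lambda>Y. \<lambda>g\<in>carrier G. Y (\<gamma> \<otimes> g) - Y \<gamma>) = M"
      by (simp add: T_def[abs_def])
  qed (simp_all add: M sets_M)
  moreover have "distr M borel (\<lambda>Y. Y g - Y h) = distr std_normal_distribution borel (\<lambda>x. sqrt (squared_dist K g h) * x)"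
    if gh: "g \<in> carrier G" "h \<in> carrier G" for g h
  proof (rule law_of_char_normal[OF M])
    let ?c = "[(1, g), (-1, h)] :: (real \<times> 'a) list"
    have form: "form K ?c ?c = squared_dist K g h"
      using K.K_commute[OF gh] by (simp add: form_def squared_dist_def)
    then show "0 \<le> squared_dist K g h"
      using K.K_positive[of ?c] gh by simp
    show "(CLINT Y|M. iexp (t * (Y g - Y h))) = complex_of_real (exp (- (t\<^sup>2 * squared_dist K g h) / 2))" for t
      using char[of "scale_comb t ?c"] gh
      by (simp add: form_scale form power2_eq_square del: lin_scale_comb)
        (simp add: algebra_simps)
  qed (use gh in measurable)
  ultimately show ?thesis by blast
qed

lemma percolation_of_kernel:
  assumes inf: "infinite (carrier G)"
    and K: "positive_kernel (carrier G) K"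
    and K_one: "\<And>g. g \<in> carrier G \<Longrightarrow> K \<one> g = 0"
    and inv: "\<And>\<gamma> g h. \<lbrakk>\<gamma> \<in> carrier G; g \<in> carrier G; h \<in> carrier G\<rbrakk> \<Longrightarrow>
      squared_dist K (\<gamma> \<otimes> g) (\<gamma> \<otimes> h) = squared_dist K g h"
    and proper: "\<And>R. finite {g \<in> carrier G. squared_dist K \<one> g \<le> R}"
    and \<alpha>: "\<alpha> < 1"
  shows "\<exists>P. bond_percolation E P \<and> invariant_percolation G P \<and>
    (\<integral>\<omega>. real (degree_in \<omega> \<one>) \<partial>P) > \<alpha> * real (degree_in E \<one>) \<and>
    vanishes_at_infinity G E (two_point P)"
proof -
  interpret K: positive_kernel "carrier G" K by fact
  \<comment> \<open>An increment of standard deviation \<sigma> has mean absolute value C \<sigma>,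
    and \<open>D\<close> bounds the standard deviations over the generators before scaling.\<close>
  define C where "C = (LINT x|std_normal_distribution. \<bar>x\<bar>)"
  have C_int: "integrable std_normal_distribution (\<lambda>x. \<bar>x\<bar>)"
    using integrable_std_normal_distribution_moment[of 1] by simp
  have C: "0 \<le> C" unfolding C_def by simp
  define D where "D = Max (insert 0 ((\<lambda>s. sqrt (squared_dist K \<one> s)) ` S))"
  have D: "0 \<le> D" "\<And>s. s \<in> S \<Longrightarrow> sqrt (squared_dist K \<one> s) \<le> D"
    unfolding D_def using finite_S by auto
  \<comment> \<open>Scaling the covariance by r scales increments by sqrt r, so the closing
    probabilities stay below 1 - \<alpha>. The summand 1 avoids a zero denominator.\<close>
  define r where "r = ((1 - \<alpha>) / (2 * (C * D + 1)))\<^sup>2"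
  have CD: "0 < C * D + 1" using C D by (simp add: add_nonneg_pos)
  have r: "0 < r" using CD \<alpha> by (simp add: r_def)
  have r_sqrt: "sqrt r * (C * D) < 1 - \<alpha>"
  proof -
    have "sqrt r = (1 - \<alpha>) / (2 * (C * D + 1))" using CD \<alpha> by (simp add: r_def)
    then have "sqrt r * (C * D) = (1 - \<alpha>) * (C * D / (2 * (C * D + 1)))" by simp
    also have "\<dots> < (1 - \<alpha>) * 1"
      using CD \<alpha> C D by (intro mult_strict_left_mono) (auto simp: divide_less_eq)
    finally show ?thesis by simp
  qed
  define K' where "K' g h = r * K g h" for g h
  have sq: "squared_dist K' g h = r * squared_dist K g h" for g h
    by (simp add: squared_dist_def K'_def algebra_simps)
  have form': "form K' c c = r * form K c c" for c
    by (simp only: form_def K'_def[abs_def] lin_scale)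
  have "positive_kernel (carrier G) K'"
  proof
    show "K' x y = K' y x" if "x \<in> carrier G" "y \<in> carrier G" for x y
      using K.K_commute[OF that] by (simp add: K'_def)
    show "0 \<le> form K' c c" if "snd ` set c \<subseteq> carrier G" for c
      unfolding form' using K.K_positive[OF that] r by simp
  qed
  from cayley_field_of_kernel[OF inf this]
  obtain M where field: "cayley_field G S M"
    and law: "\<And>g h. \<lbrakk>g \<in> carrier G; h \<in> carrier G\<rbrakk> \<Longrightarrow> distr M borel (\<lambda>Y. Y g - Y h) =
      distr std_normal_distribution borel (\<lambda>x. sqrt (r * squared_dist K g h) * x)"
    using K_one inv by (auto simp: sq K'_def)
  interpret F: cayley_field G S M by fact
  have two_point_small: "two_point F.P g h \<le> 2 / sqrt (r * squared_dist K g h)"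
    if gh: "g \<in> carrier G" "h \<in> carrier G" and pos: "0 < squared_dist K g h" for g h
  proof -
    note [measurable] = F.measurable_coord[OF gh(1)] F.measurable_coord[OF gh(2)]
    have "two_point F.P g h \<le> measure M {Y \<in> space M. \<bar>Y g - Y h\<bar> < 1}"
      by (rule F.two_point_le[OF gh])
    also have "\<dots> = measure (distr M borel (\<lambda>Y. Y g - Y h)) {x. \<bar>x\<bar> < 1}"
      by (subst measure_distr) (auto intro!: arg_cong[of _ _ "measure M"])
    also have "\<dots> = measure std_normal_distribution {x. \<bar>sqrt (r * squared_dist K g h) * x\<bar> < 1}"
      unfolding law[OF gh] by (subst measure_distr) (auto intro!: arg_cong[of _ _ "measure _"])
    also have "\<dots> \<le> 2 / sqrt (r * squared_dist K g h)"
      using r pos by (intro normal_small_ball) simp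
    finally show ?thesis .
  qed
  have closed: "1 - F.prob {\<omega> \<in> space F.P. {\<one>, s} \<in> \<omega>} \<le> sqrt r * (C * D)" if s: "s \<in> S" for s
  proof -
    let ?q = "r * squared_dist K \<one> s"
    note [measurable] = F.measurable_coord[OF one_closed] F.measurable_coord[OF S_mem[OF s]]
    have "ennreal (1 - F.prob {\<omega> \<in> space F.P. {\<one>, s} \<in> \<omega>}) \<le> (\<integral>\<^sup>+Y. ennreal \<bar>Y \<one> - Y s\<bar> \<partial>M)"
      by (rule F.edge_closed_le[OF edge_one[OF s]])
    also have "\<dots> = (\<integral>\<^sup>+x. ennreal \<bar>x\<bar> \<partial>distr M borel (\<lambda>Y. Y \<one> - Y s))"
      by (subst nn_integral_distr) simp_all
    also have "\<dots> = (\<integral>\<^sup>+x. ennreal \<bar>sqrt ?q * x\<bar> \<partial>std_normal_distribution)"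
      unfolding law[OF one_closed S_mem[OF s]] by (subst nn_integral_distr) simp_all
    also have "\<dots> = ennreal (LINT x|std_normal_distribution. \<bar>sqrt ?q * x\<bar>)"
      using C_int by (intro nn_integral_eq_integral) (simp_all add: abs_mult)
    also have "(LINT x|std_normal_distribution. \<bar>sqrt ?q * x\<bar>) = \<bar>sqrt ?q\<bar> * C"
      by (simp add: abs_mult C_def)
    finally have "1 - F.prob {\<omega> \<in> space F.P. {\<one>, s} \<in> \<omega>} \<le> \<bar>sqrt ?q\<bar> * C"
      using C by (simp add: ennreal_le_iff)
    also have "\<dots> \<le> sqrt r * (C * D)"
    proof -
      have "0 \<le> squared_dist K \<one> s"
        using K.K_positive[of "[(1, \<one>), (-1, s)]"] S_mem[OF s] K.K_commute[of \<one> s]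
        by (simp add: form_def squared_dist_def)
      then have "\<bar>sqrt ?q\<bar> * C = sqrt r * (C * sqrt (squared_dist K \<one> s))"
        using r by (simp add: real_sqrt_mult)
      also have "\<dots> \<le> sqrt r * (C * D)"
        using r C D(2)[OF s] by (intro mult_left_mono) auto
      finally show ?thesis .
    qed
    finally show ?thesis .
  qed
  have "\<alpha> * real (degree_in E \<one>) < (\<integral>\<omega>. real (degree_in \<omega> \<one>) \<partial>F.P)"
  proof -
    have "\<alpha> * real (card S) < (1 - sqrt r * (C * D)) * real (card S)"
      using r_sqrt card_S_pos[OF inf] by (intro mult_strict_right_mono) auto
    also have "\<dots> = (\<Sum>s\<in>S. 1 - sqrt r * (C * D))" by simp
    also have "\<dots> \<le> (\<Sum>s\<in>S. F.prob {\<omega> \<in> space F.P. {\<one>, s} \<in> \<omega>})"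
      using closed by (intro sum_mono) (simp add: algebra_simps)
    finally show ?thesis by (simp only: F.expected_degree degree_E)
  qed
  moreover have "vanishes_at_infinity G E (two_point F.P)"
  proof (rule vanishes_at_infinityI[OF inf])
    fix \<epsilon> :: real assume \<epsilon>: "0 < \<epsilon>"
    \<comment> \<open>The squared distance at which the bound in \<open>two_point_small\<close>
      equals \<epsilon>.\<close>
    let ?R = "(2 / \<epsilon>)\<^sup>2 / r"
    let ?F = "{k \<in> carrier G. squared_dist K \<one> k \<le> ?R}"
    have "two_point F.P g h \<le> \<epsilon>" if gh: "g \<in> carrier G" "h \<in> carrier G" "inv g \<otimes> h \<notin> ?F" for g h
    proof -
      have "squared_dist K \<one> (inv g \<otimes> h) = squared_dist K g h"
        using inv[of g \<one> "inv g \<otimes> h"] gh by (simp add: m_assoc[symmetric])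
      then have big: "?R < squared_dist K g h" using gh by auto
      have "0 \<le> ?R" using r by simp
      then have pos: "0 < squared_dist K g h" using big by linarith
      have "(2 / \<epsilon>)\<^sup>2 \<le> r * squared_dist K g h"
        using big r by (simp add: divide_less_eq mult.commute)
      then have "2 / \<epsilon> \<le> sqrt (r * squared_dist K g h)" by (rule real_le_rsqrt)
      then have "2 / sqrt (r * squared_dist K g h) \<le> \<epsilon>"
        using \<epsilon> r pos by (simp add: divide_le_eq mult.commute)
      then show ?thesis using two_point_small[OF gh(1,2) pos] by simp
    qed
    then show "\<exists>F. finite F \<and> F \<subseteq> carrier G \<and>
      (\<forall>g\<in>carrier G. \<forall>h\<in>carrier G. inv g \<otimes> h \<notin> F \<longrightarrow> two_point F.P g h \<le> \<epsilon>)"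
      using proper[of ?R] by (intro exI[of _ ?F]) auto
  qed (simp_all add: two_point_def)
  ultimately show ?thesis
    using F.bond_percolation_P F.invariant_P by blast
qed

lemma percolations_of_haagerup:
  assumes inf: "infinite (carrier G)" and "haagerup TYPE('h) G" and \<alpha>: "\<alpha> < 1"
  shows "\<exists>P. bond_percolation E P \<and> invariant_percolation G P \<and>
    (\<integral>\<omega>. real (degree_in \<omega> \<one>) \<partial>P) > \<alpha> * real (degree_in E \<one>) \<and>
    vanishes_at_infinity G E (two_point P)"
proof -
  obtain H :: "(real, 'h) module" and ip \<phi> where H: "hilbert_space H ip"
    and aff: "affine_isometric_action G H ip \<phi>" and proper: "metrically_proper G H ip \<phi>"
    using assms(2) unfolding haagerup_def by blast
  interpret H: hilbert_space H ip by (rule H)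
  interpret act: group_action G "carrier H" \<phi>
    using aff by (simp add: affine_isometric_action_def)
  define b where "b g = \<phi> g \<zero>\<^bsub>H\<^esub>" for g
  have b_mem: "b g \<in> carrier H" if "g \<in> carrier G" for g
    unfolding b_def using act.element_image[OF that H.M.zero_closed] by simp
  have b_mult: "b (g \<otimes> h) = \<phi> g (b h)" if "g \<in> carrier G" "h \<in> carrier G" for g h
    unfolding b_def using act.composition_rule[OF H.M.zero_closed that] by simp
  have b_one: "b \<one> = \<zero>\<^bsub>H\<^esub>"
    unfolding b_def using H.M.zero_closed by (simp flip: act.id_eq_one)
  define K where "K g h = ip (b g) (b h)" for g h
  have ip_zero: "ip \<zero>\<^bsub>H\<^esub> x = 0" if "x \<in> carrier H" for x
    using H.ip_minus_left[of x x x] that by (simp add: H.M.r_neg H.M.minus_eq)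
  \<comment> \<open>The combination realised as a vector of \<open>H\<close>; the form of the Gram
    kernel is its squared norm.\<close>
  define vec where "vec c = foldr (\<lambda>(t, g) v. t \<odot>\<^bsub>H\<^esub> b g \<oplus>\<^bsub>H\<^esub> v) c \<zero>\<^bsub>H\<^esub>" for c
  have smult: "t \<odot>\<^bsub>H\<^esub> x \<in> carrier H" if "x \<in> carrier H" for t x
    using that by (simp add: H.smult_closed real_field_def)
  have vec: "vec c \<in> carrier H \<and> (\<forall>x\<in>carrier H. ip (vec c) x = lin c (\<lambda>g. ip (b g) x))"
    if "snd ` set c \<subseteq> carrier G" for c
    using that
  proof (induction c)
    case Nil
    then show ?case by (simp add: vec_def ip_zero)
  next
    case (Cons p c)
    obtain t g where p: "p = (t, g)" by (cases p)
    then have "vec (p # c) = t \<odot>\<^bsub>H\<^esub> b g \<oplus>\<^bsub>H\<^esub> vec c" by (simp add: vec_def)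
    then show ?case
      using Cons p by (simp add: smult b_mem H.ip_add_left H.ip_smult_left)
  qed
  have "positive_kernel (carrier G) K"
  proof
    show "K g h = K h g" if "g \<in> carrier G" "h \<in> carrier G" for g h
      unfolding K_def by (intro H.ip_commute b_mem that)
    show "0 \<le> form K c c" if c: "snd ` set c \<subseteq> carrier G" for c
    proof -
      have v: "vec c \<in> carrier H" "\<And>x. x \<in> carrier H \<Longrightarrow> ip (vec c) x = lin c (\<lambda>g. ip (b g) x)"
        using vec[OF c] by auto
      have "form K c c = lin c (\<lambda>g. ip (b g) (vec c))"
        unfolding form_def K_def
      proof (rule lin_cong)
        fix g assume "g \<in> snd ` set c"
        then have g: "g \<in> carrier G" using c by blast
        have "lin c (\<lambda>h. ip (b g) (b h)) = lin c (\<lambda>h. ip (b h) (b g))"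
          using c by (intro lin_cong H.ip_commute b_mem g) auto
        also have "\<dots> = ip (b g) (vec c)"
          using v b_mem[OF g] H.ip_commute[of "b g" "vec c"] by simp
        finally show "lin c (\<lambda>h. ip (b g) (b h)) = ip (b g) (vec c)" .
      qed
      also have "\<dots> = ip (vec c) (vec c)" using v by simp
      finally show ?thesis using H.ip_nonneg[OF v(1)] by simp
    qed
  qed
  moreover have "K \<one> g = 0" if "g \<in> carrier G" for g
    by (simp add: K_def b_one ip_zero b_mem that)
  moreover have sq: "squared_dist K g h = (ip_dist H ip (b g) (b h))\<^sup>2" if gh: "g \<in> carrier G" "h \<in> carrier G" for g h
  proof -
    have "(ip_dist H ip (b g) (b h))\<^sup>2 = ip (b g \<ominus>\<^bsub>H\<^esub> b h) (b g \<ominus>\<^bsub>H\<^esub> b h)"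
      using gh by (simp add: ip_dist_def b_mem H.ip_nonneg)
    then show ?thesis
      using gh H.ip_commute[of "b g" "b h"]
      by (simp add: squared_dist_def K_def H.ip_minus_left H.ip_minus_right b_mem)
  qed
  have "squared_dist K (\<gamma> \<otimes> g) (\<gamma> \<otimes> h) = squared_dist K g h"
    if "\<gamma> \<in> carrier G" "g \<in> carrier G" "h \<in> carrier G" for \<gamma> g h
    using that aff by (simp add: sq b_mult affine_isometric_action_def b_mem)
  moreover have "finite {g \<in> carrier G. squared_dist K \<one> g \<le> R}" for R
  proof -
    \<comment> \<open>The ball contains the origin and, when the squared distance is at most
      \<open>R\<close>, also its image \<open>b g\<close>, so g is among the finitely many returning
      elements.\<close>
    let ?B = "H.mcball \<zero>\<^bsub>H\<^esub> (sqrt \<bar>R\<bar>)"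
    have "\<phi> g ` ?B \<inter> ?B \<noteq> {}" if g: "g \<in> carrier G" and R: "squared_dist K \<one> g \<le> R" for g
    proof -
      have "ip_dist H ip \<zero>\<^bsub>H\<^esub> (b g) \<le> sqrt \<bar>R\<bar>"
        using R g by (intro real_le_rsqrt) (simp add: sq b_one)
      then have "b g \<in> ?B" using b_mem[OF g] by simp
      moreover have "\<zero>\<^bsub>H\<^esub> \<in> ?B" by simp
      ultimately show ?thesis unfolding b_def by blast
    qed
    moreover have "finite {g \<in> carrier G. \<phi> g ` ?B \<inter> ?B \<noteq> {}}"
      using proper H.mbounded_mcball unfolding metrically_proper_def by blast
    ultimately show ?thesis by (elim finite_subset[rotated]) blast
  qed
  ultimately show ?thesis
    using percolation_of_kernel[OF inf _ _ _ _ \<alpha>, of K] by blast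
qed

end

theorem theorem1p1:
  fixes G :: "('a, 'b) monoid_scheme" and S :: "'a set"
  assumes "group G" and "infinite (carrier G)"
    and "finite_symmetric_generating_set G S"
    and universe: "(UNIV :: real set) \<lesssim> (UNIV :: 'h set)"
  shows "haagerup TYPE('h) G \<longleftrightarrow>
    (\<forall>\<alpha>::real. \<alpha> < 1 \<longrightarrow>
      (\<exists>P. bond_percolation (cayley_edges G S) P \<and> invariant_percolation G P \<and>
         (\<integral>\<omega>. real (degree_in \<omega> \<one>\<^bsub>G\<^esub>) \<partial>P) > \<alpha> * real (degree_in (cayley_edges G S) \<one>\<^bsub>G\<^esub>) \<and>
         vanishes_at_infinity G (cayley_edges G S) (two_point P)))"
proof -
  interpret group G by fact
  interpret cayley_graph G S by unfold_locales fact
  show ?thesis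
    using percolations_of_haagerup[OF assms(2)] haagerup_of_percolations[OF assms(2) universe]
    by blast
qed

end
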